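(* Let $K\subset\mathbb{C}$ be a compact regular set and let $P\subset\Omega_K$ be compact, where $\Omega_K$ is the unbounded connected component of $\mathbb{C}\setminus K$. Let $\mu\in\mathcal{M}^+(K)$ with $\operatorname{supp}\mu=K$ and suppose that there exists $t>0$ such that $$\lim_{r\to0^+}\operatorname{cap}\left(\{z\in K:\mu(B(z,r))\ge r^t\}\right)=\operatorname{cap}(K).$$ Then $(K,\mu,P)$ has the rational Bernstein Markov property.
   Context: $\mathcal{M}^+(K)$ is the cone of positive finite Borel measures $\mu$ with $\operatorname{supp}\mu\subseteq K$; $\mathcal{M}^+_1(K)$ is its subset of probability measures. $B(z,r)$ is the disc of center $z$ and radius $r$ (open, say). $\|g\|_K=\sup_{z\in K}|g(z)|$ and $\|g\|_{L^2_\mu}=(\int|g|^2\,d\mu)^{1/2}$. Logarithmic capacity: $\operatorname{cap}(K):=\sup_{\mu\in\mathcal{M}^+_1(K)}\exp(-I[\mu])$, where $I[\mu]:=\int\int\log\frac1{|z-\zeta|}\,d\mu(z)\,d\mu(\zeta)$; for a Borel set the supremum is over probability measures with compact support contained in the set (and is $0$ if there are none). Regular: a compact set $K$ is regular if the Green function $g_K(\cdot,\infty)$ of $\Omega_K$ with logarithmic pole at $\infty$ exists as a classical Green function, vanishing continuously at every point of $\partial\Omega_K$; equivalently $g_K(\cdot,\infty)$ (extended by $0$ off $\Omega_K$) is continuous on $\mathbb{C}$. Rational Bernstein Markov property of $(K,\mu,P)$, for disjoint compact sets $K,P$: $\limsup_k\left(\|r_k\|_K/\|r_k\|_{L^2_\mu}\right)^{1/k}\le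 1$ for every sequence $\{r_k\}$ of the form $r_k=p_k/q_k$ with $p_k,q_k$ complex polynomials of degree at most $k$ and $\{z\in\mathbb{C}:q_k(z)=0\}\subseteq P$ for all $k\in\mathbb{N}$ (only $r_k$ not vanishing identically on $K$ are considered, and a ratio is $+\infty$ if its denominator is $0$ and its numerator is positive). *)

theory Defs
  imports
    "HOL-Analysis.Analysis"
    "HOL-Probability.Probability_Measure"
    "HOL-Library.Landau_Symbols"
    "HOL-Computational_Algebra.Polynomial"
begin

section \<open>Measures\<close>

definition measure_supp :: "complex measure \<Rightarrow> complex set" where
  "measure_supp \<mu> = {z. \<forall>r>0. 0 < emeasure \<mu> (ball z r)}"

definition pos_measures :: "complex set \<Rightarrow> complex measure set" where
  "pos_measures E = {\<mu>. finite_measure \<mu> \<and> sets \<mu> = sets borel \<and> measure_supp \<mu> \<subseteq> E}"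

definition prob_measures :: "complex set \<Rightarrow> complex measure set" where
  "prob_measures E = {\<mu> \<in> pos_measures E. prob_space \<mu>}"


section \<open>Logarithmic capacity\<close>

definition log_kernel :: "complex \<Rightarrow> complex \<Rightarrow> ereal" where
  "log_kernel z w = (if z = w then \<infinity> else ereal (ln (1 / dist z w)))"

text \<open>
  The energy is the iterated integral of the positive part of the kernel minus that of its
  negative part; \<open>e2ennreal\<close> sends negative values to \<open>0\<close>. For a finite measure with
  compact support the second term is finite, so the value lies in \<open>(-\<infinity>, \<infinity>]\<close>.
\<close>
definition log_energy :: "complex measure \<Rightarrow> ereal" where
  "log_energy \<mu> =
     enn2ereal (\<integral>\<^sup>+z. (\<integral>\<^sup>+w. e2ennreal (log_kernel z w) \<partial>\<mu>) \<partial>\<mu>)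
   - enn2ereal (\<integral>\<^sup>+z. (\<integral>\<^sup>+w. e2ennreal (- log_kernel z w) \<partial>\<mu>) \<partial>\<mu>)"

text \<open>\<open>exp (- I)\<close> for \<open>I \<in> (-\<infinity>, \<infinity>]\<close>, with \<open>exp (-\<infinity>) = 0\<close>.\<close>
definition exp_neg :: "ereal \<Rightarrow> ennreal" where
  "exp_neg I = (if I = \<infinity> then 0 else ennreal (exp (- real_of_ereal I)))"

text \<open>
  The supremum is taken in \<open>ennreal\<close>: it is \<open>0\<close> if there is no admissible measure. If \<open>E\<close> is
  compact, then the compactness condition on the support is automatic.
\<close>
definition log_cap :: "complex set \<Rightarrow> ennreal" where
  "log_cap E = (SUP \<nu> \<in> {\<nu> \<in> prob_measures E. compact (measure_supp \<nu>)}. exp_neg (log_energy \<nu>))"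


section \<open>Regular compact sets\<close>

text \<open>
  \<open>f\<close> is twice continuously differentiable on the open set \<open>S\<close> with vanishing Laplacian. The
  first and second partial derivatives are \<open>fx, fy, fxx, fxy, fyy\<close>; the mixed ones agree
  by Schwarz's theorem.
\<close>
definition harmonic_on :: "(complex \<Rightarrow> real) \<Rightarrow> complex set \<Rightarrow> bool" where
  "harmonic_on f S \<longleftrightarrow> open S \<and>
     (\<exists>fx fy fxx fxy fyy :: complex \<Rightarrow> real.
        continuous_on S fxx \<and> continuous_on S fxy \<and> continuous_on S fyy \<and>
        (\<forall>z\<in>S. (f has_derivative (\<lambda>h. fx z * Re h + fy z * Im h)) (at z) \<and>
               (fx has_derivative (\<lambda>h. fxx z * Re h + fxy z * Im h)) (at z) \<and>
               (fy has_derivative (\<lambda>h. fxy z * Re h + fyy z * Im h)) (at z) \<and>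
               fxx z + fyy z = 0))"

text \<open>
  For compact \<open>K \<subseteq> \<complex>\<close>, \<open>outside K\<close> is the unbounded connected component of \<open>\<complex> - K\<close>.
  Harmonicity at \<open>\<infinity>\<close> of \<open>g(z) - log |z|\<close> is expressed by boundedness near \<open>\<infinity>\<close>
  (removable singularity).
\<close>
definition classical_green_function :: "complex set \<Rightarrow> (complex \<Rightarrow> real) \<Rightarrow> bool" where
  "classical_green_function K g \<longleftrightarrow>
     harmonic_on g (outside K) \<and>
     (\<forall>z\<in>outside K. 0 \<le> g z) \<and>
     (\<lambda>z. g z - ln (norm z)) \<in> O[at_infinity](\<lambda>_. 1) \<and>
     (\<forall>w\<in>frontier (outside K). (g \<longlongrightarrow> 0) (at w within outside K))"

definition regular_compact :: "complex set \<Rightarrow> bool" where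
  "regular_compact K \<longleftrightarrow> compact K \<and> (\<exists>g. classical_green_function K g)"


section \<open>The rational Bernstein Markov property\<close>

definition sup_norm_on :: "complex set \<Rightarrow> (complex \<Rightarrow> complex) \<Rightarrow> real" where
  "sup_norm_on K f = (SUP z\<in>K. norm (f z))"

definition L2_norm :: "complex measure \<Rightarrow> (complex \<Rightarrow> complex) \<Rightarrow> real" where
  "L2_norm \<mu> f = sqrt (LINT z|\<mu>. (norm (f z))\<^sup>2)"

text \<open>
  The value \<open>0\<close> for \<open>f\<close> vanishing identically on \<open>K\<close> makes such terms irrelevant for an
  upper bound on the limes superior, i.e.\ they are not considered.
\<close>
definition norm_ratio_root :: "complex set \<Rightarrow> complex measure \<Rightarrow> (complex \<Rightarrow> complex) \<Rightarrow> nat \<Rightarrow> ereal"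
where
  "norm_ratio_root K \<mu> f k =
     (if \<forall>z\<in>K. f z = 0 then 0
      else if L2_norm \<mu> f = 0 then \<infinity>
      else ereal ((sup_norm_on K f / L2_norm \<mu> f) powr (1 / real k)))"

text \<open>
  Used for disjoint compact \<open>K\<close> and \<open>P\<close>. As \<open>P\<close> is bounded, the condition on the
  zeros forces \<open>q k \<noteq> 0\<close>.
\<close>
definition rational_Bernstein_Markov :: "complex set \<Rightarrow> complex measure \<Rightarrow> complex set \<Rightarrow> bool" where
  "rational_Bernstein_Markov K \<mu> P \<longleftrightarrow>
     (\<forall>p q :: nat \<Rightarrow> complex poly.
        (\<forall>k. degree (p k) \<le> k \<and> degree (q k) \<le> k \<and> {z. poly (q k) z = 0} \<subseteq> P) \<longrightarrow>
        limsup (\<lambda>k. norm_ratio_root K \<mu> (\<lambda>z. poly (p k) z / poly (q k) z) k) \<le> 1)"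

end

theory Submission
  imports
    Defs
    "HOL-Complex_Analysis.Complex_Analysis"
    "HOL-Probability.Helly_Selection"
    "HOL-Computational_Algebra.Fundamental_Theorem_Algebra"
begin

text \<open>
  Let \<open>G\<close> be the Green function of the outer domain with pole at infinity, extended by \<open>0\<close>, and \<open>\<gamma>\<close> its
  Robin constant. By Bernstein--Walsh the Leja points of \<open>K\<close> have discrete energy at most \<open>\<gamma>\<close>, so a
  weak limit of their counting measures shows \<open>cap K \<ge> exp (- \<gamma>)\<close>. If a compact subset of \<open>K\<close>
  has capacity close to \<open>cap K\<close>, then a variation of the energy yields a measure \<open>\<nu>\<close> on it with
  \<open>log_pot \<nu> \<le> \<gamma> + \<epsilon>\<close> everywhere; thus \<open>w = \<gamma> + \<epsilon> - log_pot \<nu>\<close> is a non-negative barrier dominating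
  \<open>G\<close>, and \<open>w - G\<close>, being non-negative harmonic with value about \<open>\<epsilon>\<close> at infinity, is small on compact subsets
  of the outer domain by Harnack. A two-constants argument with \<open>w\<close> in \<open>{G < e0}\<close>, which avoids \<open>P\<close>,
  transfers bounds for rational functions from the subset to \<open>K\<close>.

  For the subset one takes the points with \<open>\<mu> (ball z \<rho>) \<ge> \<rho> powr t\<close> where \<open>\<rho> = exp (- \<eta> k)\<close>: each has a
  point nearby at which the \<open>L\<^sup>2\<close> norm controls the function, and the derivative is controlled by the Cauchy estimate.
\<close>

text \<open>The subset and its measure change with the degree \<open>k\<close>, so every constant in
  the transfer to \<open>K\<close> must be independent of them: the Harnack constant depends only on
  the outer domain, a level set of \<open>G\<close> and a circle, and the \<epsilon> of the
  comparison only on \<open>K\<close>, \<open>P\<close> and the accepted loss. The exponents balance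
  as follows. At radius \<open>exp (- \<eta> k)\<close> the mass bound turns the L2 norm into a
  pointwise bound at the cost of \<open>exp (\<eta> t k / 2)\<close>. Moving by that radius changes
  the function by at most the radius times a constant times \<open>M exp (\<eta> k / 2)\<close>,
  with \<open>M\<close> the sup norm on \<open>K\<close>; the two-constants step multiplies
  everything by \<open>exp (\<eta> k / 4)\<close>. The displacement term is then a constant times
  \<open>M exp (- \<eta> k / 4)\<close>, for large \<open>k\<close> below \<open>M / 2\<close>, and
  is absorbed. What remains is a growth rate of order \<eta>, and \<eta> is arbitrary. Poles prevent
  a direct use of Bernstein-Walsh for quotients: it is applied to the numerator, while the
  denominator varies by at most a geometric factor on \<open>{G \<le> e0}\<close>. The resulting
  fixed rate is made arbitrarily small by comparison with \<open>G\<close> near \<open>K\<close> and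
  with the barrier from the subset.\<close>

section \<open>Maximum principle and Harnack inequality\<close>

text \<open>Harmonicity in the form needed for maximum principles: \<open>exp h\<close> is locally the modulus of a
  holomorphic function.\<close>

definition real_part_on_discs :: "(complex \<Rightarrow> real) \<Rightarrow> complex set \<Rightarrow> bool" where
  "real_part_on_discs h S \<longleftrightarrow>
     (\<forall>z r. 0 < r \<and> ball z r \<subseteq> S \<longrightarrow>
        (\<exists>F. F holomorphic_on ball z r \<and> (\<forall>w\<in>ball z r. h w = Re (F w))))"

lemma real_part_on_discsD:
  assumes "real_part_on_discs h S" "0 < r" "ball z r \<subseteq> S"
  obtains F where "F holomorphic_on ball z r" "\<And>w. w \<in> ball z r \<Longrightarrow> h w = Re (F w)"
  using assms unfolding real_part_on_discs_def by blast

lemma real_part_on_discs_subset: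
  "real_part_on_discs h S \<Longrightarrow> T \<subseteq> S \<Longrightarrow> real_part_on_discs h T"
  unfolding real_part_on_discs_def by blast

lemma real_part_on_discs_const: "real_part_on_discs (\<lambda>_. c) S"
  unfolding real_part_on_discs_def
  by (auto intro!: exI[of _ "\<lambda>_. complex_of_real c"])

lemma real_part_on_discs_add:
  assumes "real_part_on_discs h S" "real_part_on_discs k S"
  shows "real_part_on_discs (\<lambda>z. h z + k z) S"
  unfolding real_part_on_discs_def
proof (intro allI impI)
  fix z r assume *: "0 < r \<and> ball z r \<subseteq> S"
  obtain F where F: "F holomorphic_on ball z r" "\<And>w. w \<in> ball z r \<Longrightarrow> h w = Re (F w)"
    using real_part_on_discsD[OF assms(1)] * by metis
  obtain G where G: "G holomorphic_on ball z r" "\<And>w. w \<in> ball z r \<Longrightarrow> k w = Re (G w)"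
    using real_part_on_discsD[OF assms(2)] * by metis
  show "\<exists>H. H holomorphic_on ball z r \<and> (\<forall>w\<in>ball z r. h w + k w = Re (H w))"
    using F G by (intro exI[of _ "\<lambda>w. F w + G w"]) (auto intro: holomorphic_intros)
qed

lemma real_part_on_discs_cmult:
  assumes "real_part_on_discs h S"
  shows "real_part_on_discs (\<lambda>z. c * h z) S"
  unfolding real_part_on_discs_def
proof (intro allI impI)
  fix z r assume *: "0 < r \<and> ball z r \<subseteq> S"
  obtain F where F: "F holomorphic_on ball z r" "\<And>w. w \<in> ball z r \<Longrightarrow> h w = Re (F w)"
    using real_part_on_discsD[OF assms(1)] * by metis
  show "\<exists>H. H holomorphic_on ball z r \<and> (\<forall>w\<in>ball z r. c * h w = Re (H w))"
    using F by (intro exI[of _ "\<lambda>w. complex_of_real c * F w"]) (auto intro!: holomorphic_intros)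
qed

lemma real_part_on_discs_diff:
  assumes "real_part_on_discs h S" "real_part_on_discs k S"
  shows "real_part_on_discs (\<lambda>z. h z - k z) S"
  using real_part_on_discs_add[OF assms(1) real_part_on_discs_cmult[OF assms(2), of "-1"]] by simp

lemma real_part_on_discs_minus:
  assumes "real_part_on_discs h S"
  shows "real_part_on_discs (\<lambda>z. - h z) S"
  using real_part_on_discs_cmult[OF assms(1), of "-1"] by simp

lemma real_part_on_discs_continuous:
  assumes "real_part_on_discs h S" "open S"
  shows "continuous_on S h"
proof -
  have "isCont h z" if z: "z \<in> S" for z
  proof -
    obtain r where r: "r > 0" "ball z r \<subseteq> S"
      using assms(2) z open_contains_ball by blast
    obtain F where F: "F holomorphic_on ball z r" "\<And>w. w \<in> ball z r \<Longrightarrow> h w = Re (F w)"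
      using real_part_on_discsD[OF assms(1) r] by blast
    have "continuous_on (ball z r) (\<lambda>w. Re (F w))"
      using F(1) by (intro continuous_intros holomorphic_on_imp_continuous_on)
    then have "continuous_on (ball z r) h"
      by (rule continuous_on_eq) (use F(2) in simp)
    then show ?thesis
      using r(1) by (simp add: continuous_on_eq_continuous_at)
  qed
  then show ?thesis
    by (simp add: continuous_at_imp_continuous_on)
qed

text \<open>By the Laplace equation and the equality of the mixed derivatives,
  \<open>fx - i fy\<close> satisfies the Cauchy-Riemann equations. A primitive of it on a disc has a
  real part with the same gradient as \<open>h\<close>, hence differs from \<open>h\<close> by a
  constant there.\<close>

lemma harmonic_on_real_part_on_discs:
  assumes "harmonic_on h S"
  shows "real_part_on_discs h S"
  unfolding real_part_on_discs_def
proof (intro allI impI)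
  fix z0 r assume *: "0 < r \<and> ball z0 r \<subseteq> S"
  obtain fx fy fxx fxy fyy :: "complex \<Rightarrow> real" where
    d: "\<And>z. z \<in> S \<Longrightarrow> (h has_derivative (\<lambda>u. fx z * Re u + fy z * Im u)) (at z) \<and>
               (fx has_derivative (\<lambda>u. fxx z * Re u + fxy z * Im u)) (at z) \<and>
               (fy has_derivative (\<lambda>u. fxy z * Re u + fyy z * Im u)) (at z) \<and>
               fxx z + fyy z = 0"
    using assms unfolding harmonic_on_def by blast
  define F where "F z = Complex (fx z) (- fy z)" for z
  have dF: "(F has_field_derivative Complex (fxx z) (- fxy z)) (at z)" if "z \<in> S" for z
  proof -
    have "((\<lambda>z. of_real (fx z) - \<i> * of_real (fy z)) has_derivative
            (\<lambda>u. of_real (fxx z * Re u + fxy z * Im u) - \<i> * of_real (fxy z * Re u + fyy z * Im u))) (at z)"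
      using d[OF that] by (auto intro!: derivative_eq_intros)
    moreover have "(\<lambda>z. of_real (fx z) - \<i> * of_real (fy z)) = F"
      by (auto simp: F_def complex_eq_iff)
    moreover have "(\<lambda>u. of_real (fxx z * Re u + fxy z * Im u) - \<i> * of_real (fxy z * Re u + fyy z * Im u))
        = (*) (Complex (fxx z) (- fxy z))"
    proof -
      have "fyy z = - fxx z" using d[OF that] by linarith
      then show ?thesis
        by (auto simp: complex_eq_iff algebra_simps fun_eq_iff)
    qed
    ultimately show ?thesis
      by (simp add: has_field_derivative_def)
  qed
  have holF: "F holomorphic_on ball z0 r"
    using dF * by (auto simp: holomorphic_on_open intro: exI)
  obtain G where G: "\<And>x. x \<in> ball z0 r \<Longrightarrow> (G has_field_derivative F x) (at x within ball z0 r)"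
    using holomorphic_convex_primitive'[OF convex_ball open_ball holF] by metis
  have G': "(G has_field_derivative F x) (at x)" if "x \<in> ball z0 r" for x
    using G[OF that] that by (simp add: at_within_open[OF _ open_ball])
  have "\<exists>c. \<forall>x\<in>ball z0 r. h x - Re (G x) = c"
  proof (rule has_derivative_zero_constant[OF convex_ball])
    fix x assume x: "x \<in> ball z0 r"
    have "(G has_derivative (*) (F x)) (at x)"
      using G'[OF x] by (simp add: has_field_derivative_def)
    then have "((\<lambda>x. Re (G x)) has_derivative (\<lambda>u. Re (F x * u))) (at x)"
      by (rule bounded_linear.has_derivative[OF bounded_linear_Re])
    moreover have "(h has_derivative (\<lambda>u. fx x * Re u + fy x * Im u)) (at x)"
      using d[of x] x * by auto
    ultimately have "((\<lambda>x. h x - Re (G x)) has_derivative (\<lambda>u. (fx x * Re u + fy x * Im u) - Re (F x * u))) (at x)"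
      by (intro has_derivative_diff)
    moreover have "(\<lambda>u. (fx x * Re u + fy x * Im u) - Re (F x * u)) = (\<lambda>u. 0)"
      by (auto simp: F_def)
    ultimately show "((\<lambda>x. h x - Re (G x)) has_derivative (\<lambda>u. 0)) (at x within ball z0 r)"
      by (simp add: has_derivative_at_withinI)
  qed
  then obtain c where c: "\<And>x. x \<in> ball z0 r \<Longrightarrow> h x - Re (G x) = c" by blast
  have "(\<lambda>x. G x + of_real c) holomorphic_on ball z0 r"
    using G by (auto simp: holomorphic_on_def field_differentiable_def intro!: holomorphic_intros derivative_eq_intros exI)
  moreover have "\<forall>w\<in>ball z0 r. h w = Re (G w + of_real c)"
    using c by (auto simp: algebra_simps)
  ultimately show "\<exists>F. F holomorphic_on ball z0 r \<and> (\<forall>w\<in>ball z0 r. h w = Re (F w))"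
    by blast
qed

text \<open>Compactness of the superlevel sets makes the set where the maximum is attained compact as
  well as open, hence empty.\<close>

lemma maximum_principle_compact:
  assumes S: "open S" and f: "f holomorphic_on S" and h: "real_part_on_discs h S"
    and cpt: "\<And>c. c > B \<Longrightarrow> compact {z \<in> S. c \<le> norm (f z) * exp (h z)}"
    and z: "z \<in> S"
  shows "norm (f z) * exp (h z) \<le> B"
proof (rule ccontr)
  define \<Phi> where "\<Phi> z = norm (f z) * exp (h z)" for z
  assume "\<not> ?thesis"
  then have gt: "\<Phi> z > B" by (simp add: \<Phi>_def)
  define T where "T = {w \<in> S. \<Phi> z \<le> \<Phi> w}"
  have T: "compact T" "z \<in> T" "T \<subseteq> S"
    using cpt[OF gt] z by (auto simp: T_def \<Phi>_def)
  have cont: "continuous_on S \<Phi>"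
    unfolding \<Phi>_def
    using f h S by (intro continuous_intros holomorphic_on_imp_continuous_on real_part_on_discs_continuous)
  obtain m where m: "m \<in> T" "\<And>w. w \<in> T \<Longrightarrow> \<Phi> w \<le> \<Phi> m"
    using continuous_attains_sup[OF T(1)] T continuous_on_subset[OF cont T(3)] by blast
  have max: "\<Phi> w \<le> \<Phi> m" if "w \<in> S" for w
    using m that by (force simp: T_def)
  define A where "A = {w \<in> T. \<Phi> w = \<Phi> m}"
  have "closed A"
  proof -
    have "closed {w \<in> T. \<Phi> w = \<Phi> m}"
      by (intro continuous_closed_preimage_constant continuous_on_subset[OF cont T(3)] compact_imp_closed T)
    then show ?thesis by (simp add: A_def)
  qed
  moreover have "open A"
    unfolding open_contains_ball
  proof
    fix a assume "a \<in> A"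
    then have a: "a \<in> S" "\<Phi> a = \<Phi> m" "\<Phi> z \<le> \<Phi> a" by (auto simp: A_def T_def)
    obtain r where r: "r > 0" "ball a r \<subseteq> S"
      using S a open_contains_ball by blast
    obtain F where F: "F holomorphic_on ball a r" "\<And>w. w \<in> ball a r \<Longrightarrow> h w = Re (F w)"
      using real_part_on_discsD[OF h r] by blast
    define k where "k w = f w * exp (F w)" for w
    have k: "k holomorphic_on ball a r"
      unfolding k_def using F(1) f r by (auto intro!: holomorphic_intros intro: holomorphic_on_subset)
    have nk: "norm (k w) = \<Phi> w" if "w \<in> ball a r" for w
      using F(2)[OF that] by (simp add: k_def \<Phi>_def norm_mult norm_exp_eq_Re)
    have "k constant_on ball a r"
    proof (rule maximum_modulus_principle[OF k open_ball connected_ball open_ball subset_refl])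
      show "a \<in> ball a r" using r by simp
      fix w assume "w \<in> ball a r"
      then show "norm (k w) \<le> norm (k a)"
        using nk max r a by (metis (no_types, lifting) centre_in_ball in_mono)
    qed
    then have "\<Phi> w = \<Phi> a" if "w \<in> ball a r" for w
      using nk[OF that] nk[of a] r that unfolding constant_on_def by (metis centre_in_ball)
    then have "ball a r \<subseteq> A"
      using a r by (auto simp: A_def T_def)
    then show "\<exists>e>0. ball a e \<subseteq> A" using r by blast
  qed
  moreover have "m \<in> A" using m by (simp add: A_def)
  ultimately have "A = UNIV"
    using clopen[of A] by blast
  moreover have "bounded A"
    using T compact_imp_bounded bounded_subset[of T A] by (auto simp: A_def)
  ultimately show False
    using not_bounded_UNIV[where 'a=complex] by simp
qed

text \<open>The boundary conditions, with infinity treated as a boundary point, keep each superlevel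
  set above \<open>B\<close> bounded and away from the frontier, hence compact. They are stated as
  upper limits because \<open>f\<close> and \<open>h\<close> are controlled only inside
  \<open>S\<close>; \<open>S\<close> may be unbounded and disconnected.\<close>

lemma maximum_principle:
  assumes S: "open S" and f: "f holomorphic_on S" and h: "real_part_on_discs h S"
    and fr: "\<And>\<xi> c. \<xi> \<in> frontier S \<Longrightarrow> c > B \<Longrightarrow> \<forall>\<^sub>F z in at \<xi> within S. norm (f z) * exp (h z) < c"
    and inf: "\<And>c. c > B \<Longrightarrow> \<forall>\<^sub>F z in at_infinity. z \<in> S \<longrightarrow> norm (f z) * exp (h z) < c"
    and z: "z \<in> S"
  shows "norm (f z) * exp (h z) \<le> B"
proof (rule maximum_principle_compact[OF S f h _ z])
  fix c assume c: "c > B"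
  define \<Phi> where "\<Phi> z = norm (f z) * exp (h z)" for z
  have cont: "continuous_on S \<Phi>"
    unfolding \<Phi>_def
    using f h S by (intro continuous_intros holomorphic_on_imp_continuous_on real_part_on_discs_continuous)
  define T where "T = {z \<in> S. c \<le> \<Phi> z}"
  have "bounded T"
  proof -
    obtain b where "\<And>z. b \<le> norm z \<Longrightarrow> z \<in> S \<longrightarrow> norm (f z) * exp (h z) < c"
      using inf[OF c] unfolding eventually_at_infinity by blast
    then have "norm z \<le> b" if "z \<in> T" for z
      using that unfolding T_def \<Phi>_def by (metis (no_types, lifting) linorder_linear mem_Collect_eq not_le)
    then show ?thesis by (auto simp: bounded_iff)
  qed
  moreover have "closed T"
    unfolding closed_limpt
  proof (intro allI impI)
    fix x assume x: "x islimpt T"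
    have xS: "x \<in> closure S"
      using x by (metis (no_types, lifting) T_def closure_def UnCI islimpt_subset mem_Collect_eq subsetI)
    have "x \<in> S"
    proof (rule ccontr)
      assume "x \<notin> S"
      then have "x \<in> frontier S" using xS S by (simp add: frontier_def interior_open)
      then have "\<forall>\<^sub>F z in at x within S. \<Phi> z < c" using fr c by (auto simp: \<Phi>_def)
      then obtain d where "d > 0" "\<And>z. z \<in> S \<Longrightarrow> z \<noteq> x \<Longrightarrow> dist z x < d \<Longrightarrow> \<Phi> z < c"
        unfolding eventually_at by blast
      moreover obtain y where "y \<in> T" "y \<noteq> x" "dist y x < d"
        using x \<open>d > 0\<close> unfolding islimpt_approachable by blast
      ultimately show False by (force simp: T_def)
    qed
    moreover have "c \<le> \<Phi> x"
    proof (rule ccontr)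
      assume "\<not> c \<le> \<Phi> x"
      then have "\<Phi> x < c" by simp
      moreover have "(\<Phi> \<longlongrightarrow> \<Phi> x) (at x)"
        using cont S \<open>x \<in> S\<close> by (simp add: continuous_on_eq_continuous_at isContD)
      ultimately have "\<forall>\<^sub>F z in at x. \<Phi> z < c" by (auto dest: order_tendstoD)
      then obtain d where "d > 0" "\<And>z. z \<noteq> x \<Longrightarrow> dist z x < d \<Longrightarrow> \<Phi> z < c"
        unfolding eventually_at by blast
      moreover obtain y where "y \<in> T" "y \<noteq> x" "dist y x < d"
        using x \<open>d > 0\<close> unfolding islimpt_approachable by blast
      ultimately show False by (force simp: T_def)
    qed
    ultimately show "x \<in> T" by (simp add: T_def)
  qed
  ultimately show "compact {z \<in> S. c \<le> norm (f z) * exp (h z)}"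
    by (simp add: T_def \<Phi>_def compact_eq_bounded_closed)
qed

text \<open>A Cayley transform turns the holomorphic function with real part \<open>h\<close> into a
  self-map of the unit disc fixing 0, and the Schwarz lemma bounds it by 1/2 on the concentric disc
  of half the radius. The constant 3 is \<open>(1 + 1/2) / (1 - 1/2)\<close>.\<close>

lemma Harnack_disc:
  assumes h: "real_part_on_discs h S" and r: "0 < r" "ball z0 r \<subseteq> S"
    and nonneg: "\<And>z. z \<in> S \<Longrightarrow> 0 \<le> h z"
    and z: "dist z0 z \<le> r / 2"
  shows "h z \<le> 3 * h z0" "h z0 \<le> 3 * h z"
proof -
  obtain F where F: "F holomorphic_on ball z0 r" "\<And>w. w \<in> ball z0 r \<Longrightarrow> h w = Re (F w)"
    using real_part_on_discsD[OF h r] by blast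
  have zr: "z \<in> ball z0 r" using z r by simp
  \<comment> \<open>The shift by \<open>e\<close> makes the real part strictly positive, since
    \<open>h\<close> itself may vanish; \<open>e\<close> goes to 0 at the end.\<close>
  have main: "h z + e \<le> 3 * (h z0 + e) \<and> h z0 + e \<le> 3 * (h z + e)" if e: "e > 0" for e
  proof -
    define a where "a = h z0 + e"
    have a: "a > 0" using nonneg[of z0] r e by (auto simp: a_def subset_iff)
    \<comment> \<open>Subtracting the imaginary part at the centre makes \<open>G z0\<close> the
      positive real number \<open>a\<close>, so that the Cayley transform \<open>f\<close> below
      vanishes at 0.\<close>
    define G where "G w = F w + of_real e - \<i> * of_real (Im (F z0))" for w
    have G: "G holomorphic_on ball z0 r" unfolding G_def using F(1) by (intro holomorphic_intros)
    have reG: "Re (G w) = h w + e" if "w \<in> ball z0 r" for w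
      using F(2)[OF that] by (simp add: G_def)
    have posG: "Re (G w) > 0" if "w \<in> ball z0 r" for w
      using reG[OF that] nonneg[of w] that r(2) e by auto
    have G0: "G z0 = of_real a"
      using reG[of z0] r by (simp add: complex_eq_iff a_def) (simp add: G_def)
    define f where "f \<zeta> = (G (z0 + of_real r * \<zeta>) - of_real a) / (G (z0 + of_real r * \<zeta>) + of_real a)" for \<zeta>
    have in_ball: "z0 + of_real r * \<zeta> \<in> ball z0 r" if "norm \<zeta> < 1" for \<zeta>
      using that r by (simp add: dist_norm norm_mult)
    have nz: "G w + of_real a \<noteq> 0" if "w \<in> ball z0 r" for w
    proof
      assume "G w + of_real a = 0"
      then have "Re (G w) + a = 0" by (simp add: complex_eq_iff)
      then show False using posG[OF that] a by linarith
    qed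
    have lt1: "norm (X - of_real a) < norm (X + of_real a)" if "Re X > 0" for X :: complex
    proof -
      have "(norm (X + of_real a))\<^sup>2 - (norm (X - of_real a))\<^sup>2 = 4 * a * Re X"
        unfolding cmod_power2 by (simp add: power2_eq_square algebra_simps)
      then have "(norm (X - of_real a))\<^sup>2 < (norm (X + of_real a))\<^sup>2" using that a by (smt (verit) mult_pos_pos)
      then show ?thesis using norm_ge_zero power2_less_imp_less by blast
    qed
    have hf: "f holomorphic_on ball 0 1"
    proof -
      have "(\<lambda>\<zeta>. z0 + of_real r * \<zeta>) ` ball 0 1 \<subseteq> ball z0 r"
        using in_ball by auto
      moreover have "(\<lambda>\<zeta>. z0 + of_real r * \<zeta>) holomorphic_on ball 0 1"
        by (intro holomorphic_intros)
      ultimately have "(\<lambda>\<zeta>. G (z0 + of_real r * \<zeta>)) holomorphic_on ball 0 1"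
        using holomorphic_on_compose_gen[OF _ G] by (auto simp: o_def)
      then show ?thesis unfolding f_def using in_ball nz
        by (intro holomorphic_intros) auto
    qed
    have f0: "f 0 = 0" by (simp add: f_def G0)
    have fl: "norm (f \<zeta>) < 1" if "norm \<zeta> < 1" for \<zeta>
      using lt1[OF posG[OF in_ball[OF that]]] by (simp add: f_def norm_divide divide_less_eq_1) 
    define \<zeta> where "\<zeta> = (z - z0) / of_real r"
    have z\<zeta>: "z0 + of_real r * \<zeta> = z" using r by (simp add: \<zeta>_def)
    have n\<zeta>: "norm \<zeta> \<le> 1/2" using z r by (simp add: \<zeta>_def norm_divide dist_norm norm_minus_commute field_simps)
    have "norm (f \<zeta>) \<le> norm \<zeta>" using Schwarz_Lemma(1)[OF hf f0 fl] n\<zeta> by simp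
    then have "norm (f \<zeta>) \<le> 1/2" using n\<zeta> by linarith
    then have "norm (G z - of_real a) \<le> norm (G z + of_real a) / 2"
      using nz[OF zr] unfolding f_def z\<zeta> by (simp add: norm_divide field_simps)
    then have "(norm (G z - of_real a))\<^sup>2 \<le> (norm (G z + of_real a) / 2)\<^sup>2"
      by (intro power_mono) auto
    then have "4 * ((Re (G z) - a)\<^sup>2 + (Im (G z))\<^sup>2) \<le> (Re (G z) + a)\<^sup>2 + (Im (G z))\<^sup>2"
      by (simp add: cmod_power2 power_divide)
    moreover have "4 * (X + Y) \<le> Z + Y \<Longrightarrow> 0 \<le> Y \<Longrightarrow> 4 * X \<le> Z" for X Y Z :: real
      unfolding distrib_left by linarith
    ultimately have "4 * (Re (G z) - a)\<^sup>2 \<le> (Re (G z) + a)\<^sup>2"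
      using zero_le_power2 by blast
    then have "(2 * \<bar>Re (G z) - a\<bar>)\<^sup>2 \<le> (Re (G z) + a)\<^sup>2"
      by (simp add: power_mult_distrib)
    then have "2 * \<bar>Re (G z) - a\<bar> \<le> Re (G z) + a"
      by (rule power2_le_imp_le) (use posG[OF zr] a in simp)
    then have "2 * \<bar>(h z + e) - a\<bar> \<le> (h z + e) + a" by (simp only: reG[OF zr])
    moreover have "2 * \<bar>X - Y\<bar> \<le> X + Y \<Longrightarrow> X \<le> 3 * Y \<and> Y \<le> 3 * X" for X Y :: real
      by (simp add: abs_if split: if_splits)
    ultimately show ?thesis unfolding a_def by blast
  qed
  show "h z \<le> 3 * h z0"
  proof (rule field_le_epsilon)
    fix e :: real assume e: "e > 0"
    show "h z \<le> 3 * h z0 + e" using main[OF half_gt_zero[OF e]] unfolding distrib_left by linarith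
  qed
  show "h z0 \<le> 3 * h z"
  proof (rule field_le_epsilon)
    fix e :: real assume e: "e > 0"
    show "h z0 \<le> 3 * h z + e" using main[OF half_gt_zero[OF e]] unfolding distrib_left by linarith
  qed
qed

text \<open>Being comparable by a factor that works for all non-negative harmonic functions at once
  is an equivalence relation with open classes, so it holds between any two points of the connected
  set. A finite cover of \<open>Q\<close> makes the factor uniform. That \<open>C\<close> is fixed
  before \<open>h\<close> is what the application to varying measures relies on.\<close>

lemma Harnack_compact:
  assumes S: "open S" "connected S" and Q: "compact Q" "Q \<subseteq> S"
  obtains C where "C > 0"
    "\<And>h z w. \<lbrakk>real_part_on_discs h S; \<And>x. x \<in> S \<Longrightarrow> 0 \<le> h x; z \<in> Q; w \<in> Q\<rbrakk> \<Longrightarrow> h z \<le> C * h w"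
proof -
  define pos where "pos (h :: complex \<Rightarrow> real) \<longleftrightarrow> real_part_on_discs h S \<and> (\<forall>x\<in>S. 0 \<le> h x)" for h
  define R where "R z w \<longleftrightarrow> (\<exists>C>0. \<forall>h. pos h \<longrightarrow> h z \<le> C * h w \<and> h w \<le> C * h z)" for z w
  have R_local: "\<exists>r>0. ball a r \<subseteq> S \<and> (\<forall>h x. pos h \<longrightarrow> x \<in> ball a r \<longrightarrow> h a \<le> 3 * h x \<and> h x \<le> 3 * h a)" if a: "a \<in> S" for a :: complex
  proof -
    obtain r where r: "r > 0" "ball a r \<subseteq> S" using S a open_contains_ball by blast
    have "\<forall>h x. pos h \<longrightarrow> x \<in> ball a (r/2) \<longrightarrow> h a \<le> 3 * h x \<and> h x \<le> 3 * h a"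
      using Harnack_disc[OF _ r] by (auto simp: pos_def)
    moreover have "ball a (r/2) \<subseteq> S" using r subset_ball[of "r/2" r a] by auto
    ultimately show ?thesis using r by (intro exI[of _ "r/2"]) auto
  qed
  have R_all: "R a b" if "a \<in> S" "b \<in> S" for a b
  proof (rule connected_equivalence_relation[OF S(2) that])
    show "R y x" if "R x y" for x y using that unfolding R_def by blast
    show "R x z" if xy: "R x y" and yz: "R y z" for x y z
    proof -
      obtain C D where C: "C > 0" "\<And>h. pos h \<Longrightarrow> h x \<le> C * h y \<and> h y \<le> C * h x"
        and D: "D > 0" "\<And>h. pos h \<Longrightarrow> h y \<le> D * h z \<and> h z \<le> D * h y"
        using xy yz unfolding R_def by blast
      have "h x \<le> (C * D) * h z \<and> h z \<le> (C * D) * h x" if h: "pos h" for h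
      proof
        have "h x \<le> C * h y" using C h by blast
        also have "\<dots> \<le> C * (D * h z)" using C(1) D(2)[OF h] by (intro mult_left_mono) auto
        finally show "h x \<le> (C * D) * h z" by (simp add: mult.assoc)
        have "h z \<le> D * h y" using D h by blast
        also have "\<dots> \<le> D * (C * h x)" using D(1) C(2)[OF h] by (intro mult_left_mono) auto
        finally show "h z \<le> (C * D) * h x" by (simp add: mult_ac)
      qed
      then show ?thesis unfolding R_def using C(1) D(1) by (intro exI[of _ "C * D"]) auto
    qed
    show "\<exists>T. openin (top_of_set S) T \<and> a \<in> T \<and> (\<forall>x\<in>T. R a x)" if "a \<in> S" for a
    proof -
      from R_local[OF that] obtain r where r: "r > 0" "ball a r \<subseteq> S"
        and *: "\<forall>h x. pos h \<longrightarrow> x \<in> ball a r \<longrightarrow> h a \<le> 3 * h x \<and> h x \<le> 3 * h a"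
        by (elim exE conjE)
      have "R a x" if "x \<in> ball a r" for x
        unfolding R_def using * that by (intro exI[of _ 3]) auto
      then show ?thesis
        using r by (intro exI[of _ "ball a r"]) (auto simp: open_subset)
    qed
  qed
  show ?thesis
  proof (cases "Q = {}")
    case True
    then show ?thesis using that[of 1] by auto
  next
    case False
    then obtain z0 where z0: "z0 \<in> Q" by blast
    have "\<exists>r C. r > 0 \<and> C > 0 \<and> (\<forall>h x. pos h \<longrightarrow> x \<in> ball a r \<longrightarrow> h z0 \<le> C * h x \<and> h x \<le> C * h z0)" if a: "a \<in> Q" for a
    proof -
      have aS: "a \<in> S" "z0 \<in> S" using a z0 Q by auto
      from R_local[OF aS(1)] obtain r where r: "r > 0"
        and rh: "\<forall>h x. pos h \<longrightarrow> x \<in> ball a r \<longrightarrow> h a \<le> 3 * h x \<and> h x \<le> 3 * h a"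
        by (elim exE conjE)
      obtain C where C: "C > 0" "\<And>h. pos h \<Longrightarrow> h z0 \<le> C * h a \<and> h a \<le> C * h z0"
        using R_all[OF aS(2,1)] unfolding R_def by blast
      have "h z0 \<le> (C*3) * h x \<and> h x \<le> (C*3) * h z0" if h: "pos h" "x \<in> ball a r" for h x
      proof
        have "h z0 \<le> C * h a" using C h by blast
        also have "\<dots> \<le> C * (3 * h x)" using C(1) rh h by (intro mult_left_mono) auto
        finally show "h z0 \<le> (C*3) * h x" by (simp add: mult.assoc)
        have "h x \<le> 3 * h a" using rh h by blast
        also have "\<dots> \<le> 3 * (C * h z0)" using C(2)[OF h(1)] by (intro mult_left_mono) auto
        finally show "h x \<le> (C*3) * h z0" by (simp add: mult_ac)
      qed
      then show ?thesis using r C(1) by (intro exI[of _ r] exI[of _ "C*3"]) auto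
    qed
    then obtain r C where rC: "\<And>a. a \<in> Q \<Longrightarrow> r a > 0" "\<And>a. a \<in> Q \<Longrightarrow> C a > (0::real)"
      "\<And>a h x. a \<in> Q \<Longrightarrow> pos h \<Longrightarrow> x \<in> ball a (r a) \<Longrightarrow> h z0 \<le> C a * h x \<and> h x \<le> C a * h z0"
      by metis
    have "Q \<subseteq> (\<Union>a\<in>Q. ball a (r a))" using rC(1) by force
    then obtain Y where Y: "Y \<subseteq> Q" "finite Y" "Q \<subseteq> (\<Union>a\<in>Y. ball a (r a))"
      using compactE_image[OF Q(1), of Q "\<lambda>a. ball a (r a)"] by auto
    define M where "M = 1 + sum C Y"
    have C0: "0 \<le> C a" if "a \<in> Y" for a
      using Y(1) rC(2) that by (meson less_imp_le subsetD)
    have CM: "C a \<le> M" if "a \<in> Y" for a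
      using member_le_sum[OF that, of C] Y(2) C0 unfolding M_def by fastforce
    have M: "M > 0" unfolding M_def using sum_nonneg[of Y C] C0 by fastforce
    have unif: "h z0 \<le> M * h x \<and> h x \<le> M * h z0" if h: "pos h" and x: "x \<in> Q" for h x
    proof -
      obtain a where a: "a \<in> Y" "x \<in> ball a (r a)" using Y x by blast
      have nn: "h x \<ge> 0" "h z0 \<ge> 0" using h x z0 Q by (auto simp: pos_def)
      have "h z0 \<le> C a * h x \<and> h x \<le> C a * h z0" using rC(3) a Y h by blast
      moreover have "C a * h x \<le> M * h x" "C a * h z0 \<le> M * h z0"
        using CM[OF a(1)] nn by (auto intro: mult_right_mono)
      ultimately show ?thesis by linarith
    qed
    show ?thesis
    proof (rule that[of "M * M"])
      show "M * M > 0" using M by simp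
      fix h z w assume h: "real_part_on_discs h S" "\<And>x. x \<in> S \<Longrightarrow> 0 \<le> h x" and zw: "z \<in> Q" "w \<in> Q"
      have p: "pos h" using h by (auto simp: pos_def)
      have "h z \<le> M * h z0" using unif[OF p zw(1)] by blast
      also have "\<dots> \<le> M * (M * h w)" using unif[OF p zw(2)] M by (intro mult_left_mono) auto
      finally show "h z \<le> M * M * h w" by (simp add: mult.assoc)
    qed
  qed
qed

section \<open>Logarithmic potentials\<close>

text \<open>Being carried by \<open>A\<close> is required almost everywhere and not through
  \<open>measure_supp\<close>, a form that passes directly to densities and weak limits.\<close>

definition prob_on :: "complex set \<Rightarrow> complex measure \<Rightarrow> bool" where
  "prob_on A \<nu> \<longleftrightarrow> prob_space \<nu> \<and> sets \<nu> = sets borel \<and> (AE w in \<nu>. w \<in> A)"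

lemma prob_on_mono: "prob_on A \<nu> \<Longrightarrow> A \<subseteq> B \<Longrightarrow> prob_on B \<nu>"
  unfolding prob_on_def by (auto elim!: eventually_mono)

text \<open>Evaluated only off a compact carrier of the measure, where the kernel is bounded; on the
  carrier, where the potential may be infinite, \<open>shifted_pot\<close> takes its place.\<close>

definition log_pot :: "complex measure \<Rightarrow> complex \<Rightarrow> real" where
  "log_pot \<nu> z = (LINT w|\<nu>. - ln (dist z w))"

text \<open>The logarithmic kernel shifted by \<open>L\<close>: it is non-negative between points whose distance is at
  most \<open>exp L\<close>.\<close>

definition shifted_kernel :: "real \<Rightarrow> complex \<Rightarrow> complex \<Rightarrow> ennreal" where
  "shifted_kernel L z w = (if z = w then \<infinity> else ennreal (L - ln (dist z w)))"

definition shifted_pot :: "real \<Rightarrow> complex measure \<Rightarrow> complex \<Rightarrow> ennreal" where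
  "shifted_pot L \<nu> z = (\<integral>\<^sup>+w. shifted_kernel L z w \<partial>\<nu>)"

definition shifted_energy :: "real \<Rightarrow> complex measure \<Rightarrow> ennreal" where
  "shifted_energy L \<nu> = (\<integral>\<^sup>+z. shifted_pot L \<nu> z \<partial>\<nu>)"

lemma measurable_shifted_kernel_pair:
  assumes [measurable_cong]: "sets M = sets borel" "sets N = sets borel"
  shows "case_prod (shifted_kernel L) \<in> borel_measurable (M \<Otimes>\<^sub>M N)"
proof -
  have eq: "case_prod (shifted_kernel L) =
    (\<lambda>x. if dist (fst x) (snd x) = 0 then \<infinity> else ennreal (L - ln (dist (fst x) (snd x))))"
    by (auto simp: shifted_kernel_def fun_eq_iff)
  have [measurable]: "(\<lambda>x. dist (fst x) (snd x)) \<in> borel_measurable (M \<Otimes>\<^sub>M N)"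
    by measurable
  show ?thesis unfolding eq by measurable
qed

lemma measurable_shifted_kernel:
  assumes "sets M = sets borel"
  shows "shifted_kernel L z \<in> borel_measurable M"
proof -
  have [measurable_cong]: "sets M = sets borel" by fact
  have eq: "shifted_kernel L z = (\<lambda>w. if dist z w = 0 then \<infinity> else ennreal (L - ln (dist z w)))"
    by (auto simp: shifted_kernel_def fun_eq_iff)
  have [measurable]: "(\<lambda>w. dist z w) \<in> borel_measurable M"
    by measurable
  show ?thesis unfolding eq by measurable
qed

lemma measurable_shifted_pot:
  assumes "prob_on A \<nu>" "sets M = sets borel"
  shows "shifted_pot L \<nu> \<in> borel_measurable M"
proof -
  have s: "sets \<nu> = sets borel" "prob_space \<nu>" using assms by (auto simp: prob_on_def)
  interpret prob_space \<nu> by fact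
  show ?thesis
    unfolding shifted_pot_def
    using measurable_shifted_kernel_pair[OF assms(2) s(1), of L]
    by (rule borel_measurable_nn_integral)
qed

lemma integrable_bounded_prob_on:
  fixes f :: "complex \<Rightarrow> 'b::{banach,second_countable_topology}"
  assumes "prob_on A \<nu>" "f \<in> borel_measurable borel" "\<And>w. w \<in> A \<Longrightarrow> norm (f w) \<le> B"
  shows "integrable \<nu> f"
proof -
  interpret prob_space \<nu> using assms by (simp add: prob_on_def)
  have s: "sets \<nu> = sets borel" "AE w in \<nu>. w \<in> A" using assms by (auto simp: prob_on_def)
  show ?thesis
  proof (rule integrable_const_bound)
    show "AE x in \<nu>. norm (f x) \<le> B" using s(2) by (rule eventually_mono) (use assms in auto)
    show "f \<in> borel_measurable \<nu>" using assms(2) s(1) by (simp cong: measurable_cong_sets)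
  qed
qed

lemma measurable_ln_dist: "(\<lambda>w. - ln (dist z w)) \<in> borel_measurable borel"
proof -
  have [measurable]: "(\<lambda>w. dist z w) \<in> borel_measurable borel"
    by (intro borel_measurable_continuous_onI continuous_intros)
  show ?thesis by measurable
qed

lemma integrable_ln_dist:
  assumes "prob_on A \<nu>" "compact A" "z \<notin> A"
  shows "integrable \<nu> (\<lambda>w. - ln (dist z w))"
proof -
  have "bounded ((\<lambda>w. - ln (dist z w)) ` A)"
    using assms(2,3) by (intro compact_imp_bounded compact_continuous_image continuous_intros) auto
  then obtain B where "\<And>w. w \<in> A \<Longrightarrow> norm (- ln (dist z w)) \<le> B"
    unfolding bounded_iff by blast
  then show ?thesis
    using integrable_bounded_prob_on[OF assms(1) measurable_ln_dist] by blast
qed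

text \<open>On a disc off \<open>A\<close> the difference to the value at the centre is the integral
  of \<open>- ln |1 - (z - z0) / (w - z0)|\<close>. Expanding the complex logarithm and integrating
  term by term gives a power series in \<open>z - z0\<close>, which is the required holomorphic
  function up to a constant.\<close>

lemma log_pot_real_part_on_discs:
  assumes \<nu>: "prob_on A \<nu>" and A: "compact A"
  shows "real_part_on_discs (log_pot \<nu>) (- A)"
  unfolding real_part_on_discs_def
proof (intro allI impI)
  fix z0 r assume *: "0 < r \<and> ball z0 r \<subseteq> - A"
  interpret prob_space \<nu> using \<nu> by (simp add: prob_on_def)
  have s: "sets \<nu> = sets borel" and AE: "AE w in \<nu>. w \<in> A" using \<nu> by (auto simp: prob_on_def)
  have far: "r \<le> dist z0 w" if "w \<in> A" for w
    using * that by (force simp: not_less)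
  have z0: "z0 \<notin> A" using far * by fastforce
  \<comment> \<open>Division by zero makes \<open>c 0\<close> equal to 0, in accordance with the
    logarithm series, which has no constant term.\<close>
  define c where "c n = (LINT w|\<nu>. 1 / (of_nat n * (w - z0) ^ n))" for n
  have sums: "(\<lambda>n. c n * (z - z0) ^ n) sums (LINT w|\<nu>. - Ln (1 - (z - z0) / (w - z0)))"
    and reint: "Re (LINT w|\<nu>. - Ln (1 - (z - z0) / (w - z0))) = log_pot \<nu> z - log_pot \<nu> z0"
    if z: "z \<in> ball z0 r" for z
  proof -
    define q where "q w = (z - z0) / (w - z0)" for w
    define \<rho> where "\<rho> = dist z0 z / r"
    have \<rho>: "0 \<le> \<rho>" "\<rho> < 1" using z * by (auto simp: \<rho>_def)
    have q: "norm (q w) \<le> \<rho>" if "w \<in> A" for w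
      using far[OF that] * by (simp add: q_def \<rho>_def norm_divide dist_norm norm_minus_commute frac_le)
    have meas[measurable]: "(\<lambda>w. q w ^ n / of_nat n) \<in> borel_measurable borel" for n
      unfolding q_def by measurable
    have bd: "norm (q w ^ n / of_nat n) \<le> \<rho> ^ n" if "w \<in> A" for w n
    proof (cases "n = 0")
      case False
      have "norm (q w ^ n / of_nat n) = norm (q w) ^ n / n" by (simp add: norm_divide norm_power)
      also have "\<dots> \<le> \<rho> ^ n / 1"
        using q[OF that] False \<rho> by (intro frac_le power_mono) auto
      finally show ?thesis by simp
    qed simp
    have int: "integrable \<nu> (\<lambda>w. q w ^ n / of_nat n)" for n
      by (rule integrable_bounded_prob_on[OF \<nu> meas bd])
    have sm: "summable (\<lambda>n. \<rho> ^ n)" using \<rho> by (simp add: summable_geometric)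
    have "(\<lambda>n. LINT w|\<nu>. q w ^ n / of_nat n) sums (LINT w|\<nu>. (\<Sum>n. q w ^ n / of_nat n))"
    proof (rule sums_integral[OF int])
      show "AE w in \<nu>. summable (\<lambda>n. norm (q w ^ n / of_nat n))"
        using AE
      proof (rule eventually_mono)
        fix w assume "w \<in> A"
        then show "summable (\<lambda>n. norm (q w ^ n / of_nat n))"
          using bd by (intro summable_comparison_test'[OF sm, of 0]) auto
      qed
      show "summable (\<lambda>n. LINT w|\<nu>. norm (q w ^ n / of_nat n))"
      proof (rule summable_comparison_test'[OF sm, of 0])
        fix n :: nat
        have "(LINT w|\<nu>. norm (q w ^ n / of_nat n)) \<le> \<rho> ^ n"
          using AE by (intro integral_le_const integrable_norm int) (auto elim!: eventually_mono bd)
        then show "norm (LINT w|\<nu>. norm (q w ^ n / of_nat n)) \<le> \<rho> ^ n"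
          by (simp add: integral_nonneg_AE)
      qed
    qed
    moreover have "(LINT w|\<nu>. q w ^ n / of_nat n) = c n * (z - z0) ^ n" for n
    proof -
      have "(LINT w|\<nu>. q w ^ n / of_nat n) = (LINT w|\<nu>. (1 / (of_nat n * (w - z0) ^ n)) * (z - z0) ^ n)"
        by (intro arg_cong[where f = "integral\<^sup>L \<nu>"] ext) (simp add: q_def power_divide)
      also have "\<dots> = c n * (z - z0) ^ n"
        unfolding c_def by (rule integral_mult_left_zero)
      finally show ?thesis .
    qed
    moreover have "(LINT w|\<nu>. (\<Sum>n. q w ^ n / of_nat n)) = (LINT w|\<nu>. - Ln (1 - q w))"
    proof (rule integral_cong_AE)
      show "(\<lambda>w. \<Sum>n. q w ^ n / of_nat n) \<in> borel_measurable \<nu>"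
        using s meas by (intro borel_measurable_suminf) (simp cong: measurable_cong_sets)
      have "(\<lambda>w. - Ln (1 - q w)) \<in> borel_measurable borel" unfolding q_def by measurable
      then show "(\<lambda>w. - Ln (1 - q w)) \<in> borel_measurable \<nu>"
        using s by (simp cong: measurable_cong_sets)
      show "AE w in \<nu>. (\<Sum>n. q w ^ n / of_nat n) = - Ln (1 - q w)"
        using AE
      proof (rule eventually_mono)
        fix w assume "w \<in> A"
        then have "norm (- q w) < 1" using q \<rho> by (metis le_less_trans norm_minus_cancel)
        from Ln_series'[OF this] have "(\<lambda>n. - (q w ^ n / of_nat n)) sums Ln (1 - q w)"
          by simp
        then have "(\<lambda>n. q w ^ n / of_nat n) sums (- Ln (1 - q w))"
          using sums_minus by fastforce
        then show "(\<Sum>n. q w ^ n / of_nat n) = - Ln (1 - q w)" by (simp add: sums_iff)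
      qed
    qed
    ultimately show "(\<lambda>n. c n * (z - z0) ^ n) sums (LINT w|\<nu>. - Ln (1 - (z - z0) / (w - z0)))"
      by (simp add: q_def)
    have intL: "integrable \<nu> (\<lambda>w. - Ln (1 - q w))"
    proof (rule integrable_bounded_prob_on[OF \<nu>])
      show "(\<lambda>w. - Ln (1 - q w)) \<in> borel_measurable borel" unfolding q_def by measurable
      fix w assume w: "w \<in> A"
      then have "norm (- q w) < 1" using q \<rho> by (metis le_less_trans norm_minus_cancel)
      from Ln_series'[OF this] have S: "(\<lambda>n. - (q w ^ n / of_nat n)) sums Ln (1 - q w)"
        by simp
      have "norm (Ln (1 - q w)) \<le> (\<Sum>n. \<rho> ^ n)"
        unfolding sums_unique[OF S] by (rule norm_suminf_le[OF _ sm]) (use bd[OF w] in \<open>simp only: norm_minus_cancel\<close>)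
      then show "norm (- Ln (1 - q w)) \<le> (\<Sum>n. \<rho> ^ n)" by simp
    qed
    have zA: "z \<notin> A" using * z by blast
    have "Re (LINT w|\<nu>. - Ln (1 - q w)) = (LINT w|\<nu>. Re (- Ln (1 - q w)))"
      using intL by (simp add: integral_Re)
    also have "\<dots> = (LINT w|\<nu>. - ln (dist z w) - (- ln (dist z0 w)))"
    proof (rule integral_cong_AE)
      show "(\<lambda>w. Re (- Ln (1 - q w))) \<in> borel_measurable \<nu>" using intL by auto
      show "(\<lambda>w. - ln (dist z w) - (- ln (dist z0 w))) \<in> borel_measurable \<nu>"
        using integrable_ln_dist[OF \<nu> A] zA z0 by (intro borel_measurable_diff) auto
      show "AE w in \<nu>. Re (- Ln (1 - q w)) = - ln (dist z w) - (- ln (dist z0 w))"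
        using AE
      proof (rule eventually_mono)
        fix w assume w: "w \<in> A"
        then have nz: "w \<noteq> z" "w \<noteq> z0" using zA z0 by auto
        then have "1 - q w = (w - z) / (w - z0)" by (simp add: q_def field_simps)
        moreover have "1 - q w \<noteq> 0" using calculation nz by simp
        ultimately have "Re (Ln (1 - q w)) = ln (norm (w - z) / norm (w - z0))"
          by (simp add: norm_divide)
        then show "Re (- Ln (1 - q w)) = - ln (dist z w) - (- ln (dist z0 w))"
          using nz by (simp add: ln_div dist_norm norm_minus_commute)
      qed
    qed
    also have "\<dots> = log_pot \<nu> z - log_pot \<nu> z0"
      unfolding log_pot_def by (intro Bochner_Integration.integral_diff integrable_ln_dist[OF \<nu> A] zA z0)
    finally show "Re (LINT w|\<nu>. - Ln (1 - (z - z0) / (w - z0))) = log_pot \<nu> z - log_pot \<nu> z0"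
      by (simp add: q_def)
  qed
  define F where "F z = (LINT w|\<nu>. - Ln (1 - (z - z0) / (w - z0))) + of_real (log_pot \<nu> z0)" for z
  have "(\<lambda>z. LINT w|\<nu>. - Ln (1 - (z - z0) / (w - z0))) holomorphic_on ball z0 r"
    using sums by (rule power_series_holomorphic)
  then have "F holomorphic_on ball z0 r"
    unfolding F_def by (intro holomorphic_intros)
  moreover have "log_pot \<nu> z = Re (F z)" if "z \<in> ball z0 r" for z
    using reint[OF that] by (simp add: F_def)
  ultimately show "\<exists>F. F holomorphic_on ball z0 r \<and> (\<forall>w\<in>ball z0 r. log_pot \<nu> w = Re (F w))"
    by blast
qed

lemma abs_ln_one_plus_le:
  fixes x t :: real
  assumes "1 - t \<le> x" "x \<le> 1 + t" "0 \<le> t" "t \<le> 1/2"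
  shows "\<bar>ln x\<bar> \<le> 2 * t"
proof -
  have x: "x > 0" using assms by linarith
  have "ln x \<le> x - 1" using x by (rule ln_le_minus_one)
  moreover have "- t - 2 * t\<^sup>2 \<le> ln (1 - t)"
    using ln_one_minus_pos_lower_bound assms by blast
  moreover have "ln (1 - t) \<le> ln x" using assms by simp
  moreover have "2 * t\<^sup>2 \<le> t"
    using mult_right_mono[OF assms(4,3)] by (simp add: power2_eq_square)
  ultimately show ?thesis using assms by linarith
qed

text \<open>Dividing distances by \<open>norm z\<close> leaves the logarithm of a ratio within
  \<open>R / norm z\<close> of 1, and \<open>2 * R \<le> norm z\<close> keeps that deviation at most
  1/2, where \<open>|ln x|\<close> is at most twice the deviation.\<close>

lemma log_pot_at_infinity:
  assumes \<nu>: "prob_on A \<nu>" and A: "compact A" "A \<subseteq> cball 0 R" and R: "R > 0" and z: "2 * R \<le> norm z"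
  shows "\<bar>log_pot \<nu> z + ln (norm z)\<bar> \<le> 2 * R / norm z"
proof -
  interpret prob_space \<nu> using \<nu> by (simp add: prob_on_def)
  have AE: "AE w in \<nu>. w \<in> A" using \<nu> by (auto simp: prob_on_def)
  have nz: "norm z > 0" using R z by linarith
  have zA: "z \<notin> A" using A R z by auto
  have int: "integrable \<nu> (\<lambda>w. - ln (dist z w))" by (rule integrable_ln_dist[OF \<nu> A(1) zA])
  have "log_pot \<nu> z + ln (norm z) = (LINT w|\<nu>. - ln (dist z w) + ln (norm z))"
    unfolding log_pot_def using int by (subst Bochner_Integration.integral_add) (auto simp: prob_space)
  also have "\<bar>\<dots>\<bar> \<le> (LINT w|\<nu>. \<bar>- ln (dist z w) + ln (norm z)\<bar>)"
    by (rule integral_abs_bound)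
  also have "\<dots> \<le> 2 * R / norm z"
  proof (rule integral_le_const)
    show "integrable \<nu> (\<lambda>w. \<bar>- ln (dist z w) + ln (norm z)\<bar>)" using int by auto
    show "AE w in \<nu>. \<bar>- ln (dist z w) + ln (norm z)\<bar> \<le> 2 * R / norm z"
      using AE
    proof (rule eventually_mono)
      fix w assume w: "w \<in> A"
      then have wR: "norm w \<le> R" using A by auto
      have d: "dist z w > 0" using w zA by auto
      have "norm z - norm w \<le> dist z w" "dist z w \<le> norm z + norm w"
        by (simp_all add: dist_norm norm_triangle_ineq2 norm_triangle_ineq4)
      then have "norm z - R \<le> dist z w" "dist z w \<le> norm z + R" using wR by linarith+
      then have h: "1 - R / norm z \<le> dist z w / norm z" "dist z w / norm z \<le> 1 + R / norm z"
        using divide_right_mono[of "norm z - R" "dist z w" "norm z"] divide_right_mono[of "dist z w" "norm z + R" "norm z"] nz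
        by (simp_all add: diff_divide_distrib add_divide_distrib)
      have "0 \<le> R / norm z" "R / norm z \<le> 1 / 2" using z nz R by (auto simp: field_simps)
      with h have "\<bar>ln (dist z w / norm z)\<bar> \<le> 2 * (R / norm z)"
        by (rule abs_ln_one_plus_le)
      then show "\<bar>- ln (dist z w) + ln (norm z)\<bar> \<le> 2 * R / norm z"
        using d nz by (simp add: ln_div)
    qed
  qed
  finally show ?thesis .
qed

lemma shifted_pot_eq_log_pot:
  assumes \<nu>: "prob_on A \<nu>" and A: "compact A" "z \<notin> A" and L: "\<And>w. w \<in> A \<Longrightarrow> dist z w \<le> exp L"
  shows "shifted_pot L \<nu> z = ennreal (L + log_pot \<nu> z)" "0 \<le> L + log_pot \<nu> z"
proof -
  interpret prob_space \<nu> using \<nu> by (simp add: prob_on_def)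
  have AE: "AE w in \<nu>. w \<in> A" using \<nu> by (auto simp: prob_on_def)
  have int: "integrable \<nu> (\<lambda>w. - ln (dist z w))" by (rule integrable_ln_dist[OF \<nu> A])
  have eq: "(LINT w|\<nu>. L - ln (dist z w)) = L + log_pot \<nu> z"
    using Bochner_Integration.integral_add[OF _ int, of "\<lambda>_. L"] by (simp add: log_pot_def prob_space)
  have int': "integrable \<nu> (\<lambda>w. L - ln (dist z w))"
    using Bochner_Integration.integrable_add[OF _ int, of "\<lambda>_. L"] by simp
  have nn: "AE w in \<nu>. 0 \<le> L - ln (dist z w)"
    using AE
  proof (rule eventually_mono)
    fix w assume w: "w \<in> A"
    then have "0 < dist z w" using A by auto
    then have "ln (dist z w) \<le> ln (exp L)" using L[OF w] by (subst ln_le_cancel_iff) auto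
    then show "0 \<le> L - ln (dist z w)" by simp
  qed
  show "0 \<le> L + log_pot \<nu> z" using integral_nonneg_AE[OF nn] eq by simp
  have "shifted_pot L \<nu> z = (\<integral>\<^sup>+w. ennreal (L - ln (dist z w)) \<partial>\<nu>)"
    unfolding shifted_pot_def
    by (rule nn_integral_cong_AE, use AE in eventually_elim) (use A in \<open>auto simp: shifted_kernel_def\<close>)
  also have "\<dots> = ennreal (L + log_pot \<nu> z)"
    using nn_integral_eq_integral[OF int' nn] eq by simp
  finally show "shifted_pot L \<nu> z = ennreal (L + log_pot \<nu> z)" .
qed

text \<open>Passing from \<open>z\<close> to the nearest point of \<open>A\<close> at most doubles distances; the resulting \<open>ln 2\<close> is
  charged only to a small ball, whose mass is small because the potential is bounded.\<close>

lemma log_pot_near_support: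
  assumes \<nu>: "prob_on A \<nu>" and A: "compact A" and L: "\<And>z w. z \<in> A \<Longrightarrow> w \<in> A \<Longrightarrow> dist z w + 1 \<le> exp L"
    and M: "0 \<le> L + M" "\<And>z. z \<in> A \<Longrightarrow> shifted_pot L \<nu> z \<le> ennreal (L + M)" and e: "e > 0"
  obtains d where "d > 0" "\<And>z x. x \<in> A \<Longrightarrow> z \<notin> A \<Longrightarrow> dist z x < d \<Longrightarrow> log_pot \<nu> z \<le> M + e"
proof -
  interpret prob_space \<nu> using \<nu> by (simp add: prob_on_def)
  have AE: "AE w in \<nu>. w \<in> A" and s: "sets \<nu> = sets borel" using \<nu> by (auto simp: prob_on_def)
  \<comment> \<open>On the ball of radius \<open>r = exp (L - T)\<close> the shifted kernel is at
    least \<open>T\<close>, so the ball has mass at most \<open>(L + M) / T\<close>;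
    \<open>T\<close> is chosen so that \<open>ln 2\<close> times this mass is at most
    \<open>e / 2\<close>. The number \<open>d\<close> makes distances to points outside that ball
    shrink at most by the factor \<open>exp (- e / 2)\<close>.\<close>
  define T where "T = 1 + 2 * ln 2 * (L + M) / e"
  have T: "T \<ge> 1" using M e by (simp add: T_def)
  have T2: "ln 2 * (L + M) \<le> T * (e / 2)"
  proof -
    have "T * (e / 2) = e / 2 + ln 2 * (L + M)" using e by (simp add: T_def field_simps)
    then show ?thesis using e by simp
  qed
  define r where "r = exp (L - T)"
  have r: "r > 0" by (simp add: r_def)
  define d where "d = min 1 (r * (1 - exp (- e / 2)))"
  have d: "d > 0" "d \<le> 1" "d \<le> r * (1 - exp (- e / 2))" using r e by (auto simp: d_def)
  show ?thesis
  proof (rule that[OF d(1)])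
    fix z x assume x: "x \<in> A" and z: "z \<notin> A" and zx: "dist z x < d"
    obtain y where y: "y \<in> A" "\<And>w. w \<in> A \<Longrightarrow> dist z y \<le> dist z w"
      using distance_attains_inf[OF compact_imp_closed[OF A], of z] x by blast
    define \<delta> where "\<delta> = dist z y"
    have \<delta>: "0 < \<delta>" "\<delta> < d" using y(2)[OF x] zx y(1) z by (auto simp: \<delta>_def)
    have \<delta>r: "exp (- e / 2) < 1 - \<delta> / r" using \<delta> d r by (simp add: field_simps)
    then have "0 < 1 - \<delta> / r" using exp_gt_zero order.strict_trans by blast
    have Lz: "dist z w \<le> exp L" if "w \<in> A" for w
      using L[OF y(1) that] \<delta> d dist_triangle[of z w y] by (simp add: \<delta>_def)
    have ball: "measure \<nu> (ball y r) * T \<le> L + M"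
    proof -
      have "ennreal (measure \<nu> (ball y r) * T) = (\<integral>\<^sup>+w. ennreal T * indicator (ball y r) w \<partial>\<nu>)"
        using s T by (subst nn_integral_cmult_indicator) (auto simp: emeasure_eq_measure ennreal_mult' mult.commute)
      also have "\<dots> \<le> shifted_pot L \<nu> y"
        unfolding shifted_pot_def
      proof (rule nn_integral_mono)
        fix w
        show "ennreal T * indicator (ball y r) w \<le> shifted_kernel L y w"
        proof (cases "w \<in> ball y r \<and> w \<noteq> y")
          case True
          then have "ln (dist y w) \<le> ln r" using r by (subst ln_le_cancel_iff) auto
          then have "T \<le> L - ln (dist y w)" by (simp add: r_def)
          then show ?thesis using True by (simp add: shifted_kernel_def ennreal_leI)
        next
          case False
          then show ?thesis by (auto simp: shifted_kernel_def indicator_def)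
        qed
      qed
      also have "\<dots> \<le> ennreal (L + M)" by (rule M(2)[OF y(1)])
      finally show ?thesis using M(1) by simp
    qed
    have "ln 2 * measure \<nu> (ball y r) \<le> e / 2"
    proof -
      have "ln 2 * measure \<nu> (ball y r) * T \<le> T * (e / 2)"
        using order_trans[OF mult_left_mono[OF ball, of "ln 2"] T2] by (simp only: mult.assoc ln_ge_zero_iff)
      then show ?thesis using T by (simp add: mult.commute)
    qed
    have pw: "shifted_kernel L z w \<le> shifted_kernel L y w + (ennreal (ln 2) * indicator (ball y r) w + ennreal (e / 2))"
      if w: "w \<in> A" for w
    proof (cases "w = y")
      case True
      then show ?thesis by (simp add: shifted_kernel_def)
    next
      case False
      have zw: "z \<noteq> w" using w z by auto
      have Ly: "0 \<le> L - ln (dist y w)"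
      proof -
        have "ln (dist y w) \<le> ln (exp L)" using L[OF y(1) w] False by (subst ln_le_cancel_iff) auto
        then show ?thesis by simp
      qed
      have tri: "dist y w \<le> \<delta> + dist z w" using dist_triangle[of y w z] by (simp add: \<delta>_def dist_commute)
      show ?thesis
      proof (cases "w \<in> ball y r")
        case True
        have "dist y w \<le> 2 * dist z w" using tri y(2)[OF w] by (simp add: \<delta>_def)
        then have "ln (dist y w) \<le> ln (2 * dist z w)" using False zw by (subst ln_le_cancel_iff) auto
        then have "L - ln (dist z w) \<le> L - ln (dist y w) + ln 2" using zw by (simp add: ln_mult)
        then have "ennreal (L - ln (dist z w)) \<le> ennreal (L - ln (dist y w)) + ennreal (ln 2)"
          using Ly by (simp add: ennreal_plus[symmetric] ennreal_leI del: ennreal_plus)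
        also have "\<dots> \<le> ennreal (L - ln (dist y w)) + (ennreal (ln 2) + ennreal (e/2))"
          by (intro add_left_mono) simp
        finally show ?thesis using True False zw by (simp add: shifted_kernel_def)
      next
        case nb: False
        have wr: "r \<le> dist y w" using nb by simp
        have "dist y w * (1 - \<delta> / r) \<le> dist y w - \<delta>"
          using wr r \<delta> by (simp add: field_simps)
        also have "\<dots> \<le> dist z w" using tri by simp
        finally have "dist y w * exp (- e / 2) \<le> dist z w"
          using \<delta>r by (meson less_imp_le mult_left_mono order_trans zero_le_dist)
        then have "ln (dist y w * exp (- e / 2)) \<le> ln (dist z w)"
          using False zw by (subst ln_le_cancel_iff) auto
        then have "L - ln (dist z w) \<le> L - ln (dist y w) + e / 2" using False by (simp add: ln_mult)
        then have "ennreal (L - ln (dist z w)) \<le> ennreal (L - ln (dist y w)) + ennreal (e / 2)"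
          using Ly e by (simp add: ennreal_plus[symmetric] ennreal_leI del: ennreal_plus)
        then show ?thesis using nb False zw by (simp add: shifted_kernel_def)
      qed
    qed
    have "shifted_pot L \<nu> z \<le> (\<integral>\<^sup>+w. shifted_kernel L y w + (ennreal (ln 2) * indicator (ball y r) w + ennreal (e / 2)) \<partial>\<nu>)"
      unfolding shifted_pot_def
      by (rule nn_integral_mono_AE, use AE in eventually_elim) (rule pw)
    also have "\<dots> = shifted_pot L \<nu> y + (ennreal (ln 2) * emeasure \<nu> (ball y r) + ennreal (e / 2))"
    proof -
      have [measurable]: "ball y r \<in> sets \<nu>" using s by simp
      have [measurable]: "shifted_kernel L y \<in> borel_measurable \<nu>" by (rule measurable_shifted_kernel[OF s])
      show ?thesis
        by (simp add: nn_integral_add nn_integral_cmult_indicator shifted_pot_def emeasure_space_1)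
    qed
    also have "\<dots> \<le> ennreal (L + M) + (ennreal (ln 2 * measure \<nu> (ball y r)) + ennreal (e / 2))"
      using M(2)[OF y(1)] by (intro add_mono) (auto simp: emeasure_eq_measure ennreal_mult')
    also have "\<dots> \<le> ennreal (L + M) + (ennreal (e / 2) + ennreal (e / 2))"
      using \<open>ln 2 * measure \<nu> (ball y r) \<le> e / 2\<close> by (intro add_mono ennreal_leI) auto
    also have "\<dots> = ennreal (L + M + e)"
      using M e by (simp add: ennreal_plus[symmetric] del: ennreal_plus)
    finally have "ennreal (L + log_pot \<nu> z) \<le> ennreal (L + M + e)"
      using shifted_pot_eq_log_pot(1)[OF \<nu> A z Lz] by simp
    then have "L + log_pot \<nu> z \<le> L + M + e"
      using M(1) e by (subst (asm) ennreal_le_iff) auto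
    then show "log_pot \<nu> z \<le> M + e" by simp
  qed
qed

text \<open>The potential is harmonic off \<open>A\<close>, its upper limits at \<open>A\<close> are
  at most \<open>M\<close> by the estimate near the carrier, and it tends to minus infinity at
  infinity. The margin 1 in the condition on \<open>L\<close> keeps the shifted kernel non-negative
  at points within distance 1 of \<open>A\<close>.\<close>

lemma log_pot_maximum_principle:
  assumes \<nu>: "prob_on A \<nu>" and A: "compact A" and L: "\<And>z w. z \<in> A \<Longrightarrow> w \<in> A \<Longrightarrow> dist z w + 1 \<le> exp L"
    and M: "0 \<le> L + M" "\<And>z. z \<in> A \<Longrightarrow> shifted_pot L \<nu> z \<le> ennreal (L + M)" and z: "z \<notin> A"
  shows "log_pot \<nu> z \<le> M"
proof -
  have "norm (1::complex) * exp (log_pot \<nu> z) \<le> exp M"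
  proof (rule maximum_principle[where S = "- A" and f = "\<lambda>_. 1"])
    show "open (- A)" using A by (simp add: compact_imp_closed open_Compl)
    show "real_part_on_discs (log_pot \<nu>) (- A)" by (rule log_pot_real_part_on_discs[OF \<nu> A])
  next
    fix \<xi> c assume \<xi>: "\<xi> \<in> frontier (- A)" and c: "exp M < c"
    have \<xi>A: "\<xi> \<in> A" using \<xi> A by (metis compact_imp_closed frontier_complement frontier_subset_closed subsetD)
    define e where "e = (ln c - M) / 2"
    have c0: "c > 0" using c exp_gt_zero order.strict_trans by blast
    have "M < ln c" using c c0 by (metis exp_less_cancel_iff exp_ln)
    then have e: "e > 0" "M + e < ln c" by (auto simp: e_def field_simps)
    obtain d where d: "d > 0" "\<And>z x. x \<in> A \<Longrightarrow> z \<notin> A \<Longrightarrow> dist z x < d \<Longrightarrow> log_pot \<nu> z \<le> M + e"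
      using log_pot_near_support[OF \<nu> A L M e(1)] by blast
    have "exp (log_pot \<nu> z) < c" if "z \<notin> A" "dist z \<xi> < d" for z
    proof -
      have "log_pot \<nu> z < ln c" using d(2)[OF \<xi>A that] e by linarith
      then show ?thesis using c0 by (metis exp_less_cancel_iff exp_ln)
    qed
    then show "\<forall>\<^sub>F z in at \<xi> within - A. norm (1::complex) * exp (log_pot \<nu> z) < c"
      unfolding eventually_at using d(1) by auto
  next
    fix c assume c: "exp M < c"
    have c0: "c > 0" using c exp_gt_zero order.strict_trans by blast
    obtain R where R: "R > 0" "A \<subseteq> cball 0 R"
      using compact_imp_bounded[OF A] by (metis bounded_subset_ballD ball_subset_cball order_trans)
    have "exp (log_pot \<nu> z) < c" if z: "norm z \<ge> max (2 * R) (2 * exp 1 / c)" for z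
    proof -
      have nz: "norm z > 0" using z R by linarith
      have "\<bar>log_pot \<nu> z + ln (norm z)\<bar> \<le> 2 * R / norm z"
        using log_pot_at_infinity[OF \<nu> A R(2,1)] z by simp
      also have "\<dots> \<le> 1" using z nz by (simp add: field_simps)
      finally have "log_pot \<nu> z \<le> 1 - ln (norm z)" by linarith
      then have "exp (log_pot \<nu> z) \<le> exp (1 - ln (norm z))" by simp
      also have "\<dots> = exp 1 / norm z" using nz by (simp add: exp_diff)
      also have "\<dots> < c" 
      proof -
        have "2 * exp 1 \<le> norm z * c" using z c0 by (simp add: field_simps)
        moreover have "exp (1::real) > 0" by simp
        ultimately have "exp 1 < c * norm z" unfolding mult.commute[of c] by linarith
        then show ?thesis using nz by (simp add: field_simps)
      qed
      finally show ?thesis .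
    qed
    then show "\<forall>\<^sub>F z in at_infinity. z \<in> - A \<longrightarrow> norm (1::complex) * exp (log_pot \<nu> z) < c"
      unfolding eventually_at_infinity by (intro exI[of _ "max (2 * R) (2 * exp 1 / c)"]) auto
  qed (use z in auto)
  then show ?thesis by simp
qed

section \<open>Weak limits of counting measures\<close>

text \<open>A point is coded by the ternary digits recording its membership in the discs of a countable base.
  As only the digits \<open>0\<close> and \<open>1\<close> occur, decoding is uniformly continuous, so that Helly's selection theorem on
  the line applies to measures on \<open>K\<close>.\<close>

lemma real_coding_of_compact:
  fixes K :: "complex set"
  assumes K: "compact K" "K \<noteq> {}"
  obtains t :: "complex \<Rightarrow> real" and \<phi> :: "real \<Rightarrow> complex" and B where
    "\<And>z. z \<in> K \<Longrightarrow> 0 \<le> t z \<and> t z \<le> 1" "continuous_on UNIV \<phi>" "\<And>x. norm (\<phi> x) \<le> B"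
    "\<And>z. z \<in> K \<Longrightarrow> \<phi> (t z) = z"
proof -
  obtain D :: "complex set" where D: "countable D" "\<And>X. open X \<Longrightarrow> X \<noteq> {} \<Longrightarrow> \<exists>d\<in>D. d \<in> X"
    using countable_dense_setE by blast
  define \<F> where "\<F> = (\<lambda>(d, n). ball d (1 / Suc n)) ` (D \<times> (UNIV :: nat set))"
  have "D \<noteq> {}" using D(2)[of UNIV] by auto
  then have F: "countable \<F>" "\<F> \<noteq> {}" using D(1) by (auto simp: \<F>_def)
  define U where "U = from_nat_into \<F>"
  have U: "range U = \<F>" using range_from_nat_into[OF F(2,1)] by (simp add: U_def)
  define b where "b j z = (if z \<in> U j then 1 else 0 :: real)" for j z
  define t where "t z = (\<Sum>j. b j z * (1/3) ^ Suc j)" for z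
  have geo: "summable (\<lambda>j. (1/3::real) ^ Suc j)" "(\<Sum>j. (1/3::real) ^ Suc j) = 1/2"
  proof -
    have "(\<lambda>j. (1/3::real) * (1/3) ^ j) sums (1/3 * (1 / (1 - 1/3)))"
      by (intro sums_mult geometric_sums) simp
    then have "(\<lambda>j. (1/3::real) ^ Suc j) sums (1/2)" by simp
    then show "summable (\<lambda>j. (1/3::real) ^ Suc j)" "(\<Sum>j. (1/3::real) ^ Suc j) = 1/2"
      by (simp_all only: sums_iff)
  qed
  have sm: "summable (\<lambda>j. b j z * (1/3) ^ Suc j)" for z
    by (rule summable_comparison_test'[OF geo(1), of 0]) (auto simp: b_def)
  have t01: "0 \<le> t z \<and> t z \<le> 1" for z
  proof
    show "0 \<le> t z" unfolding t_def by (rule suminf_nonneg[OF sm]) (auto simp: b_def)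
    have "t z \<le> (\<Sum>j. (1/3::real) ^ Suc j)" unfolding t_def by (rule suminf_le[OF _ sm geo(1)]) (auto simp: b_def)
    then show "t z \<le> 1" using geo(2) by simp
  qed
  \<comment> \<open>The first differing digit contributes \<open>(1/3) ^ Suc m\<close> and all later
    digits together at most half of that, so codes that are close enough have equal digits up to
    \<open>J\<close>. Base 3 leaves a gap that base 2 would not.\<close>
  have agree: "b j z = b j z'" if cl: "\<bar>t z - t z'\<bar> < (1/3) ^ Suc J / 2" and jJ: "j \<le> J" for z z' j J
  proof (rule ccontr)
    assume ne: "b j z \<noteq> b j z'"
    define m where "m = (LEAST j. b j z \<noteq> b j z')"
    have m: "b m z \<noteq> b m z'" "m \<le> j" "\<And>i. i < m \<Longrightarrow> b i z = b i z'"
      unfolding m_def using LeastI[of "\<lambda>j. b j z \<noteq> b j z'", OF ne] Least_le[of "\<lambda>j. b j z \<noteq> b j z'", OF ne]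
      by (blast dest: not_less_Least)+
    define c where "c i = (b i z - b i z') * (1/3) ^ Suc i" for i
    have smc: "summable c"
      unfolding c_def left_diff_distrib using sm by (intro summable_diff) auto
    have "t z - t z' = suminf c"
      unfolding c_def t_def left_diff_distrib using sm by (intro suminf_diff) auto
    also have "\<dots> = (\<Sum>i. c (i + Suc m)) + (\<Sum>i<Suc m. c i)"
      by (rule suminf_split_initial_segment[OF smc])
    also have "(\<Sum>i<Suc m. c i) = c m" using m(3) by (simp add: c_def)
    finally have eq: "t z - t z' = (\<Sum>i. c (i + Suc m)) + c m" .
    have sg: "summable (\<lambda>i. (1/3::real) ^ Suc i * (1/3) ^ Suc m)" using geo(1) by (rule summable_mult2)
    have "\<bar>\<Sum>i. c (i + Suc m)\<bar> \<le> (\<Sum>i. (1/3::real) ^ Suc i * (1/3) ^ Suc m)"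
      unfolding real_norm_def[symmetric]
    proof (rule norm_suminf_le[OF _ sg])
      fix i
      have "\<bar>b (i + Suc m) z - b (i + Suc m) z'\<bar> \<le> 1" by (auto simp: b_def)
      then have "\<bar>b (i + Suc m) z - b (i + Suc m) z'\<bar> * (1/3) ^ Suc (i + Suc m) \<le> 1 * (1/3) ^ Suc (i + Suc m)"
        by (rule mult_right_mono) simp
      then show "norm (c (i + Suc m)) \<le> (1/3) ^ Suc i * (1/3) ^ Suc m"
        by (simp add: c_def abs_mult power_add)
    qed
    also have "\<dots> = (1/3) ^ Suc m / 2" unfolding suminf_mult2[OF geo(1), symmetric] geo(2) by simp
    finally have "\<bar>\<Sum>i. c (i + Suc m)\<bar> \<le> (1/3) ^ Suc m / 2" .
    moreover have "\<bar>c m\<bar> = (1/3) ^ Suc m" using m(1) by (auto simp: c_def b_def split: if_splits)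
    ultimately have "(1/3) ^ Suc m / 2 \<le> \<bar>t z - t z'\<bar>" using eq by linarith
    moreover have "(1/3::real) ^ Suc J \<le> (1/3) ^ Suc m" using m(2) jJ by (intro power_decreasing) auto
    ultimately show False using cl by linarith
  qed
  have close: "\<exists>\<delta>>0. \<forall>z\<in>K. \<forall>z'\<in>K. \<bar>t z - t z'\<bar> < \<delta> \<longrightarrow> dist z z' < e" if e: "e > 0" for e
  proof -
    \<comment> \<open>Finitely many base sets of small diameter cover \<open>K\<close>; once two
      codes agree in the corresponding digits, both points lie in a common one of these
      sets.\<close>
    define N where "N = {j. \<forall>z\<in>U j. \<forall>z'\<in>U j. dist z z' < e}"
    have op: "open (U j)" for j
    proof -
      have "U j \<in> \<F>" using U by blast
      then show ?thesis by (auto simp: \<F>_def)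
    qed
    have "K \<subseteq> (\<Union>j\<in>N. U j)"
    proof
      fix z assume "z \<in> K"
      obtain n where n: "1 / Suc n < e / 2" using e nat_approx_posE[of "e/2"] by (metis half_gt_zero)
      obtain d where d: "d \<in> D" "d \<in> ball z (1 / Suc n)" using D(2)[of "ball z (1 / Suc n)"] by auto
      then have "ball d (1 / Suc n) \<in> \<F>" by (force simp: \<F>_def)
      then obtain j where j: "U j = ball d (1 / Suc n)" using U by (metis imageE)
      have "dist x y < e" if "x \<in> U j" "y \<in> U j" for x y
      proof -
        have "dist d x < 1 / Suc n" "dist d y < 1 / Suc n" using that j by auto
        then show ?thesis using n dist_triangle[of x y d] by (simp add: dist_commute)
      qed
      then have "j \<in> N" by (auto simp: N_def)
      moreover have "z \<in> U j" using d j by (simp add: dist_commute)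
      ultimately show "z \<in> (\<Union>j\<in>N. U j)" by blast
    qed
    then obtain Y where Y: "Y \<subseteq> N" "finite Y" "K \<subseteq> (\<Union>j\<in>Y. U j)"
      using compactE_image[OF K(1), of N U] op by auto
    define J where "J = Max (insert 0 Y)"
    have J: "j \<le> J" if "j \<in> Y" for j using that Y(2) by (simp add: J_def)
    show ?thesis
    proof (intro exI[of _ "(1/3) ^ Suc J / 2"] conjI ballI impI)
      show "0 < (1/3::real) ^ Suc J / 2" by simp
      fix z z' assume z: "z \<in> K" "z' \<in> K" and tt: "\<bar>t z - t z'\<bar> < (1/3) ^ Suc J / 2"
      obtain j where j: "j \<in> Y" "z \<in> U j" using Y z by blast
      have "b j z = b j z'" using agree[OF tt J[OF j(1)]] .
      then have "z' \<in> U j" using j(2) by (simp add: b_def split: if_splits)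
      then show "dist z z' < e" using j Y(1) by (auto simp: N_def)
    qed
  qed
  have inj: "inj_on t K"
  proof (rule inj_onI, rule ccontr)
    fix z z' assume z: "z \<in> K" "z' \<in> K" "t z = t z'" "z \<noteq> z'"
    then have "0 < dist z z'" by simp
    from close[OF this] z(1,2) obtain \<delta> where "\<delta> > 0" "\<bar>t z - t z'\<bar> < \<delta> \<longrightarrow> dist z z' < dist z z'"
      by blast
    then show False using z by simp
  qed
  have "uniformly_continuous_on (t ` K) (inv_into K t)"
    unfolding uniformly_continuous_on_def
  proof (intro allI impI)
    fix e :: real assume "e > 0"
    then obtain \<delta> where \<delta>: "\<delta> > 0" "\<And>z z'. z \<in> K \<Longrightarrow> z' \<in> K \<Longrightarrow> \<bar>t z - t z'\<bar> < \<delta> \<Longrightarrow> dist z z' < e"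
      using close by meson
    then show "\<exists>d>0. \<forall>x\<in>t ` K. \<forall>x'\<in>t ` K. dist x' x < d \<longrightarrow> dist (inv_into K t x') (inv_into K t x) < e"
      using inj by (intro exI[of _ \<delta>]) (auto simp: dist_real_def)
  qed
  then obtain g where g: "uniformly_continuous_on (closure (t ` K)) g" "\<And>x. x \<in> t ` K \<Longrightarrow> inv_into K t x = g x"
    by (rule uniformly_continuous_on_extension_on_closure) blast
  have cpt: "compact (closure (t ` K))"
    unfolding compact_closure using t01 by (intro boundedI[of _ 1]) auto
  have gc: "continuous_on (closure (t ` K)) g" using g(1) by (rule uniformly_continuous_imp_continuous)
  have "bounded (g ` closure (t ` K))"
    by (rule compact_imp_bounded[OF compact_continuous_image[OF gc cpt]])
  then obtain B where B: "B > 0" "\<And>x. x \<in> closure (t ` K) \<Longrightarrow> norm (g x) \<le> B"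
    unfolding bounded_pos by (metis imageI)
  obtain \<phi> where \<phi>: "continuous_on UNIV \<phi>" "\<And>x. x \<in> closure (t ` K) \<Longrightarrow> \<phi> x = g x" "\<And>x. norm (\<phi> x) \<le> B"
    using Tietze[OF gc, of UNIV B] B by auto
  show ?thesis
  proof (rule that[of t \<phi> B])
    show "\<phi> (t z) = z" if z: "z \<in> K" for z
    proof -
      have "\<phi> (t z) = g (t z)" using \<phi>(2) closure_subset z by blast
      also have "\<dots> = inv_into K t (t z)" using g(2) z by auto
      finally show ?thesis using inj z by simp
    qed
  qed (use t01 \<phi> in auto)
qed

text \<open>The counting measures are pushed to the unit interval by the coding, where tightness is
  automatic, and the limit on the line is pushed back by the continuous decoding. A continuous test
  function on the plane becomes a bounded continuous one on the line.\<close>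

lemma empirical_weak_limit:
  fixes K :: "complex set" and x :: "nat \<Rightarrow> complex"
  assumes K: "compact K" and x: "\<And>n. x n \<in> K"
  obtains r \<tau> where "strict_mono r" "prob_on K \<tau>"
    "\<And>f :: complex \<Rightarrow> real. continuous_on UNIV f \<Longrightarrow>
       (\<lambda>n. (\<Sum>i<r n. f (x i)) / real (r n)) \<longlonglongrightarrow> (LINT z|\<tau>. f z)"
proof -
  have "K \<noteq> {}" using x by auto
  obtain t :: "complex \<Rightarrow> real" and \<phi> :: "real \<Rightarrow> complex" and B where
    t: "\<And>z. z \<in> K \<Longrightarrow> 0 \<le> t z \<and> t z \<le> 1" and \<phi>: "continuous_on UNIV \<phi>" "\<And>y. norm (\<phi> y) \<le> B"
    "\<And>z. z \<in> K \<Longrightarrow> \<phi> (t z) = z"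
    using real_coding_of_compact[OF K \<open>K \<noteq> {}\<close>] by blast
  \<comment> \<open>\<open>Suc n\<close> points, so that the uniform measure never lives on the
    empty set.\<close>
  define \<mu> where "\<mu> n = distr (uniform_count_measure {..<Suc n}) borel (\<lambda>i. t (x i))" for n
  have ps: "prob_space (uniform_count_measure {..<Suc n})" for n
    by (rule prob_space_uniform_count_measure) auto
  have meas: "g \<in> measurable (uniform_count_measure {..<Suc n}) N" if "\<And>i. g i \<in> space N" for n N and g :: "nat \<Rightarrow> 'b"
    using that by (auto simp: measurable_def sets_uniform_count_measure space_uniform_count_measure)
  have rd: "real_distribution (\<mu> n)" for n
    unfolding \<mu>_def by (rule prob_space.real_distribution_distr[OF ps]) (rule meas, simp)
  have "tight \<mu>"
    unfolding tight_def
  proof (intro conjI allI impI rd)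
    fix \<epsilon> :: real assume \<epsilon>: "\<epsilon> > 0"
    have "measure (\<mu> n) {-1<..2} = 1" for n
    proof -
      have "(\<lambda>i. t (x i)) -` {-1<..2} \<inter> {..<Suc n} = {..<Suc n}"
      proof -
        have "-1 < t (x i) \<and> t (x i) \<le> 2" for i using t[OF x[of i]] by linarith
        then show ?thesis by auto
      qed
      then have "measure (\<mu> n) {-1<..2} = measure (uniform_count_measure {..<Suc n}) {..<Suc n}"
        unfolding \<mu>_def by (subst measure_distr) (auto intro!: meas simp: space_uniform_count_measure)
      also have "\<dots> = 1" by (subst measure_uniform_count_measure) auto
      finally show ?thesis .
    qed
    then show "\<exists>a b. a < b \<and> (\<forall>n. 1 - \<epsilon> < measure (\<mu> n) {a<..b})"
      using \<epsilon> by (intro exI[of _ "-1"] exI[of _ 2]) auto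
  qed
  then obtain r M where r: "strict_mono (r :: nat \<Rightarrow> nat)" and M: "real_distribution M" and
    wc: "weak_conv_m (\<mu> \<circ> id \<circ> r) M"
    using tight_imp_convergent_subsubsequence[of \<mu> id] by (auto simp: strict_mono_id)
  have wc': "weak_conv_m (\<lambda>n. \<mu> (r n)) M" using wc by (simp add: comp_def)
  interpret M: real_distribution M by fact
  define \<tau> where "\<tau> = distr M borel \<phi>"
  have m\<phi>: "\<phi> \<in> measurable M borel"
    using \<phi>(1) by (simp add: borel_measurable_continuous_onI cong: measurable_cong_sets)
  have lim: "(\<lambda>n. (\<Sum>i<Suc (r n). f (x i)) / real (Suc (r n))) \<longlonglongrightarrow> (LINT z|\<tau>. f z)"
    if f: "continuous_on UNIV f" for f :: "complex \<Rightarrow> real"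
  proof -
    have fb: "f \<in> borel_measurable borel" using f by (rule borel_measurable_continuous_onI)
    have "bounded (f ` cball 0 B)"
      by (intro compact_imp_bounded compact_continuous_image continuous_on_subset[OF f]) auto
    then obtain C where C: "\<And>z. z \<in> cball 0 B \<Longrightarrow> norm (f z) \<le> C" unfolding bounded_iff by blast
    have cf: "continuous_on UNIV (\<lambda>y. f (\<phi> y))"
      using continuous_on_compose2[OF f \<phi>(1)] by simp
    have "(\<lambda>n. integral\<^sup>L (\<mu> (r n)) (\<lambda>y. f (\<phi> y))) \<longlonglongrightarrow> integral\<^sup>L M (\<lambda>y. f (\<phi> y))"
    proof (rule weak_conv_imp_integral_bdd_continuous_conv[where B = C])
      show "isCont (\<lambda>y. f (\<phi> y)) y" for y using cf by (simp add: continuous_on_eq_continuous_at)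
      show "norm (f (\<phi> y)) \<le> C" for y using C \<phi>(2) by simp
    qed (use rd M wc' in auto)
    moreover have "integral\<^sup>L (\<mu> (r n)) (\<lambda>y. f (\<phi> y)) = (\<Sum>i<Suc (r n). f (x i)) / real (Suc (r n))" for n
    proof -
      have "integral\<^sup>L (\<mu> (r n)) (\<lambda>y. f (\<phi> y)) = integral\<^sup>L (uniform_count_measure {..<Suc (r n)}) (\<lambda>i. f (\<phi> (t (x i))))"
        unfolding \<mu>_def using cf
        by (subst integral_distr) (auto intro!: meas borel_measurable_continuous_onI)
      also have "\<dots> = (\<Sum>i<Suc (r n). f (x i)) / real (Suc (r n))"
        using \<phi>(3)[OF x] by (subst integral_uniform_count_measure) auto
      finally show ?thesis by simp
    qed
    moreover have "integral\<^sup>L M (\<lambda>y. f (\<phi> y)) = (LINT z|\<tau>. f z)"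
      unfolding \<tau>_def by (subst integral_distr[OF m\<phi> fb]) simp
    ultimately show ?thesis by simp
  qed
  have p\<tau>: "prob_space \<tau>" unfolding \<tau>_def by (rule M.prob_space_distr[OF m\<phi>])
  interpret \<tau>: prob_space \<tau> by fact
  have s\<tau>: "sets \<tau> = sets borel" by (simp add: \<tau>_def)
  have ci: "continuous_on UNIV (\<lambda>z. infdist z K)" by (intro continuous_intros)
  \<comment> \<open>The continuous function \<open>infdist\<close> to \<open>K\<close> vanishes at
    all the points, so its integral against the limit is 0, and the closed set \<open>K\<close>
    carries the limit.\<close>
  have "AE z in \<tau>. infdist z K = 0"
  proof -
    have "(LINT z|\<tau>. infdist z K) = 0"
    proof -
      have "(\<lambda>n. (\<Sum>i<Suc (r n). infdist (x i) K) / real (Suc (r n))) \<longlonglongrightarrow> (LINT z|\<tau>. infdist z K)"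
        by (rule lim[OF ci])
      then have "(\<lambda>n. 0) \<longlonglongrightarrow> (LINT z|\<tau>. infdist z K)" using x by simp
      then show ?thesis using LIMSEQ_unique tendsto_const by metis
    qed
    moreover have "integrable \<tau> (\<lambda>z. infdist z K)"
    proof -
      obtain z0 where z0: "z0 \<in> K" using \<open>K \<noteq> {}\<close> by blast
      have "integrable M (\<lambda>y. infdist (\<phi> y) K)"
      proof (rule M.integrable_const_bound[where B = "B + norm z0"])
        have "infdist (\<phi> y) K \<le> B + norm z0" for y
        proof -
          have "infdist (\<phi> y) K \<le> dist (\<phi> y) z0" by (rule infdist_le[OF z0])
          also have "\<dots> \<le> norm (\<phi> y) + norm z0" by (simp add: dist_norm norm_triangle_ineq4)
          finally show ?thesis using \<phi>(2)[of y] by linarith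
        qed
        then show "AE y in M. norm (infdist (\<phi> y) K) \<le> B + norm z0" by (simp add: infdist_nonneg)
        show "(\<lambda>y. infdist (\<phi> y) K) \<in> borel_measurable M"
          using measurable_compose[OF m\<phi> borel_measurable_continuous_onI[OF ci]] .
      qed
      then show ?thesis
        unfolding \<tau>_def by (subst integrable_distr_eq[OF m\<phi> borel_measurable_continuous_onI[OF ci]])
    qed
    ultimately show ?thesis
      using integral_nonneg_eq_0_iff_AE[of \<tau> "\<lambda>z. infdist z K"] by (simp add: infdist_nonneg)
  qed
  then have AE: "AE z in \<tau>. z \<in> K"
    by (rule eventually_mono) (use in_closed_iff_infdist_zero[OF compact_imp_closed[OF K] \<open>K \<noteq> {}\<close>] in auto)
  show ?thesis
  proof (rule that[of "\<lambda>n. Suc (r n)" \<tau>])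
    show "strict_mono (\<lambda>n. Suc (r n))" using r by (simp add: strict_mono_def)
    show "prob_on K \<tau>" using p\<tau> s\<tau> AE by (simp add: prob_on_def)
  qed (rule lim)
qed

section \<open>Green function and Leja points\<close>

lemma eventually_ln_norm_gt: "\<forall>\<^sub>F z::complex in at_infinity. T < ln (norm z)"
  unfolding eventually_at_infinity
proof (intro exI[of _ "exp T + 1"] allI impI)
  fix z :: complex assume "exp T + 1 \<le> norm z"
  then have "exp T < norm z" by linarith
  then show "T < ln (norm z)"
    by (metis exp_gt_zero exp_less_cancel_iff exp_ln order.strict_trans)
qed

lemma eventually_in_outside:
  fixes K :: "complex set"
  assumes "bounded K"
  shows "\<forall>\<^sub>F z in at_infinity. z \<in> outside K"
proof -
  obtain R where R: "K \<subseteq> cball 0 R" using assms by (metis bounded_iff mem_cball_0 subsetI)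
  have "- cball 0 R \<subseteq> outside K" using outside_subset_convex[OF convex_cball R] .
  then show ?thesis
    unfolding eventually_at_infinity by (intro exI[of _ "R + 1"]) (auto simp: subset_iff)
qed

lemma norm_poly_le_at_infinity:
  fixes p :: "complex poly"
  assumes "degree p \<le> n"
  obtains B where "B > 0" "\<And>z. 1 \<le> norm z \<Longrightarrow> norm (poly p z) \<le> B * norm z ^ n"
proof
  show "1 + (\<Sum>i\<le>degree p. norm (coeff p i)) > 0"
    by (smt (verit) norm_ge_zero sum_nonneg)
  fix z :: complex assume z: "1 \<le> norm z"
  have "norm (poly p z) \<le> (\<Sum>i\<le>degree p. norm (coeff p i * z ^ i))"
    unfolding poly_altdef by (rule norm_sum)
  also have "\<dots> \<le> (\<Sum>i\<le>degree p. norm (coeff p i) * norm z ^ n)"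
    using z assms by (intro sum_mono) (auto simp: norm_mult norm_power intro!: mult_left_mono power_increasing)
  also have "\<dots> \<le> (1 + (\<Sum>i\<le>degree p. norm (coeff p i))) * norm z ^ n"
    by (simp add: sum_distrib_right[symmetric] distrib_right)
  finally show "norm (poly p z) \<le> (1 + (\<Sum>i\<le>degree p. norm (coeff p i))) * norm z ^ n" .
qed

text \<open>\<open>G\<close> is the Green function of the outer domain of \<open>K\<close>, extended by \<open>0\<close>.\<close>

locale green_function =
  fixes K :: "complex set" and G :: "complex \<Rightarrow> real"
  assumes compact_K: "compact K" and nonempty_K: "K \<noteq> {}"
    and continuous_G: "continuous_on UNIV G"
    and G_nonneg: "0 \<le> G z"
    and G_zero: "z \<notin> outside K \<Longrightarrow> G z = 0"
    and G_pos: "z \<in> outside K \<Longrightarrow> 0 < G z"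
    and G_re: "real_part_on_discs G (- K)"
    and G_at_infinity: "\<exists>C. \<forall>\<^sub>F z in at_infinity. \<bar>G z - ln (norm z)\<bar> \<le> C"
begin

text \<open>The lower limit at infinity of \<open>G z - ln (norm z)\<close>, written as the supremum
  of its eventual lower bounds; classically the Robin constant, with \<open>exp (- robin)\<close>
  the capacity of \<open>K\<close>.\<close>

definition robin :: real where
  "robin = Sup {c. \<forall>\<^sub>F z in at_infinity. c \<le> G z - ln (norm z)}"

lemma G_on_K: "z \<in> K \<Longrightarrow> G z = 0"
  using outside_no_overlap[of K] by (intro G_zero) blast

lemma open_compl_K: "open (- K)"
  using compact_K by (simp add: compact_imp_closed open_Compl)

lemma G_tendsto: "(G \<longlongrightarrow> G z) (at z within S)"
  using continuous_G by (metis UNIV_I continuous_on_def tendsto_within_subset top_greatest)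

text \<open>The two halves of a lower limit: the lower bound holds everywhere near infinity, the
  upper one only along some points tending to infinity.\<close>

lemma robin_bounds:
  assumes e: "e > 0"
  shows "\<forall>\<^sub>F z in at_infinity. robin - e < G z - ln (norm z)"
    and "\<exists>\<^sub>F z in at_infinity. G z - ln (norm z) < robin + e"
proof -
  define S where "S = {c. \<forall>\<^sub>F z in at_infinity. c \<le> G z - ln (norm z)}"
  obtain C where C: "\<forall>\<^sub>F z in at_infinity. \<bar>G z - ln (norm z)\<bar> \<le> C" using G_at_infinity by blast
  have "- C \<in> S" unfolding S_def using C by (auto elim!: eventually_mono)
  then have ne: "S \<noteq> {}" by blast
  have "c \<le> C" if "c \<in> S" for c
  proof -
    have "\<forall>\<^sub>F z in at_infinity. c \<le> G z - ln (norm z)" using that by (simp add: S_def)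
    with C have "\<forall>\<^sub>F z::complex in at_infinity. c \<le> C" by eventually_elim linarith
    then show ?thesis by (simp add: trivial_limit_at_infinity eventually_const)
  qed
  then have bdd: "bdd_above S" by (auto simp: bdd_above_def)
  have "robin - e < Sup S" using e by (simp add: robin_def S_def)
  then obtain c where "c \<in> S" "robin - e < c" using less_cSup_iff[OF ne bdd] by blast
  then show "\<forall>\<^sub>F z in at_infinity. robin - e < G z - ln (norm z)"
    unfolding S_def by (auto elim!: eventually_mono)
  have "robin + e \<notin> S"
  proof
    assume "robin + e \<in> S"
    then have "robin + e \<le> robin" unfolding robin_def S_def[symmetric] using bdd by (rule cSup_upper)
    then show False using e by simp
  qed
  then show "\<exists>\<^sub>F z in at_infinity. G z - ln (norm z) < robin + e"
    by (auto simp: S_def frequently_def not_less)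
qed

lemma eventually_G_gt: "\<forall>\<^sub>F z in at_infinity. T < G z"
proof -
  have "\<forall>\<^sub>F z in at_infinity. robin - 1 < G z - ln (norm z)" by (rule robin_bounds(1)) simp
  moreover have "\<forall>\<^sub>F z::complex in at_infinity. T - (robin - 1) < ln (norm z)"
    by (rule eventually_ln_norm_gt)
  ultimately show ?thesis by eventually_elim linarith
qed

lemma bounded_G_le: "bounded {z. G z \<le> T}"
proof -
  obtain b where b: "\<And>z. b \<le> norm z \<Longrightarrow> T < G z"
    using eventually_G_gt[of T] unfolding eventually_at_infinity by blast
  have "norm z \<le> b" if "G z \<le> T" for z
    using b[of z] that by (meson linorder_linear not_less)
  then show ?thesis by (auto simp: bounded_iff)
qed

lemma open_G_less: "open {z. G z < e}"
  using continuous_G by (intro open_Collect_less) auto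

lemma closed_G_le: "closed {z. G z \<le> e}"
  using continuous_G by (intro closed_Collect_le) auto

lemma compact_G_eq: "compact {z. G z = e}"
proof -
  have "closed {z. G z = e}" using continuous_G by (intro closed_Collect_eq) auto
  moreover have "bounded {z. G z = e}"
    by (rule bounded_subset[OF bounded_G_le[of e]]) auto
  ultimately show ?thesis by (simp add: compact_eq_bounded_closed)
qed

lemma frontier_G_less: "frontier {z. G z < e} \<subseteq> {z. G z = e}"
proof -
  have "closure {z. G z < e} \<subseteq> {z. G z \<le> e}"
    by (rule closure_minimal) (auto simp: closed_G_le)
  moreover have "interior {z. G z < e} = {z. G z < e}" by (rule interior_open[OF open_G_less])
  ultimately show ?thesis by (auto simp: frontier_def not_less)
qed

lemma frontier_compl_K: "frontier (- K) \<subseteq> K"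
  using compact_K by (metis compact_imp_closed frontier_complement frontier_subset_closed)

text \<open>Replacing \<open>n\<close> by \<open>n + \<delta>\<close> makes the quotient vanish at infinity, so that no analysis of the
  singularity of \<open>G z - ln \<bar>z\<bar>\<close> at infinity is needed.\<close>

lemma Bernstein_Walsh:
  fixes p :: "complex poly"
  assumes deg: "degree p \<le> n" and M: "\<And>z. z \<in> K \<Longrightarrow> norm (poly p z) \<le> M"
  shows "norm (poly p z) \<le> M * exp (real n * G z)"
proof (cases "z \<in> K")
  case True
  then show ?thesis using M G_on_K by simp
next
  case False
  obtain z0 where z0: "z0 \<in> K" using nonempty_K by blast
  have M0: "0 \<le> M" using M[OF z0] norm_ge_zero order_trans by blast
  have pert: "norm (poly p z) * exp (- (real n + \<delta>) * G z) \<le> M" if \<delta>: "\<delta> > 0" for \<delta>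
  proof (rule maximum_principle[where S = "- K"])
    show "open (- K)" by (rule open_compl_K)
    show "poly p holomorphic_on - K" by (intro holomorphic_intros)
    show "real_part_on_discs (\<lambda>z. - (real n + \<delta>) * G z) (- K)"
      by (rule real_part_on_discs_cmult[OF G_re])
    show "z \<in> - K" using False by simp
  next
    fix \<xi> c assume \<xi>: "\<xi> \<in> frontier (- K)" and c: "c > M"
    have \<xi>K: "\<xi> \<in> K" using \<xi> frontier_compl_K by blast
    have "((\<lambda>z. norm (poly p z) * exp (- (real n + \<delta>) * G z)) \<longlongrightarrow> norm (poly p \<xi>) * exp (- (real n + \<delta>) * G \<xi>)) (at \<xi> within - K)"
      by (intro tendsto_intros G_tendsto)
    moreover have "norm (poly p \<xi>) * exp (- (real n + \<delta>) * G \<xi>) < c"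
      using M[OF \<xi>K] c G_on_K[OF \<xi>K] by simp
    ultimately show "\<forall>\<^sub>F z in at \<xi> within - K. norm (poly p z) * exp (- (real n + \<delta>) * G z) < c"
      by (rule order_tendstoD(2))
  next
    fix c assume c: "c > M"
    then have c0: "c > 0" using M0 by linarith
    obtain B where B: "B > 0" "\<And>z. 1 \<le> norm z \<Longrightarrow> norm (poly p z) \<le> B * norm z ^ n"
      using norm_poly_le_at_infinity[OF deg] by blast
    have "\<forall>\<^sub>F z in at_infinity. robin - 1 < G z - ln (norm z)" by (rule robin_bounds(1)) simp
    moreover have "\<forall>\<^sub>F z::complex in at_infinity. 0 < ln (norm z)" by (rule eventually_ln_norm_gt)
    moreover have "\<forall>\<^sub>F z::complex in at_infinity. (ln B - ln c - (n + \<delta>) * (robin - 1)) / \<delta> < ln (norm z)"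
      by (rule eventually_ln_norm_gt)
    ultimately show "\<forall>\<^sub>F z in at_infinity. z \<in> - K \<longrightarrow> norm (poly p z) * exp (- (real n + \<delta>) * G z) < c"
    proof eventually_elim
      case (elim z)
      have nz: "norm z > 1" using elim(2)
        by (metis ln_less_zero_iff ln_one less_irrefl linorder_neqE_linordered_idom not_less_iff_gr_or_eq norm_eq_zero zero_less_norm_iff ln_0)
      have "norm (poly p z) \<le> B * norm z ^ n" using B nz by simp
      also have "\<dots> = exp (ln B + n * ln (norm z))"
      proof -
        have "exp (ln (norm z)) = norm z" using nz by (intro exp_ln) linarith
        then show ?thesis using B by (simp add: exp_add exp_of_nat_mult)
      qed
      finally have "norm (poly p z) * exp (- (real n + \<delta>) * G z)
          \<le> exp (ln B + n * ln (norm z)) * exp (- (real n + \<delta>) * G z)"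
        by (intro mult_right_mono) auto
      also have "\<dots> = exp (ln B + n * ln (norm z) - (n + \<delta>) * G z)"
        by (simp add: exp_add[symmetric] left_diff_distrib distrib_right)
      also have "\<dots> \<le> exp (ln B + n * ln (norm z) - (n + \<delta>) * (robin - 1 + ln (norm z)))"
      proof -
        have "(n + \<delta>) * (robin - 1 + ln (norm z)) \<le> (n + \<delta>) * G z"
          using elim(1) \<delta> by (intro mult_left_mono) auto
        then show ?thesis by simp
      qed
      also have "\<dots> < exp (ln c)"
        using elim(3) \<delta> by (simp add: field_simps)
      also have "\<dots> = c" using c0 by simp
      finally show ?case by simp
    qed
  qed
  have "norm (poly p z) * exp (- real n * G z) \<le> M"
  proof (rule tendsto_upperbound)
    show "((\<lambda>\<delta>. norm (poly p z) * exp (- (real n + \<delta>) * G z)) \<longlongrightarrow> norm (poly p z) * exp (- real n * G z)) (at_right 0)"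
      by (auto intro!: tendsto_eq_intros)
    show "\<forall>\<^sub>F \<delta> in at_right 0. norm (poly p z) * exp (- (real n + \<delta>) * G z) \<le> M"
      unfolding eventually_at_right_field by (intro exI[of _ 1] conjI allI impI pert) simp_all
  qed simp
  then have "norm (poly p z) * exp (- real n * G z) * exp (real n * G z) \<le> M * exp (real n * G z)"
    by (intro mult_right_mono) auto
  then show ?thesis by (simp add: mult.assoc exp_add[symmetric])
qed

text \<open>In Bernstein-Walsh for the monic polynomial the left side is asymptotic to
  \<open>norm z ^ n\<close>, and the right side is about
  \<open>M * exp (n * robin) * norm z ^ n\<close> at points where the lower limit defining
  \<open>robin\<close> is nearly attained. Cancelling the power leaves the claim.\<close>

lemma monic_lower_bound:
  fixes a :: "nat \<Rightarrow> complex"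
  assumes M: "\<And>z. z \<in> K \<Longrightarrow> (\<Prod>j<n. dist z (a j)) \<le> M"
  shows "exp (- real n * robin) \<le> M"
proof -
  define p where "p = (\<Prod>j<n. [:- a j, 1:])"
  have pz: "poly p z = (\<Prod>j<n. z - a j)" for z by (simp add: p_def poly_prod)
  have np: "norm (poly p z) = (\<Prod>j<n. dist z (a j))" for z
    by (simp add: pz prod_norm[symmetric] dist_norm)
  have deg: "degree p \<le> n"
  proof -
    have "degree p \<le> sum (degree \<circ> (\<lambda>j. [:- a j, 1:])) {..<n}" unfolding p_def by (rule degree_prod_sum_le) simp
    then show ?thesis by simp
  qed
  have lim: "((\<lambda>z. norm (poly p z) / norm z ^ n) \<longlongrightarrow> 1) at_infinity"
  proof -
    have "((\<lambda>z. norm (\<Prod>j<n. 1 - a j / z)) \<longlongrightarrow> norm (\<Prod>j<n. 1 - (0::complex))) at_infinity"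
      by (intro tendsto_intros tendsto_divide_0[OF tendsto_const] filterlim_ident)
    then have "((\<lambda>z. norm (\<Prod>j<n. 1 - a j / z)) \<longlongrightarrow> 1) at_infinity" by simp
    moreover have "\<forall>\<^sub>F z in at_infinity. norm (\<Prod>j<n. 1 - a j / z) = norm (poly p z) / norm z ^ n"
      unfolding eventually_at_infinity
    proof (intro exI[of _ 1] allI impI)
      fix z :: complex assume "1 \<le> norm z"
      then have z: "z \<noteq> 0" by auto
      have "(\<Prod>j<n. 1 - a j / z) = (\<Prod>j<n. (z - a j) / z)" using z by (intro prod.cong) (auto simp: field_simps)
      also have "\<dots> = poly p z / z ^ n" by (simp add: prod_dividef pz)
      finally show "norm (\<Prod>j<n. 1 - a j / z) = norm (poly p z) / norm z ^ n" by (simp add: norm_divide norm_power)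
    qed
    ultimately show ?thesis by (rule Lim_transform_eventually)
  qed
  have BW: "norm (poly p z) \<le> M * exp (real n * G z)" for z
    by (rule Bernstein_Walsh[OF deg]) (use M np in simp)
  obtain z0 where z0: "z0 \<in> K" using nonempty_K by blast
  have M0: "0 \<le> M" using M[OF z0] by (meson order_trans prod_nonneg zero_le_dist)
  have main: "1 - e \<le> M * exp (real n * (robin + e))" if e: "e > 0" for e
  proof -
    have "\<forall>\<^sub>F z in at_infinity. 1 - e < norm (poly p z) / norm z ^ n"
      using order_tendstoD(1)[OF lim, of "1 - e"] e by simp
    moreover have "\<forall>\<^sub>F z::complex in at_infinity. 1 \<le> norm z" unfolding eventually_at_infinity by blast
    ultimately have "\<forall>\<^sub>F z in at_infinity. 1 - e < norm (poly p z) / norm z ^ n \<and> 1 \<le> norm z"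
      by eventually_elim simp
    then have "\<exists>\<^sub>F z in at_infinity. (1 - e < norm (poly p z) / norm z ^ n \<and> 1 \<le> norm z) \<and> G z - ln (norm z) < robin + e"
      by (rule frequently_eventually_conj[OF robin_bounds(2)[OF e]])
    then obtain z where z: "1 - e < norm (poly p z) / norm z ^ n" "1 \<le> norm z" "G z < robin + e + ln (norm z)"
      by (auto dest!: frequently_ex)
    have "(1 - e) * norm z ^ n \<le> norm (poly p z)" using mult_right_mono[OF less_imp_le[OF z(1)], of "norm z ^ n"] z(2) by (auto split: if_splits)
    also have "\<dots> \<le> M * exp (real n * G z)" by (rule BW)
    also have "\<dots> \<le> M * exp (real n * (robin + e + ln (norm z)))"
      using z M0 by (intro mult_left_mono) (auto intro!: mult_left_mono)
    also have "\<dots> = M * exp (real n * (robin + e)) * norm z ^ n"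
    proof -
      have "real n * (robin + e + ln (norm z)) = real n * (robin + e) + real n * ln (norm z)"
        by (simp add: algebra_simps)
      moreover have "exp (real n * ln (norm z)) = norm z ^ n"
      proof -
        have "exp (ln (norm z)) = norm z" using z by (intro exp_ln) linarith
        then show ?thesis by (simp add: exp_of_nat_mult)
      qed
      ultimately show ?thesis by (simp only: exp_add mult.assoc)
    qed
    finally have "(1 - e) * norm z ^ n \<le> M * exp (real n * (robin + e)) * norm z ^ n" .
    moreover have "0 < norm z ^ n" using z(2) by (intro zero_less_power) linarith
    ultimately show ?thesis by (rule mult_right_le_imp_le)
  qed
  have "1 \<le> M * exp (real n * robin)"
  proof (rule tendsto_le)
    show "((\<lambda>e. M * exp (real n * (robin + e))) \<longlongrightarrow> M * exp (real n * robin)) (at_right 0)"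
      by (auto intro!: tendsto_eq_intros)
    show "((\<lambda>e. 1 - e) \<longlongrightarrow> 1) (at_right (0::real))"
      by (auto intro!: tendsto_eq_intros)
    show "\<forall>\<^sub>F e in at_right 0. 1 - e \<le> M * exp (real n * (robin + e))"
      unfolding eventually_at_right_field by (intro exI[of _ 1] conjI allI impI main) simp_all
  qed simp
  then have "exp (- real n * robin) * 1 \<le> exp (- real n * robin) * (M * exp (real n * robin))"
    by (intro mult_left_mono) auto
  then show ?thesis by (simp add: mult.left_commute exp_add[symmetric])
qed

text \<open>Greedy choice: \<open>x n\<close> maximises over \<open>K\<close> the product of the
  distances to the earlier points, and the lower bound for monic polynomials applies to this
  maximum.\<close>

lemma Leja_points:
  obtains x :: "nat \<Rightarrow> complex" where "\<And>n. x n \<in> K"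
    "\<And>n. exp (- real n * robin) \<le> (\<Prod>j<n. dist (x n) (x j))"
proof -
  define P where "P x n y \<longleftrightarrow> y \<in> K \<and> (\<forall>z\<in>K. (\<Prod>j<n. dist z (x j)) \<le> (\<Prod>j<n. dist y (x j)))"
    for x :: "nat \<Rightarrow> complex" and n y
  have "\<exists>x. \<forall>n. P x n (x n)"
  proof (rule dependent_wellorder_choice)
    fix r n and f g :: "nat \<Rightarrow> complex" assume eq: "\<And>y. y < n \<Longrightarrow> f y = g y"
    have "(\<Prod>j<n. dist z (f j)) = (\<Prod>j<n. dist z (g j))" for z using eq by (intro prod.cong) auto
    then show "P f n r = P g n r" by (simp add: P_def)
  next
    fix n and f :: "nat \<Rightarrow> complex"
    have "continuous_on K (\<lambda>z. \<Prod>j<n. dist z (f j))" by (intro continuous_intros)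
    from continuous_attains_sup[OF compact_K nonempty_K this] show "\<exists>r. P f n r"
      by (auto simp: P_def)
  qed
  then obtain x where x: "\<And>n. P x n (x n)" by blast
  show ?thesis
  proof (rule that[of x])
    show "x n \<in> K" for n using x by (simp add: P_def)
    show "exp (- real n * robin) \<le> (\<Prod>j<n. dist (x n) (x j))" for n
      by (rule monic_lower_bound[where a = x]) (use x[of n] in \<open>simp add: P_def\<close>)
  qed
qed

end

text \<open>The boundary limits make the extension by 0 continuous, and on the bounded components of
  the complement it is the zero function, so it is harmonic off all of \<open>K\<close>. A zero in
  the outer domain would force \<open>g\<close> to vanish there by Harnack, against its logarithmic
  growth.\<close>

lemma classical_green_function_imp_green_function:
  assumes K: "compact K" "K \<noteq> {}" and g: "classical_green_function K g"
  shows "green_function K (\<lambda>z. if z \<in> outside K then g z else 0)"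
proof -
  define G where "G z = (if z \<in> outside K then g z else 0)" for z
  have har: "real_part_on_discs g (outside K)" and g0: "\<And>z. z \<in> outside K \<Longrightarrow> 0 \<le> g z"
    and bigO: "(\<lambda>z. g z - ln (norm z)) \<in> O[at_infinity](\<lambda>_. 1)"
    and bd: "\<And>w. w \<in> frontier (outside K) \<Longrightarrow> (g \<longlongrightarrow> 0) (at w within outside K)"
    using g by (auto simp: classical_green_function_def intro: harmonic_on_real_part_on_discs)
  have op: "open (outside K)" using K by (simp add: compact_imp_closed open_outside)
  have bK: "bounded K" using K compact_imp_bounded by blast
  have ev: "\<forall>\<^sub>F z in at_infinity. z \<in> outside K" by (rule eventually_in_outside[OF bK])
  obtain C where C: "\<forall>\<^sub>F z in at_infinity. norm (g z - ln (norm z)) \<le> C * norm (1::real)"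
    using landau_o.bigE[OF bigO] by blast
  have CG: "\<forall>\<^sub>F z in at_infinity. \<bar>G z - ln (norm z)\<bar> \<le> C"
    using C ev by eventually_elim (auto simp: G_def)
  have contG: "isCont G z" for z
  proof (cases "z \<in> outside K")
    case True
    have "isCont g z" using real_part_on_discs_continuous[OF har op] True op
      by (simp add: continuous_on_eq_continuous_at)
    moreover have "\<forall>\<^sub>F w in nhds z. g w = G w"
      using eventually_nhds_in_open[OF op True] by eventually_elim (simp add: G_def)
    ultimately show ?thesis by (metis isCont_cong)
  next
    case False
    have "(G \<longlongrightarrow> 0) (at z)"
    proof (rule tendstoI)
      fix e :: real assume e: "e > 0"
      have "\<forall>\<^sub>F w in at z. w \<in> outside K \<longrightarrow> dist (g w) 0 < e"
      proof (cases "z \<in> closure (outside K)")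
        case True
        then have "z \<in> frontier (outside K)" using False op by (simp add: frontier_def interior_open)
        then have "\<forall>\<^sub>F w in at z within outside K. dist (g w) 0 < e" using bd e tendstoD by blast
        then show ?thesis by (auto simp: eventually_at_filter elim!: eventually_mono)
      next
        case False
        then have "\<forall>\<^sub>F w in nhds z. w \<in> - closure (outside K)"
          by (intro eventually_nhds_in_open) auto
        then show ?thesis
          using closure_subset[of "outside K"] by (auto simp: eventually_at_filter elim!: eventually_mono)
      qed
      then show "\<forall>\<^sub>F w in at z. dist (G w) 0 < e"
        by eventually_elim (use e in \<open>auto simp: G_def\<close>)
    qed
    then show ?thesis using False by (simp add: G_def isCont_def)
  qed
  have re: "real_part_on_discs G (- K)"
    unfolding real_part_on_discs_def
  proof (intro allI impI)
    fix z r assume *: "0 < r \<and> ball z r \<subseteq> - K"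
    show "\<exists>F. F holomorphic_on ball z r \<and> (\<forall>w\<in>ball z r. G w = Re (F w))"
    proof (cases "ball z r \<inter> outside K = {}")
      case True
      then show ?thesis by (intro exI[of _ "\<lambda>_. 0"]) (auto simp: G_def)
    next
      case False
      then obtain x where x: "x \<in> ball z r" "x \<in> outside K" by blast
      have "y \<in> outside K" if "y \<in> ball z r" for y
      proof (rule outside_same_component[OF _ x(2)])
        show "connected_component (- K) x y"
          unfolding connected_component_def using * x that by (intro exI[of _ "ball z r"]) auto
      qed
      then have sub: "ball z r \<subseteq> outside K" by blast
      obtain F where "F holomorphic_on ball z r" "\<And>w. w \<in> ball z r \<Longrightarrow> g w = Re (F w)"
        using real_part_on_discsD[OF har _ sub] * by blast
      then show ?thesis using sub by (intro exI[of _ F]) (auto simp: G_def subset_iff)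
    qed
  qed
  have pos: "0 < g z" if z: "z \<in> outside K" for z
  proof (rule ccontr)
    assume "\<not> 0 < g z"
    then have gz: "g z = 0" using g0[OF z] by simp
    have "\<forall>\<^sub>F w::complex in at_infinity. C < ln (norm w)" by (rule eventually_ln_norm_gt)
    with C ev have "\<forall>\<^sub>F w in at_infinity. 0 < g w \<and> w \<in> outside K"
      by eventually_elim auto
    then obtain w where w: "0 < g w" "w \<in> outside K"
      using eventually_happens'[OF trivial_limit_at_infinity] by blast
    have con: "connected (outside K)" by (rule connected_outside[OF bK]) simp
    obtain D where "D > 0" "\<And>h x y. \<lbrakk>real_part_on_discs h (outside K); \<And>x. x \<in> outside K \<Longrightarrow> 0 \<le> h x; x \<in> {z, w}; y \<in> {z, w}\<rbrakk> \<Longrightarrow> h x \<le> D * h y"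
      using Harnack_compact[OF op con, of "{z, w}"] z w by auto
    from this(2)[OF har g0, of w z] show False using w gz by simp
  qed
  have "green_function K G"
  proof
    show "continuous_on UNIV G" using contG by (simp add: continuous_at_imp_continuous_on)
    show "\<exists>C. \<forall>\<^sub>F z in at_infinity. \<bar>G z - ln (norm z)\<bar> \<le> C" using CG by blast
  qed (use K g0 pos re in \<open>auto simp: G_def\<close>)
  then show ?thesis by (simp add: G_def[abs_def])
qed

section \<open>Energy of the weak limit of the Leja points\<close>

lemma ln_max_Lipschitz:
  fixes s a b :: real
  assumes "s > 0"
  shows "\<bar>ln (max s a) - ln (max s b)\<bar> \<le> \<bar>a - b\<bar> / s"
proof -
  have *: "ln (max s a) - ln (max s b) \<le> \<bar>a - b\<bar> / s" for a b :: real
  proof -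
    have p: "0 < max s a" "0 < max s b" using assms by auto
    have "ln (max s a) - ln (max s b) = ln (max s a / max s b)" using p by (simp add: ln_div)
    also have "\<dots> \<le> max s a / max s b - 1" using p by (intro ln_le_minus_one) simp
    also have "\<dots> = (max s a - max s b) / max s b" using p by (simp add: field_simps)
    also have "\<dots> \<le> \<bar>a - b\<bar> / s" using assms by (intro frac_le) auto
    finally show ?thesis .
  qed
  from *[of a b] *[of b a] show ?thesis by (simp add: abs_le_iff abs_minus_commute)
qed

context green_function
begin

text \<open>The kernel truncated at distance \<open>s\<close> is Lipschitz, so the discrete potentials of the Leja
  points are equicontinuous and converge uniformly on \<open>K\<close>; hence the energies pass to the limit.\<close>

lemma truncated_energy_limit:
  assumes x: "\<And>n. x n \<in> K" and leja: "\<And>n. exp (- real n * robin) \<le> (\<Prod>j<n. dist (x n) (x j))"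
    and r: "strict_mono (r :: nat \<Rightarrow> nat)" and \<tau>: "prob_on K \<tau>"
    and lim: "\<And>f :: complex \<Rightarrow> real. continuous_on UNIV f \<Longrightarrow>
       (\<lambda>n. (\<Sum>i<r n. f (x i)) / real (r n)) \<longlonglongrightarrow> (LINT z|\<tau>. f z)"
    and s: "s > 0"
  shows "(LINT z|\<tau>. (LINT w|\<tau>. L - ln (max s (dist z w)))) \<le> L + robin"
proof -
  interpret \<tau>: prob_space \<tau> using \<tau> by (simp add: prob_on_def)
  define k where "k z w = - ln (max s (dist z w))" for z w :: complex
  have k_Lip: "\<bar>k z w - k z' w\<bar> \<le> dist z z' / s" for z z' w
  proof -
    have "\<bar>k z w - k z' w\<bar> \<le> \<bar>dist z w - dist z' w\<bar> / s"
      using ln_max_Lipschitz[OF s, of "dist z' w" "dist z w"] by (simp add: k_def abs_minus_commute)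
    also have "\<dots> \<le> dist z z' / s"
      using s abs_dist_diff_le[of z w z'] by (intro divide_right_mono) (auto simp: dist_commute)
    finally show ?thesis .
  qed
  have kc: "continuous_on UNIV (k z)" for z
    unfolding k_def using s by (intro continuous_intros) (auto simp: max_def)
  have kint: "integrable \<tau> (k z)" for z
  proof -
    have "bounded (k z ` K)" using compact_K kc
      by (meson compact_continuous_image compact_imp_bounded continuous_on_subset subset_UNIV)
    then obtain B where "\<And>w. w \<in> K \<Longrightarrow> norm (k z w) \<le> B" unfolding bounded_iff by blast
    then show ?thesis by (intro integrable_bounded_prob_on[OF \<tau>] borel_measurable_continuous_onI kc)
  qed
  define U where "U z = (LINT w|\<tau>. k z w)" for z
  define V where "V n z = (\<Sum>i<r n. k z (x i)) / real (r n)" for n z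
  have VU: "(\<lambda>n. V n z) \<longlonglongrightarrow> U z" for z
    unfolding V_def U_def by (rule lim[OF kc])
  have U_Lip: "\<bar>U z - U z'\<bar> \<le> dist z z' / s" for z z'
  proof -
    have "U z - U z' = (LINT w|\<tau>. k z w - k z' w)" unfolding U_def using kint by simp
    also have "\<bar>\<dots>\<bar> \<le> (LINT w|\<tau>. \<bar>k z w - k z' w\<bar>)" by (rule integral_abs_bound)
    also have "\<dots> \<le> dist z z' / s"
      using kint k_Lip by (intro \<tau>.integral_le_const) auto
    finally show ?thesis .
  qed
  have V_Lip: "\<bar>V n z - V n z'\<bar> \<le> dist z z' / s" for n z z'
  proof -
    have "V n z - V n z' = (\<Sum>i<r n. k z (x i) - k z' (x i)) / real (r n)"
      by (simp add: V_def sum_subtractf diff_divide_distrib)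
    also have "\<bar>\<dots>\<bar> \<le> (\<Sum>i<r n. \<bar>k z (x i) - k z' (x i)\<bar>) / real (r n)"
      by (auto simp: abs_divide intro!: divide_right_mono)
    also have "\<dots> \<le> (\<Sum>i<r n. dist z z' / s) / real (r n)"
      by (intro divide_right_mono sum_mono k_Lip) auto
    also have "\<dots> \<le> dist z z' / s" using s by (cases "r n = 0") auto
    finally show ?thesis .
  qed
  have U_cont: "continuous_on UNIV U"
  proof (rule continuous_onI)
    fix z e assume e: "(0::real) < e"
    show "\<exists>d>0. \<forall>x'\<in>UNIV. dist x' z < d \<longrightarrow> dist (U x') (U z) \<le> e"
    proof (intro exI[of _ "e * s"] conjI ballI impI)
      show "0 < e * s" using e s by simp
      fix x' assume "dist x' z < e * s"
      then have "dist x' z / s < e" using s by (simp add: field_simps)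
      then show "dist (U x') (U z) \<le> e" using U_Lip[of x' z] by (simp add: dist_real_def)
    qed
  qed
  have avgU: "(\<lambda>n. (\<Sum>i<r n. U (x i)) / real (r n)) \<longlonglongrightarrow> (LINT z|\<tau>. U z)"
    by (rule lim[OF U_cont])
  have rtop: "filterlim (\<lambda>n. real (r n)) at_top sequentially"
    by (rule filterlim_compose[OF filterlim_real_sequentially filterlim_subseq[OF r]])
  have pair: "k (x i) (x j) = k (x j) (x i)" for i j by (simp add: k_def dist_commute)
  \<comment> \<open>The truncated kernel is at most the untruncated one, and the logarithm of the
    Leja inequality is a bound for the untruncated row below the diagonal.\<close>
  have row: "(\<Sum>j<i. k (x i) (x j)) \<le> real i * robin" for i
  proof -
    have P: "0 < (\<Prod>j<i. dist (x i) (x j))"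
      using leja[of i] exp_gt_zero order.strict_trans2 by blast
    then have nz: "dist (x i) (x j) > 0" if "j < i" for j
      using that by (metis finite_lessThan lessThan_iff less_irrefl prod_zero zero_less_dist_iff dist_eq_0_iff)
    have "(\<Sum>j<i. k (x i) (x j)) \<le> (\<Sum>j<i. - ln (dist (x i) (x j)))"
    proof (rule sum_mono)
      fix j assume "j \<in> {..<i}"
      then have "ln (dist (x i) (x j)) \<le> ln (max s (dist (x i) (x j)))"
        using nz[of j] by (subst ln_le_cancel_iff) (auto simp: less_max_iff_disj)
      then show "k (x i) (x j) \<le> - ln (dist (x i) (x j))" by (simp add: k_def)
    qed
    also have "\<dots> = - ln (\<Prod>j<i. dist (x i) (x j))"
      using nz by (subst ln_prod) (auto simp: sum_negf)
    also have "\<dots> \<le> real i * robin"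
    proof -
      have "ln (exp (- real i * robin)) \<le> ln (\<Prod>j<i. dist (x i) (x j))"
        using leja[of i] P by (subst ln_le_cancel_iff) auto
      then show ?thesis by simp
    qed
    finally show ?thesis .
  qed
  \<comment> \<open>Each of the \<open>n\<close> diagonal terms equals \<open>- ln s\<close>. The
    remaining terms are twice the rows below the diagonal, and
    \<open>2 * (0 + ... + (n - 1)) = n * (n - 1)\<close>. The diagonal becomes negligible after
    division by the square of \<open>n\<close>.\<close>
  have double: "(\<Sum>i<n. \<Sum>j<n. k (x i) (x j)) \<le> real n * (- ln s) + real n * (real n - 1) * robin" for n
  proof (induction n)
    case (Suc n)
    have "(\<Sum>i<Suc n. \<Sum>j<Suc n. k (x i) (x j))
       = (\<Sum>i<n. \<Sum>j<n. k (x i) (x j)) + (\<Sum>i<n. k (x i) (x n)) + (\<Sum>j<n. k (x n) (x j)) + k (x n) (x n)"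
      by (simp add: sum.distrib)
    also have "(\<Sum>i<n. k (x i) (x n)) = (\<Sum>j<n. k (x n) (x j))"
      by (intro sum.cong refl pair)
    also have "k (x n) (x n) = - ln s" using s by (simp add: k_def)
    also have "(\<Sum>i<n. \<Sum>j<n. k (x i) (x j)) + (\<Sum>j<n. k (x n) (x j)) + (\<Sum>j<n. k (x n) (x j)) + - ln s
       \<le> (real n * (- ln s) + real n * (real n - 1) * robin) + real n * robin + real n * robin + - ln s"
      using Suc.IH row[of n] by linarith
    also have "\<dots> = real (Suc n) * (- ln s) + real (Suc n) * (real (Suc n) - 1) * robin"
      by (simp add: algebra_simps)
    finally show ?case .
  qed simp
  have avgV: "(\<Sum>i<r n. V n (x i)) / real (r n) \<le> \<bar>ln s\<bar> / real (r n) + robin - robin / real (r n)" if "r n > 0" for n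
  proof -
    have "(\<Sum>i<r n. V n (x i)) = (\<Sum>i<r n. \<Sum>j<r n. k (x i) (x j)) / real (r n)"
      by (simp add: V_def sum_divide_distrib)
    also have "\<dots> \<le> (real (r n) * (- ln s) + real (r n) * (real (r n) - 1) * robin) / real (r n)"
      by (intro divide_right_mono double) auto
    also have "\<dots> = - ln s + (real (r n) - 1) * robin" using that by (simp add: field_simps)
    also have "\<dots> \<le> \<bar>ln s\<bar> + (real (r n) - 1) * robin" by simp
    finally have "(\<Sum>i<r n. V n (x i)) / real (r n) \<le> (\<bar>ln s\<bar> + (real (r n) - 1) * robin) / real (r n)"
      by (intro divide_right_mono) auto
    also have "\<dots> = \<bar>ln s\<bar> / real (r n) + robin - robin / real (r n)"
      using that by (simp add: field_simps)
    finally show ?thesis .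
  qed
  \<comment> \<open>A finite net of mesh \<open>e * s\<close> turns pointwise convergence of the
    discrete potentials into uniform convergence on \<open>K\<close>: two Lipschitz errors and one
    error on the net add up to \<open>3 * e\<close>.\<close>
  have bound: "(LINT z|\<tau>. U z) \<le> robin + 3 * e" if e: "e > 0" for e
  proof -
    have "K \<subseteq> (\<Union>y\<in>K. ball y (e * s))" using e s by auto
    then obtain Y where Y: "Y \<subseteq> K" "finite Y" "K \<subseteq> (\<Union>y\<in>Y. ball y (e * s))"
      using compactE_image[OF compact_K, of K "\<lambda>y. ball y (e * s)"] by auto
    have "\<forall>\<^sub>F n in sequentially. \<forall>y\<in>Y. \<bar>V n y - U y\<bar> < e"
      using Y(2) VU e unfolding tendsto_iff dist_real_def by (intro eventually_ball_finite) auto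
    moreover have "\<forall>\<^sub>F n in sequentially. 0 < real (r n)"
      using rtop unfolding filterlim_at_top_dense by blast
    ultimately have "\<forall>\<^sub>F n in sequentially. (\<Sum>i<r n. U (x i)) / real (r n)
        \<le> (\<bar>ln s\<bar> / real (r n) + robin - robin / real (r n)) + 3 * e"
    proof eventually_elim
      case (elim n)
      have close: "U z \<le> V n z + 3 * e" if z: "z \<in> K" for z
      proof -
        obtain y where y: "y \<in> Y" "dist y z < e * s" using Y(3) z by auto
        have "dist z y / s < e" using y(2) s by (simp add: field_simps dist_commute)
        then have "\<bar>U z - U y\<bar> < e" "\<bar>V n z - V n y\<bar> < e"
          using U_Lip[of z y] V_Lip[of n z y] by linarith+
        moreover have "\<bar>V n y - U y\<bar> < e" using elim(1) y(1) by blast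
        ultimately show ?thesis by linarith
      qed
      have "(\<Sum>i<r n. U (x i)) / real (r n) \<le> (\<Sum>i<r n. V n (x i) + 3 * e) / real (r n)"
        by (intro divide_right_mono sum_mono close x) auto
      also have "\<dots> = (\<Sum>i<r n. V n (x i)) / real (r n) + 3 * e"
        using elim(2) by (simp add: sum.distrib add_divide_distrib)
      finally show ?case using avgV[of n] elim(2) by simp
    qed
    moreover have "(\<lambda>n. (\<bar>ln s\<bar> / real (r n) + robin - robin / real (r n)) + 3 * e) \<longlonglongrightarrow> (0 + robin - 0) + 3 * e"
      by (intro tendsto_intros real_tendsto_divide_at_top[OF tendsto_const rtop])
    ultimately show ?thesis
      using tendsto_le[OF sequentially_bot _ avgU] by force
  qed
  have "(LINT z|\<tau>. U z) \<le> robin + e" if "e > 0" for e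
    using bound[of "e / 3"] that by simp
  then have "(LINT z|\<tau>. U z) \<le> robin" by (rule field_le_epsilon)
  moreover have "bounded (U ` K)"
    by (rule compact_imp_bounded[OF compact_continuous_image[OF continuous_on_subset[OF U_cont subset_UNIV] compact_K]])
  then obtain B where "\<And>z. z \<in> K \<Longrightarrow> norm (U z) \<le> B" unfolding bounded_iff by blast
  then have "integrable \<tau> U" by (intro integrable_bounded_prob_on[OF \<tau>] borel_measurable_continuous_onI U_cont)
  then have "(LINT z|\<tau>. L + U z) = L + (LINT z|\<tau>. U z)" by (simp add: \<tau>.prob_space)
  moreover have "(LINT w|\<tau>. L - ln (max s (dist z w))) = L + U z" for z
  proof -
    have "(LINT w|\<tau>. L + k z w) = L + U z" using kint by (simp add: U_def \<tau>.prob_space)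
    then show ?thesis by (simp add: k_def)
  qed
  ultimately show ?thesis by simp
qed

text \<open>Every truncation of the kernel has energy at most \<open>L + robin\<close> for the weak
  limit. As the truncation radius decreases to 0, monotone convergence yields the full kernel; the
  shift by \<open>L\<close> makes the truncated kernels non-negative on \<open>K\<close>.\<close>

lemma exists_energy_le_robin:
  assumes L: "\<And>z w. z \<in> K \<Longrightarrow> w \<in> K \<Longrightarrow> dist z w \<le> exp L"
  obtains \<tau> where "prob_on K \<tau>" "shifted_energy L \<tau> \<le> ennreal (L + robin)"
proof -
  obtain x where x: "\<And>n. x n \<in> K" and leja: "\<And>n. exp (- real n * robin) \<le> (\<Prod>j<n. dist (x n) (x j))"
    using Leja_points by blast
  obtain r \<tau> where r: "strict_mono (r :: nat \<Rightarrow> nat)" and \<tau>: "prob_on K \<tau>"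
    and lim: "\<And>f :: complex \<Rightarrow> real. continuous_on UNIV f \<Longrightarrow>
       (\<lambda>n. (\<Sum>i<r n. f (x i)) / real (r n)) \<longlonglongrightarrow> (LINT z|\<tau>. f z)"
    using empirical_weak_limit[of K x, OF compact_K x] by blast
  interpret \<tau>: prob_space \<tau> using \<tau> by (simp add: prob_on_def)
  have st: "sets \<tau> = sets borel" and AE: "AE w in \<tau>. w \<in> K" using \<tau> by (auto simp: prob_on_def)
  note [measurable_cong] = st
  \<comment> \<open>Starting the radii at \<open>exp L\<close> keeps \<open>k\<close> non-negative
    on \<open>K\<close>; halving gives the diagonal value \<open>n * ln 2\<close>, which is
    unbounded as required for the infinite value of the kernel there.\<close>
  define s where "s n = exp L / 2 ^ n" for n :: nat
  have s: "0 < s n" "s n \<le> exp L" for n by (auto simp: s_def field_simps)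
  define k where "k n z w = L - ln (max (s n) (dist z w))" for n and z w :: complex
  have k0: "0 \<le> k n z w" if "z \<in> K" "w \<in> K" for n z w
  proof -
    have "ln (max (s n) (dist z w)) \<le> ln (exp L)"
      using L[OF that] s[of n] by (subst ln_le_cancel_iff) auto
    then show ?thesis by (simp add: k_def)
  qed
  have kb: "k n z w \<le> L - ln (s n)" for n z w
    using s(1)[of n] by (simp add: k_def)
  have kmeas: "(\<lambda>p. k n (fst p) (snd p)) \<in> borel_measurable (borel \<Otimes>\<^sub>M borel)" for n
  proof -
    have [measurable]: "(\<lambda>x. dist (fst x) (snd x)) \<in> borel_measurable (borel \<Otimes>\<^sub>M (borel :: complex measure))"
      by measurable
    show ?thesis unfolding k_def by measurable
  qed
  have kmeas1: "k n z \<in> borel_measurable borel" for n z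
    unfolding k_def using s(1)[of n]
    by (intro borel_measurable_continuous_onI continuous_intros) (auto simp: max_def)
  have kint: "integrable \<tau> (k n z)" if "z \<in> K" for n z
  proof (rule integrable_bounded_prob_on[OF \<tau> kmeas1])
    show "norm (k n z w) \<le> L - ln (s n)" if "w \<in> K" for w
      using k0[OF \<open>z \<in> K\<close> that, of n] kb[of n z w] by simp
  qed
  define I where "I n z = (LINT w|\<tau>. k n z w)" for n z
  have I0: "0 \<le> I n z" if "z \<in> K" for n z
    unfolding I_def by (rule integral_nonneg_AE, use AE in eventually_elim) (simp add: k0 that)
  have nnI: "(\<integral>\<^sup>+w. ennreal (k n z w) \<partial>\<tau>) = ennreal (I n z)" if "z \<in> K" for n z
    unfolding I_def by (rule nn_integral_eq_integral[OF kint[OF that]], use AE in eventually_elim) (simp add: k0 that)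
  have Imeas: "I n \<in> borel_measurable borel" for n
  proof -
    have "(\<lambda>(z, w). k n z w) \<in> borel_measurable (borel \<Otimes>\<^sub>M \<tau>)"
      using kmeas[of n] by (simp add: case_prod_beta cong: measurable_cong_sets sets_pair_measure_cong)
    then show ?thesis unfolding I_def by (rule \<tau>.borel_measurable_lebesgue_integral)
  qed
  have Iint: "integrable \<tau> (I n)" for n
  proof (rule integrable_bounded_prob_on[OF \<tau> Imeas])
    fix z assume z: "z \<in> K"
    have "I n z \<le> L - ln (s n)"
      unfolding I_def using kb by (intro \<tau>.integral_le_const kint z) auto
    then show "norm (I n z) \<le> L - ln (s n)" using I0[OF z, of n] by simp
  qed
  have energy: "(\<integral>\<^sup>+z. (\<integral>\<^sup>+w. ennreal (k n z w) \<partial>\<tau>) \<partial>\<tau>) \<le> ennreal (L + robin)" for n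
  proof -
    have "(\<integral>\<^sup>+z. (\<integral>\<^sup>+w. ennreal (k n z w) \<partial>\<tau>) \<partial>\<tau>) = (\<integral>\<^sup>+z. ennreal (I n z) \<partial>\<tau>)"
      by (rule nn_integral_cong_AE, use AE in eventually_elim) (simp add: nnI)
    also have "\<dots> = ennreal (LINT z|\<tau>. I n z)"
      by (rule nn_integral_eq_integral[OF Iint], use AE in eventually_elim) (simp add: I0)
    also have "\<dots> \<le> ennreal (L + robin)"
      unfolding I_def k_def by (rule ennreal_leI) (rule truncated_energy_limit[OF x leja r \<tau> lim s(1)])
    finally show ?thesis .
  qed
  have smono: "s (Suc n) \<le> s n" for n by (simp add: s_def field_simps)
  have kmono: "k n z w \<le> k (Suc n) z w" for n z w
  proof -
    have "ln (max (s (Suc n)) (dist z w)) \<le> ln (max (s n) (dist z w))"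
      using s(1)[of n] s(1)[of "Suc n"] smono[of n] by (subst ln_le_cancel_iff) (auto simp: max_def)
    then show ?thesis by (simp add: k_def)
  qed
  have kinc: "incseq (\<lambda>n. ennreal (k n z w))" for z w
    using kmono by (intro incseq_SucI ennreal_leI)
  have ksup: "shifted_kernel L z w \<le> (SUP n. ennreal (k n z w))" for z w
  proof (cases "z = w")
    case True
    have "(SUP n. ennreal (k n z w)) = top"
    proof (rule ennreal_SUP_eq_top)
      fix N :: nat
      have "(\<lambda>n. real n * ln 2) = (\<lambda>n. k n z w)"
      proof
        fix n
        have "max (s n) (dist z w) = s n" using True s(1)[of n] by simp
        moreover have "ln (s n) = L - real n * ln 2" by (simp add: s_def ln_div ln_realpow)
        ultimately show "real n * ln 2 = k n z w" by (simp add: k_def)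
      qed
      moreover obtain n where "real N < real n * ln 2"
        using reals_Archimedean3[of "ln (2::real)"] by auto
      ultimately have "real N \<le> k n z w" by (metis less_imp_le)
      then have "of_nat N \<le> ennreal (k n z w)"
        by (simp add: ennreal_of_nat_eq_real_of_nat ennreal_leI)
      then show "\<exists>n\<in>UNIV. of_nat N \<le> ennreal (k n z w)" by blast
    qed
    then show ?thesis by (simp only: top_greatest)
  next
    case False
    then have d: "dist z w > 0" by simp
    have "(\<lambda>n. exp L * (1/2) ^ n) \<longlonglongrightarrow> exp L * 0"
      by (intro tendsto_intros LIMSEQ_power_zero) simp
    moreover have "(\<lambda>n. exp L * (1/2) ^ n) = s" by (simp add: fun_eq_iff s_def power_divide)
    ultimately have "s \<longlonglongrightarrow> 0" by simp
    then have "\<forall>\<^sub>F n in sequentially. s n < dist z w" using d by (rule order_tendstoD)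
    then obtain n where "s n < dist z w" by (auto simp: eventually_sequentially)
    then have "shifted_kernel L z w = ennreal (k n z w)" using False by (simp add: k_def shifted_kernel_def max_def)
    also have "\<dots> \<le> (SUP n. ennreal (k n z w))" by (rule SUP_upper) simp
    finally show ?thesis .
  qed
  have m1: "(\<lambda>w. ennreal (k n z w)) \<in> borel_measurable \<tau>" for n z
    using kmeas1[of n z] by (simp cong: measurable_cong_sets add: st)
  have m2: "(\<lambda>z. \<integral>\<^sup>+w. ennreal (k n z w) \<partial>\<tau>) \<in> borel_measurable \<tau>" for n
  proof -
    have "(\<lambda>(z, w). ennreal (k n z w)) \<in> borel_measurable (\<tau> \<Otimes>\<^sub>M \<tau>)"
    proof -
      have "(\<lambda>p. ennreal (k n (fst p) (snd p))) \<in> borel_measurable (borel \<Otimes>\<^sub>M borel)"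
        using kmeas[of n] by measurable
      then show ?thesis by (simp add: case_prod_beta st cong: measurable_cong_sets sets_pair_measure_cong)
    qed
    then show ?thesis by (rule \<tau>.borel_measurable_nn_integral)
  qed
  have "shifted_energy L \<tau> \<le> (\<integral>\<^sup>+z. (\<integral>\<^sup>+w. (SUP n. ennreal (k n z w)) \<partial>\<tau>) \<partial>\<tau>)"
    unfolding shifted_energy_def shifted_pot_def by (intro nn_integral_mono ksup)
  also have "\<dots> = (\<integral>\<^sup>+z. (SUP n. \<integral>\<^sup>+w. ennreal (k n z w) \<partial>\<tau>) \<partial>\<tau>)"
  proof (rule nn_integral_cong)
    fix z
    have "incseq (\<lambda>n w. ennreal (k n z w))"
      using kinc unfolding incseq_def le_fun_def by blast
    then show "(\<integral>\<^sup>+w. (SUP n. ennreal (k n z w)) \<partial>\<tau>) = (SUP n. \<integral>\<^sup>+w. ennreal (k n z w) \<partial>\<tau>)"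
      by (rule nn_integral_monotone_convergence_SUP) (rule m1)
  qed
  also have "\<dots> = (SUP n. \<integral>\<^sup>+z. (\<integral>\<^sup>+w. ennreal (k n z w) \<partial>\<tau>) \<partial>\<tau>)"
  proof (rule nn_integral_monotone_convergence_SUP[OF _ m2])
    show "incseq (\<lambda>n z. \<integral>\<^sup>+w. ennreal (k n z w) \<partial>\<tau>)"
      using kinc unfolding incseq_def le_fun_def by (blast intro: nn_integral_mono)
  qed
  also have "\<dots> \<le> ennreal (L + robin)" by (intro SUP_least energy)
  finally show ?thesis using that \<tau> by blast
qed

end

section \<open>Energy and capacity\<close>

lemma compl_measure_supp:
  "- measure_supp \<mu> = \<Union>{ball z r |z r. r > 0 \<and> emeasure \<mu> (ball z r) = 0}" (is "_ = \<Union>?F")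
  if s: "sets \<mu> = sets borel"
proof (intro equalityI subsetI)
  fix z assume "z \<in> - measure_supp \<mu>"
  then obtain r where r: "r > 0" "emeasure \<mu> (ball z r) = 0"
    by (auto simp: measure_supp_def not_gr_zero)
  then show "z \<in> \<Union>?F" by (intro UnionI[of "ball z r"]) auto
next
  fix w assume "w \<in> \<Union>?F"
  then obtain z r where zr: "r > 0" "emeasure \<mu> (ball z r) = 0" "w \<in> ball z r" by blast
  obtain e where e: "e > 0" "ball w e \<subseteq> ball z r"
    using zr(3) open_ball[of z r] unfolding open_contains_ball by blast
  have "emeasure \<mu> (ball w e) \<le> emeasure \<mu> (ball z r)" using e s by (intro emeasure_mono) auto
  then have "emeasure \<mu> (ball w e) = 0" using zr(2) by simp
  then show "w \<in> - measure_supp \<mu>" using e(1) by (auto simp: measure_supp_def)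
qed

lemma closed_measure_supp:
  assumes "sets \<mu> = sets borel"
  shows "closed (measure_supp \<mu>)"
proof -
  have "open (- measure_supp \<mu>)"
    unfolding compl_measure_supp[OF assms] by (rule open_Union) auto
  then show ?thesis by (simp add: closed_def)
qed

text \<open>The complement of the support is a union of open null balls, and by the Lindelof
  property countably many of them have the same union.\<close>

lemma AE_in_measure_supp:
  assumes s: "sets \<mu> = sets borel"
  shows "AE z in \<mu>. z \<in> measure_supp \<mu>"
proof -
  define F where "F = {ball z r |z r. r > 0 \<and> emeasure \<mu> (ball z r) = 0}"
  obtain F' where F': "F' \<subseteq> F" "countable F'" "\<Union>F' = \<Union>F"
  proof (rule Lindelof[of F])
    show "open S" if "S \<in> F" for S using that by (auto simp: F_def)
  qed
  have "(\<Union>X\<in>F'. X) \<in> null_sets \<mu>"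
  proof (rule null_sets_UN'[OF F'(2)])
    fix X assume "X \<in> F'"
    then obtain z r where "X = ball z r" "emeasure \<mu> (ball z r) = 0" using F'(1) by (auto simp: F_def)
    then show "X \<in> null_sets \<mu>" using s by (intro null_setsI) auto
  qed
  moreover have "(\<Union>X\<in>F'. X) = - measure_supp \<mu>"
    using F'(3) compl_measure_supp[OF s] by (simp add: F_def)
  ultimately show ?thesis
    using AE_not_in[of "- measure_supp \<mu>" \<mu>] by simp
qed

lemma prob_on_measure_supp:
  assumes "\<nu> \<in> prob_measures E"
  shows "prob_on (measure_supp \<nu>) \<nu>" "measure_supp \<nu> \<subseteq> E"
  using assms AE_in_measure_supp by (auto simp: prob_measures_def pos_measures_def prob_on_def)

text \<open>Makes every measure carried by a compact subset, such as the weak limit of the Leja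
  points, a competitor in the supremum that defines \<open>log_cap\<close>.\<close>

lemma prob_on_in_prob_measures:
  assumes \<nu>: "prob_on F \<nu>" and F: "compact F" "F \<subseteq> E"
  shows "\<nu> \<in> {\<nu> \<in> prob_measures E. compact (measure_supp \<nu>)}"
proof -
  have s: "sets \<nu> = sets borel" and AE: "AE w in \<nu>. w \<in> F" and ps: "prob_space \<nu>"
    using \<nu> by (auto simp: prob_on_def)
  interpret prob_space \<nu> by fact
  have sub: "measure_supp \<nu> \<subseteq> F"
  proof
    fix z assume z: "z \<in> measure_supp \<nu>"
    show "z \<in> F"
    proof (rule ccontr)
      assume "z \<notin> F"
      then obtain r where r: "r > 0" "ball z r \<subseteq> - F"
        using F(1) by (metis ComplI compact_imp_closed open_Compl open_contains_ball)
      have "AE w in \<nu>. w \<notin> ball z r" using AE by eventually_elim (use r in blast)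
      then have "ball z r \<in> null_sets \<nu>" by (subst AE_iff_null_sets) (use s in auto)
      then have "emeasure \<nu> (ball z r) = 0" by blast
      then show False using z r(1) by (auto simp: measure_supp_def)
    qed
  qed
  have "compact (measure_supp \<nu>)"
    using compact_Int_closed[OF F(1) closed_measure_supp[OF s]] sub by (simp add: inf.absorb2)
  moreover have "finite_measure \<nu>" by unfold_locales
  ultimately show ?thesis
    using sub F(2) s ps by (auto simp: prob_measures_def pos_measures_def)
qed

text \<open>On \<open>K\<close> the shifted kernel plus the negative part equals the positive part
  plus \<open>L\<close>, an identity between sums, hence safe in \<open>ennreal\<close>. The
  integral of the negative part is at most \<open>L\<close>, so it is finite and can be subtracted
  at the end.\<close>

lemma log_energy_eq_shifted_energy:
  assumes \<nu>: "prob_on K \<nu>" and L: "0 \<le> L" "\<And>z w. z \<in> K \<Longrightarrow> w \<in> K \<Longrightarrow> dist z w \<le> exp L"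
  shows "log_energy \<nu> = enn2ereal (shifted_energy L \<nu>) - ereal L"
proof -
  interpret prob_space \<nu> using \<nu> by (simp add: prob_on_def)
  have s: "sets \<nu> = sets borel" and AE: "AE w in \<nu>. w \<in> K" using \<nu> by (auto simp: prob_on_def)
  define n where "n z w = ennreal (ln (dist z w))" for z w :: complex
  have p: "e2ennreal (log_kernel z w) = shifted_kernel 0 z w" for z w
    by (simp add: log_kernel_def shifted_kernel_def ln_div e2ennreal_ereal)
  have n: "e2ennreal (- log_kernel z w) = n z w" for z w
    by (simp add: log_kernel_def n_def ln_div e2ennreal_ereal e2ennreal_neg)
  have nm: "(\<lambda>w. n z w) \<in> borel_measurable \<nu>" for z
  proof -
    have "(\<lambda>w. ln (dist z w)) \<in> borel_measurable borel"
      using borel_measurable_uminus[OF measurable_ln_dist[of z]] by simp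
    then show ?thesis unfolding n_def by (simp add: s cong: measurable_cong_sets)
  qed
  have nm2: "(\<lambda>z. \<integral>\<^sup>+w. n z w \<partial>\<nu>) \<in> borel_measurable \<nu>"
  proof (rule borel_measurable_nn_integral)
    note [measurable_cong] = s
    have [measurable]: "(\<lambda>x. dist (fst x) (snd x)) \<in> borel_measurable (\<nu> \<Otimes>\<^sub>M \<nu>)"
      by measurable
    show "(\<lambda>(z, w). n z w) \<in> borel_measurable (\<nu> \<Otimes>\<^sub>M \<nu>)"
      unfolding n_def case_prod_beta by measurable
  qed
  have pw: "shifted_kernel L z w + n z w = shifted_kernel 0 z w + ennreal L" if zw: "z \<in> K" "w \<in> K" for z w
  proof (cases "z = w")
    case False
    define x where "x = ln (dist z w)"
    have "x \<le> ln (exp L)" unfolding x_def using L(2)[OF zw] False by (subst ln_le_cancel_iff) auto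
    then have x: "x \<le> L" by simp
    have "ennreal (L - x) + ennreal x = ennreal (0 - x) + ennreal L"
    proof (cases "0 \<le> x")
      case True
      then show ?thesis using x by (simp add: ennreal_plus[symmetric] ennreal_neg del: ennreal_plus)
    next
      case False
      then show ?thesis using x L(1) by (simp add: ennreal_plus[symmetric] ennreal_neg del: ennreal_plus)
    qed
    then show ?thesis using False by (simp add: shifted_kernel_def n_def x_def)
  qed (simp add: shifted_kernel_def)
  have nL: "n z w \<le> ennreal L" if "z \<in> K" "w \<in> K" for z w
  proof (cases "z = w")
    case False
    then have "ln (dist z w) \<le> ln (exp L)" using L(2)[OF that] by (subst ln_le_cancel_iff) auto
    then show ?thesis by (simp add: n_def ennreal_leI)
  qed (simp add: n_def)
  define N where "N = (\<integral>\<^sup>+z. (\<integral>\<^sup>+w. n z w \<partial>\<nu>) \<partial>\<nu>)"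
  have "N \<le> (\<integral>\<^sup>+z. (\<integral>\<^sup>+w. ennreal L \<partial>\<nu>) \<partial>\<nu>)"
    unfolding N_def
  proof (rule nn_integral_mono_AE, use AE in eventually_elim)
    fix z assume "z \<in> K"
    then show "(\<integral>\<^sup>+w. n z w \<partial>\<nu>) \<le> (\<integral>\<^sup>+w. ennreal L \<partial>\<nu>)"
      by (intro nn_integral_mono_AE, use AE in eventually_elim) (rule nL)
  qed
  then have NL: "N \<le> ennreal L" by (simp add: emeasure_space_1)
  have "shifted_energy L \<nu> + N = (\<integral>\<^sup>+z. shifted_pot L \<nu> z + (\<integral>\<^sup>+w. n z w \<partial>\<nu>) \<partial>\<nu>)"
    unfolding shifted_energy_def N_def
    using nm2 measurable_shifted_pot[OF \<nu> s] by (subst nn_integral_add) auto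
  also have "\<dots> = (\<integral>\<^sup>+z. shifted_pot 0 \<nu> z + ennreal L \<partial>\<nu>)"
  proof (rule nn_integral_cong_AE, use AE in eventually_elim)
    fix z assume z: "z \<in> K"
    have "shifted_pot L \<nu> z + (\<integral>\<^sup>+w. n z w \<partial>\<nu>) = (\<integral>\<^sup>+w. shifted_kernel L z w + n z w \<partial>\<nu>)"
      unfolding shifted_pot_def using nm measurable_shifted_kernel[OF s] by (subst nn_integral_add) auto
    also have "\<dots> = (\<integral>\<^sup>+w. shifted_kernel 0 z w + ennreal L \<partial>\<nu>)"
      by (rule nn_integral_cong_AE, use AE in eventually_elim) (rule pw[OF z])
    also have "\<dots> = shifted_pot 0 \<nu> z + ennreal L"
      unfolding shifted_pot_def using measurable_shifted_kernel[OF s]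
      by (subst nn_integral_add) (auto simp: emeasure_space_1)
    finally show "shifted_pot L \<nu> z + (\<integral>\<^sup>+w. n z w \<partial>\<nu>) = shifted_pot 0 \<nu> z + ennreal L" .
  qed
  also have "\<dots> = shifted_energy 0 \<nu> + ennreal L"
    unfolding shifted_energy_def using measurable_shifted_pot[OF \<nu> s]
    by (subst nn_integral_add) (auto simp: emeasure_space_1)
  finally have main: "shifted_energy L \<nu> + N = shifted_energy 0 \<nu> + ennreal L" .
  have le: "log_energy \<nu> = enn2ereal (shifted_energy 0 \<nu>) - enn2ereal N"
    unfolding log_energy_def p n N_def shifted_energy_def shifted_pot_def ..
  obtain N' where N': "N = ennreal N'" "0 \<le> N'"
    using NL by (cases N) (auto simp: top_unique)
  show ?thesis
  proof (cases "shifted_energy 0 \<nu>")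
    case top
    then have "shifted_energy L \<nu> = top" using main N' by (metis ennreal_add_eq_top ennreal_neq_top top_add)
    then show ?thesis unfolding le using top N' by simp
  next
    case (real P)
    then have "shifted_energy L \<nu> + N = ennreal (P + L)" using main L(1) by simp
    then obtain E where E: "shifted_energy L \<nu> = ennreal E" "0 \<le> E"
      by (cases "shifted_energy L \<nu>") auto
    have "ennreal (E + N') = ennreal (P + L)" using main E N' real L(1) by simp
    then have "E + N' = P + L" using E N' real L(1) by (subst (asm) ennreal_inj) auto
    then show ?thesis unfolding le using E N' real by simp
  qed
qed

lemma exp_neg_log_energy:
  assumes "prob_on K \<nu>" "0 \<le> L" "\<And>z w. z \<in> K \<Longrightarrow> w \<in> K \<Longrightarrow> dist z w \<le> exp L"
  shows "shifted_energy L \<nu> = ennreal E \<Longrightarrow> 0 \<le> E \<Longrightarrow> exp_neg (log_energy \<nu>) = ennreal (exp (L - E))"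
    and "shifted_energy L \<nu> = top \<Longrightarrow> exp_neg (log_energy \<nu>) = 0"
  using log_energy_eq_shifted_energy[OF assms] by (auto simp: exp_neg_def)

text \<open>First variation of the energy: moving a fraction \<open>x\<close> of the mass away from the set where the
  potential exceeds its mean by \<open>\<eta>\<close> gains \<open>2 x \<eta> s\<close> to first order, where \<open>s\<close> is the mass of that set.\<close>

lemma near_minimal_energy_large_potential:
  assumes \<nu>: "prob_on F \<nu>" and E: "shifted_energy L \<nu> = ennreal J" "0 \<le> J"
    and opt: "\<And>\<sigma>. prob_on F \<sigma> \<Longrightarrow> ennreal J \<le> shifted_energy L \<sigma> + ennreal \<delta>"
    and pos: "0 \<le> \<delta>" "0 \<le> \<eta>" and x: "0 < x" "x \<le> 1/2"
  shows "2 * x * \<eta> * measure \<nu> {z. ennreal (J + \<eta>) < shifted_pot L \<nu> z} \<le> \<delta> + x\<^sup>2 * J"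
proof -
  interpret prob_space \<nu> using \<nu> by (simp add: prob_on_def)
  have s: "sets \<nu> = sets borel" and AE: "AE w in \<nu>. w \<in> F" using \<nu> by (auto simp: prob_on_def)
  have sp: "space \<nu> = UNIV" using sets_eq_imp_space_eq[OF s] by simp
  note [measurable_cong] = s
  have [measurable]: "shifted_pot L \<nu> \<in> borel_measurable borel" by (rule measurable_shifted_pot[OF \<nu>]) simp
  have [measurable]: "shifted_kernel L z \<in> borel_measurable borel" for z by (rule measurable_shifted_kernel) simp
  have kpair: "case_prod (shifted_kernel L) \<in> borel_measurable (\<nu> \<Otimes>\<^sub>M \<nu>)"
    by (rule measurable_shifted_kernel_pair[OF s s])
  define B where "B = {z. ennreal (J + \<eta>) < shifted_pot L \<nu> z}"
  have B[measurable]: "B \<in> sets borel" unfolding B_def by measurable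
  \<comment> \<open>The competitor has density \<open>1 - x\<close> on \<open>B\<close> and 1
    elsewhere, divided by its total mass \<open>m\<close>. As \<open>x\<close> is at most 1/2, so is
    \<open>1 - m\<close>.\<close>
  define m where "m = 1 - x * measure \<nu> B"
  have sB: "0 \<le> measure \<nu> B" "measure \<nu> B \<le> 1" by auto
  have xs: "0 \<le> x * measure \<nu> B" "x * measure \<nu> B \<le> 1/2"
    using x sB mult_mono[of x "1/2" "measure \<nu> B" 1] by auto
  have m: "1/2 \<le> m" "m \<le> 1" using xs by (auto simp: m_def)
  define f where "f z = (1 - x * indicat_real B z) / m" for z
  have f0: "0 \<le> f z" for z using x m by (auto simp: f_def indicator_def)
  have fm[measurable]: "f \<in> borel_measurable borel" unfolding f_def by measurable
  define \<sigma> where "\<sigma> = density \<nu> (\<lambda>z. ennreal (f z))"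
  have s\<sigma>: "sets \<sigma> = sets borel" by (simp add: \<sigma>_def s)
  have intf: "(\<integral>\<^sup>+z. ennreal (f z) \<partial>\<nu>) = 1"
  proof -
    have i: "integrable \<nu> (\<lambda>z. x * indicat_real B z)" using B s by (intro integrable_mult_right) (auto simp: emeasure_eq_measure)
    have "(LINT z|\<nu>. f z) = (LINT z|\<nu>. 1 - x * indicat_real B z) / m" by (simp add: f_def)
    also have "(LINT z|\<nu>. 1 - x * indicat_real B z) = m"
    proof -
      have "measure \<nu> UNIV = 1" using prob_space sp by simp
      then show ?thesis
        using i B s by (subst Bochner_Integration.integral_diff) (auto simp: m_def sp)
    qed
    finally have "(LINT z|\<nu>. f z) = 1" using m by simp
    moreover have "integrable \<nu> f" unfolding f_def using i by (intro integrable_divide Bochner_Integration.integrable_diff) auto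
    ultimately show ?thesis using f0 by (simp add: nn_integral_eq_integral)
  qed
  have \<sigma>: "prob_on F \<sigma>"
    unfolding prob_on_def
  proof (intro conjI)
    show "prob_space \<sigma>"
      by (rule prob_spaceI) (simp add: \<sigma>_def emeasure_density sp s intf)
    show "AE w in \<sigma>. w \<in> F"
      unfolding \<sigma>_def by (subst AE_density) (use AE in \<open>auto elim: eventually_mono\<close>)
  qed (simp add: s\<sigma>)
  have pot\<sigma>: "shifted_pot L \<sigma> z = (\<integral>\<^sup>+w. ennreal (f w) * shifted_kernel L z w \<partial>\<nu>)" for z
    unfolding shifted_pot_def \<sigma>_def by (subst nn_integral_density) auto
  have [measurable]: "shifted_pot L \<sigma> \<in> borel_measurable borel" by (rule measurable_shifted_pot[OF \<sigma>]) simp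
  have E\<sigma>: "shifted_energy L \<sigma> = (\<integral>\<^sup>+z. ennreal (f z) * shifted_pot L \<sigma> z \<partial>\<nu>)"
    unfolding shifted_energy_def by (subst (1) \<sigma>_def, subst nn_integral_density) auto
  define IB where "IB = (\<integral>\<^sup>+z. indicator B z * shifted_pot L \<nu> z \<partial>\<nu>)"
  have sym: "(\<integral>\<^sup>+z. (\<integral>\<^sup>+w. indicator B w * shifted_kernel L z w \<partial>\<nu>) \<partial>\<nu>) = IB"
  proof -
    interpret pair_sigma_finite \<nu> \<nu> ..
    have "(\<lambda>(z, w). indicator B w * shifted_kernel L z w) \<in> borel_measurable (\<nu> \<Otimes>\<^sub>M \<nu>)"
      using kpair by (simp add: case_prod_beta) 
    from Fubini'[OF this] have "(\<integral>\<^sup>+z. (\<integral>\<^sup>+w. indicator B w * shifted_kernel L z w \<partial>\<nu>) \<partial>\<nu>)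
       = (\<integral>\<^sup>+w. (\<integral>\<^sup>+z. indicator B w * shifted_kernel L z w \<partial>\<nu>) \<partial>\<nu>)" by simp
    also have "\<dots> = (\<integral>\<^sup>+w. (\<integral>\<^sup>+z. indicator B w * shifted_kernel L w z \<partial>\<nu>) \<partial>\<nu>)"
    proof (intro nn_integral_cong)
      fix w z
      have "shifted_kernel L z w = shifted_kernel L w z"
        by (auto simp: shifted_kernel_def dist_commute)
      then show "indicator B w * shifted_kernel L z w = indicator B w * shifted_kernel L w z" by simp
    qed
    also have "\<dots> = IB"
      unfolding IB_def shifted_pot_def by (intro nn_integral_cong nn_integral_cmult) simp
    finally show ?thesis .
  qed
  \<comment> \<open>The factor \<open>m\<^sup>2\<close> clears the denominators in the product of
    the two densities. The terms linear in \<open>x\<close> are put on the left to avoid the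
    truncated subtraction of \<open>ennreal\<close>, and the quadratic term is at most
    \<open>x\<^sup>2\<close>.\<close>
  have pw: "ennreal (m\<^sup>2) * (ennreal (f z) * (ennreal (f w) * k)) + (ennreal x * (indicator B z * k) + ennreal x * (indicator B w * k))
     \<le> ennreal (1 + x\<^sup>2) * k" for z w k
  proof -
    have eq: "m\<^sup>2 * (f z * f w) + (x * indicat_real B z + x * indicat_real B w) = 1 + x\<^sup>2 * (indicat_real B z * indicat_real B w)"
      using m by (simp add: f_def power2_eq_square field_simps)
    have "ennreal (m\<^sup>2) * (ennreal (f z) * (ennreal (f w) * k)) + (ennreal x * (indicator B z * k) + ennreal x * (indicator B w * k))
      = ennreal (m\<^sup>2 * (f z * f w) + (x * indicat_real B z + x * indicat_real B w)) * k"
      using f0 x by (simp add: ennreal_plus ennreal_mult distrib_right ennreal_indicator mult.assoc del: ennreal_plus[symmetric])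
    also have "\<dots> \<le> ennreal (1 + x\<^sup>2) * k"
      unfolding eq using x by (intro mult_right_mono ennreal_leI) (auto simp: indicator_def)
    finally show ?thesis .
  qed
  have ineq: "ennreal (m\<^sup>2) * shifted_energy L \<sigma> + (ennreal x * IB + ennreal x * IB) \<le> ennreal ((1 + x\<^sup>2) * J)"
  proof -
    have "ennreal (m\<^sup>2) * shifted_energy L \<sigma> + (ennreal x * IB + ennreal x * IB)
       = (\<integral>\<^sup>+z. ennreal (m\<^sup>2) * (ennreal (f z) * shifted_pot L \<sigma> z)
          + (ennreal x * (indicator B z * shifted_pot L \<nu> z)
          + ennreal x * (\<integral>\<^sup>+w. indicator B w * shifted_kernel L z w \<partial>\<nu>)) \<partial>\<nu>)"
    proof -
      have m3: "(\<lambda>z. \<integral>\<^sup>+w. indicator B w * shifted_kernel L z w \<partial>\<nu>) \<in> borel_measurable \<nu>"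
        using kpair by (intro borel_measurable_nn_integral) (simp add: case_prod_beta)
      have "(\<integral>\<^sup>+z. ennreal x * (\<integral>\<^sup>+w. indicator B w * shifted_kernel L z w \<partial>\<nu>) \<partial>\<nu>) = ennreal x * IB"
        using nn_integral_cmult[OF m3] sym by simp
      moreover have "(\<integral>\<^sup>+z. ennreal x * (indicator B z * shifted_pot L \<nu> z) \<partial>\<nu>) = ennreal x * IB"
        unfolding IB_def by (rule nn_integral_cmult) simp
      moreover have "(\<integral>\<^sup>+z. ennreal (m\<^sup>2) * (ennreal (f z) * shifted_pot L \<sigma> z) \<partial>\<nu>) = ennreal (m\<^sup>2) * shifted_energy L \<sigma>"
        unfolding E\<sigma> by (rule nn_integral_cmult) simp
      ultimately show ?thesis using m3 by (simp add: nn_integral_add)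
    qed
    also have "\<dots> \<le> (\<integral>\<^sup>+z. ennreal (1 + x\<^sup>2) * shifted_pot L \<nu> z \<partial>\<nu>)"
    proof (rule nn_integral_mono)
      fix z
      have "ennreal (m\<^sup>2) * (ennreal (f z) * shifted_pot L \<sigma> z)
          + (ennreal x * (indicator B z * shifted_pot L \<nu> z)
          + ennreal x * (\<integral>\<^sup>+w. indicator B w * shifted_kernel L z w \<partial>\<nu>))
        = (\<integral>\<^sup>+w. ennreal (m\<^sup>2) * (ennreal (f z) * (ennreal (f w) * shifted_kernel L z w))
          + (ennreal x * (indicator B z * shifted_kernel L z w) + ennreal x * (indicator B w * shifted_kernel L z w)) \<partial>\<nu>)"
        unfolding pot\<sigma> unfolding shifted_pot_def by (simp add: nn_integral_add nn_integral_cmult)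
      also have "\<dots> \<le> (\<integral>\<^sup>+w. ennreal (1 + x\<^sup>2) * shifted_kernel L z w \<partial>\<nu>)" by (intro nn_integral_mono pw)
      also have "\<dots> = ennreal (1 + x\<^sup>2) * shifted_pot L \<nu> z"
        unfolding shifted_pot_def by (rule nn_integral_cmult) simp
      finally show "ennreal (m\<^sup>2) * (ennreal (f z) * shifted_pot L \<sigma> z)
          + (ennreal x * (indicator B z * shifted_pot L \<nu> z)
          + ennreal x * (\<integral>\<^sup>+w. indicator B w * shifted_kernel L z w \<partial>\<nu>)) \<le> ennreal (1 + x\<^sup>2) * shifted_pot L \<nu> z" .
    qed
    also have "\<dots> = ennreal (1 + x\<^sup>2) * shifted_energy L \<nu>"
      unfolding shifted_energy_def by (rule nn_integral_cmult) simp
    also have "\<dots> = ennreal ((1 + x\<^sup>2) * J)" using E by (simp add: ennreal_mult')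
    finally show ?thesis .
  qed
  have IBlow: "ennreal ((J + \<eta>) * measure \<nu> B) \<le> IB"
  proof -
    have "ennreal ((J + \<eta>) * measure \<nu> B) = ennreal (J + \<eta>) * emeasure \<nu> B"
      using E(2) pos by (simp add: emeasure_eq_measure ennreal_mult')
    also have "\<dots> = (\<integral>\<^sup>+z. ennreal (J + \<eta>) * indicator B z \<partial>\<nu>)"
      by (subst nn_integral_cmult_indicator) auto
    also have "\<dots> \<le> IB"
      unfolding IB_def by (intro nn_integral_mono) (auto simp: indicator_def B_def less_imp_le)
    finally show ?thesis .
  qed
  have m2: "0 < m\<^sup>2" using m by simp
  obtain e where e: "shifted_energy L \<sigma> = ennreal e" "0 \<le> e"
  proof (cases "shifted_energy L \<sigma>")
    case top
    then have "ennreal (m\<^sup>2) * shifted_energy L \<sigma> = top" using m2 by (simp add: ennreal_mult_top)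
    then show ?thesis using ineq by (simp add: top_unique)
  qed (use that in auto)
  have 1: "m\<^sup>2 * e + 2 * x * ((J + \<eta>) * measure \<nu> B) \<le> (1 + x\<^sup>2) * J"
  proof -
    have nn: "0 \<le> (J + \<eta>) * measure \<nu> B" using E(2) pos by simp
    have "ennreal (m\<^sup>2 * e + (x * ((J + \<eta>) * measure \<nu> B) + x * ((J + \<eta>) * measure \<nu> B)))
       = ennreal (m\<^sup>2) * ennreal e + (ennreal x * ennreal ((J + \<eta>) * measure \<nu> B) + ennreal x * ennreal ((J + \<eta>) * measure \<nu> B))"
      using e x nn m2 by (simp add: ennreal_mult'[symmetric] ennreal_plus[symmetric] del: ennreal_plus)
    also have "\<dots> \<le> ennreal (m\<^sup>2) * ennreal e + (ennreal x * IB + ennreal x * IB)"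
      using IBlow by (intro add_mono mult_left_mono) auto
    also have "\<dots> \<le> ennreal ((1 + x\<^sup>2) * J)" using ineq e by simp
    finally have "m\<^sup>2 * e + (x * ((J + \<eta>) * measure \<nu> B) + x * ((J + \<eta>) * measure \<nu> B)) \<le> (1 + x\<^sup>2) * J"
      using E(2) by (subst (asm) ennreal_le_iff) auto
    then show ?thesis by (simp add: mult.assoc)
  qed
  have 2: "J \<le> e + \<delta>"
    using opt[OF \<sigma>] e pos by (simp add: ennreal_plus[symmetric] del: ennreal_plus)
  have 3: "m\<^sup>2 \<le> 1" using m by (simp add: power_le_one)
  \<comment> \<open>With \<open>m = 1 - t\<close> the terms \<open>2 * t * J\<close> on both sides
    cancel, and \<open>2 * x * \<eta> * measure \<nu> B\<close> is left against
    \<open>\<delta> + x\<^sup>2 * J\<close>.\<close>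
  define t where "t = x * measure \<nu> B"
  have "m\<^sup>2 * J \<le> m\<^sup>2 * e + \<delta>"
  proof -
    have "m\<^sup>2 * J \<le> m\<^sup>2 * (e + \<delta>)" using 2 by (intro mult_left_mono) auto
    also have "\<dots> \<le> m\<^sup>2 * e + \<delta>" using mult_right_mono[OF 3 pos(1)] by (simp add: distrib_left)
    finally show ?thesis .
  qed
  moreover have "m\<^sup>2 * J = J - 2 * t * J + t\<^sup>2 * J"
    by (simp add: m_def t_def power2_eq_square algebra_simps)
  moreover have "2 * x * ((J + \<eta>) * measure \<nu> B) = 2 * t * J + 2 * x * \<eta> * measure \<nu> B"
    by (simp add: t_def algebra_simps)
  moreover have "(1 + x\<^sup>2) * J = J + x\<^sup>2 * J" by (simp add: algebra_simps)
  moreover have "0 \<le> t\<^sup>2 * J" using E(2) by simp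
  ultimately show ?thesis using 1 unfolding B_def by linarith
qed

text \<open>The potential of a near-minimiser exceeds its mean \<open>J\<close> by more than
  \<open>\<epsilon> / 2\<close> only on a set of small mass. Discarding that set and renormalising
  on a compact rest costs the other half of \<epsilon>. The tolerance \<delta> depends on
  \<open>C\<close> and \<epsilon> alone, so it serves all sets \<open>F\<close> at once.\<close>

lemma near_minimal_energy_restrict:
  assumes C: "0 \<le> C" and \<epsilon>: "0 < \<epsilon>"
  obtains \<delta> where "0 < \<delta>"
    "\<And>F \<nu> J L. \<lbrakk>compact F; prob_on F \<nu>; shifted_energy L \<nu> = ennreal J; 0 \<le> J; J \<le> C;
       \<And>\<sigma>. prob_on F \<sigma> \<Longrightarrow> ennreal J \<le> shifted_energy L \<sigma> + ennreal \<delta>\<rbrakk> \<Longrightarrow>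
       \<exists>A \<nu>'. compact A \<and> A \<subseteq> F \<and> prob_on A \<nu>' \<and> (\<forall>z\<in>A. shifted_pot L \<nu>' z \<le> ennreal (J + \<epsilon>))"
proof -
  \<comment> \<open>\<open>b\<close> bounds the discarded mass:
    \<open>(J + \<epsilon> / 2) / (1 - 2 * b)\<close> is at most \<open>J + \<epsilon>\<close> for
    all \<open>J\<close> up to \<open>C\<close>. \<open>x\<close> is the variation step for which
    the first-order estimate bounds \<epsilon> times the bad mass by \<open>x * (1 + C)\<close>,
    hence by \<open>\<epsilon> * b\<close>; its square is the tolerance.\<close>
  define b where "b = min (1/2) (\<epsilon> / (4 * (C + \<epsilon>)))"
  have b: "0 < b" "b \<le> 1/2" "b \<le> \<epsilon> / (4 * (C + \<epsilon>))" using C \<epsilon> by (auto simp: b_def)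
  define x where "x = min (1/2) (\<epsilon> * b / (1 + C))"
  have x: "0 < x" "x \<le> 1/2" "x \<le> \<epsilon> * b / (1 + C)" using C \<epsilon> b unfolding x_def by (simp, linarith, linarith)
  have xC: "x * (1 + C) \<le> \<epsilon> * b" using x(3) C by (simp add: field_simps)
  show ?thesis
  proof (rule that[of "x\<^sup>2"])
    show "0 < x\<^sup>2" using x by simp
    fix F \<nu> J L
    assume F: "compact F" and \<nu>: "prob_on F \<nu>" and E: "shifted_energy L \<nu> = ennreal J" "0 \<le> J" "J \<le> C"
      and opt: "\<And>\<sigma>. prob_on F \<sigma> \<Longrightarrow> ennreal J \<le> shifted_energy L \<sigma> + ennreal (x\<^sup>2)"
    interpret prob_space \<nu> using \<nu> by (simp add: prob_on_def)
    have s: "sets \<nu> = sets borel" and AE: "AE w in \<nu>. w \<in> F" using \<nu> by (auto simp: prob_on_def)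
    have sp: "space \<nu> = UNIV" using sets_eq_imp_space_eq[OF s] by simp
    note [measurable_cong] = s
    have [measurable]: "shifted_pot L \<nu> \<in> borel_measurable borel" by (rule measurable_shifted_pot[OF \<nu>]) simp
    have [measurable]: "shifted_kernel L z \<in> borel_measurable borel" for z by (rule measurable_shifted_kernel) simp
    define B where "B = {z. ennreal (J + \<epsilon> / 2) < shifted_pot L \<nu> z}"
    have Bm: "B \<in> sets borel" unfolding B_def by measurable
    have "2 * x * (\<epsilon> / 2) * measure \<nu> B \<le> x\<^sup>2 + x\<^sup>2 * J"
      unfolding B_def using near_minimal_energy_large_potential[OF \<nu> E(1,2) opt, of "\<epsilon> / 2" x] x \<epsilon> by simp
    then have "x * (\<epsilon> * measure \<nu> B) \<le> x * (x * (1 + J))" by (simp add: power2_eq_square algebra_simps)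
    then have "\<epsilon> * measure \<nu> B \<le> x * (1 + J)" using x by simp
    also have "\<dots> \<le> x * (1 + C)" using E x by simp
    also have "\<dots> \<le> \<epsilon> * b" by (rule xC)
    finally have sB: "measure \<nu> B \<le> b" using \<epsilon> by simp
    define D where "D = F - B"
    have Dm: "D \<in> sets borel" using F Bm by (auto simp: D_def borel_compact)
    have mD: "measure \<nu> D \<ge> 1 - b"
    proof -
      have "measure \<nu> D = measure \<nu> (UNIV - B)"
        by (rule finite_measure_eq_AE) (use AE Dm Bm s in \<open>auto simp: D_def elim!: eventually_mono\<close>)
      also have "\<dots> = 1 - measure \<nu> B" using prob_compl[of B] Bm s sp by simp
      finally show ?thesis using sB by simp
    qed
    \<comment> \<open>\<open>D\<close> is only a Borel set, whereas the maximum principle for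
      potentials works on a compact carrier; inner regularity provides one at the price of another
      \<open>b\<close>.\<close>
    obtain A where A: "compact A" "A \<subseteq> D" "1 - 2 * b < measure \<nu> A"
    proof -
      have "emeasure \<nu> D = (SUP K\<in>{K. K \<subseteq> D \<and> compact K}. emeasure \<nu> K)"
        using Dm by (intro inner_regular s) (auto simp: emeasure_space_1)
      moreover have "ennreal (1 - 2 * b) < emeasure \<nu> D"
        using mD b by (simp add: emeasure_eq_measure ennreal_less_iff)
      ultimately obtain A where "A \<subseteq> D" "compact A" "ennreal (1 - 2 * b) < emeasure \<nu> A"
        by (auto simp: less_SUP_iff)
      then show ?thesis using that b by (auto simp: emeasure_eq_measure ennreal_less_iff)
    qed
    define a where "a = measure \<nu> A"
    have a: "0 < a" "1 - 2 * b < a" using A b by (auto simp: a_def)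
    have Am[measurable]: "A \<in> sets borel" using A(1) by (simp add: borel_compact)
    define \<nu>' where "\<nu>' = density \<nu> (\<lambda>z. ennreal (1 / a) * indicator A z)"
    have "(\<integral>\<^sup>+z. ennreal (1 / a) * indicator A z \<partial>\<nu>) = 1"
    proof -
      have "(\<integral>\<^sup>+z. ennreal (1 / a) * indicator A z \<partial>\<nu>) = ennreal (1 / a) * ennreal a"
        using Am by (subst nn_integral_cmult_indicator) (auto simp: a_def emeasure_eq_measure)
      also have "\<dots> = ennreal (1 / a * a)" using a by (intro ennreal_mult'[symmetric]) auto
      finally show ?thesis using a by simp
    qed
    then have "prob_space \<nu>'"
      by (intro prob_spaceI) (simp add: \<nu>'_def emeasure_density sp s)
    moreover have "AE w in \<nu>'. w \<in> A"
      unfolding \<nu>'_def by (subst AE_density) (auto simp: indicator_def)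
    moreover have "sets \<nu>' = sets borel" by (simp add: \<nu>'_def s)
    ultimately have p': "prob_on A \<nu>'" by (simp add: prob_on_def)
    have pot: "shifted_pot L \<nu>' z \<le> ennreal (J + \<epsilon>)" if z: "z \<in> A" for z
    proof -
      have "shifted_pot L \<nu>' z = (\<integral>\<^sup>+w. (ennreal (1 / a) * indicator A w) * shifted_kernel L z w \<partial>\<nu>)"
        unfolding shifted_pot_def \<nu>'_def by (subst nn_integral_density) auto
      also have "\<dots> \<le> (\<integral>\<^sup>+w. ennreal (1 / a) * shifted_kernel L z w \<partial>\<nu>)"
        by (intro nn_integral_mono) (auto simp: indicator_def)
      also have "\<dots> = ennreal (1 / a) * shifted_pot L \<nu> z"
        unfolding shifted_pot_def by (rule nn_integral_cmult) simp
      also have "\<dots> \<le> ennreal (1 / a) * ennreal (J + \<epsilon> / 2)"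
        using z A(2) by (intro mult_left_mono) (auto simp: D_def B_def not_less)
      also have "\<dots> = ennreal ((J + \<epsilon> / 2) / a)" using a E \<epsilon> by (subst ennreal_mult'[symmetric]) auto
      also have "\<dots> \<le> ennreal (J + \<epsilon>)"
      proof (rule ennreal_leI)
        have "(J + \<epsilon>) * (2 * b) \<le> (C + \<epsilon>) * (2 * b)" using E b by (intro mult_right_mono) auto
        also have "\<dots> \<le> \<epsilon> / 2" using b(3) C \<epsilon> by (simp add: field_simps)
        finally have "J + \<epsilon> / 2 \<le> (J + \<epsilon>) * (1 - 2 * b)" by (simp add: algebra_simps)
        also have "\<dots> \<le> (J + \<epsilon>) * a" using a E \<epsilon> by (intro mult_left_mono) auto
        finally show "(J + \<epsilon> / 2) / a \<le> J + \<epsilon>" using a by (simp add: field_simps)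
      qed
      finally show ?thesis .
    qed
    show "\<exists>A \<nu>'. compact A \<and> A \<subseteq> F \<and> prob_on A \<nu>' \<and> (\<forall>z\<in>A. shifted_pot L \<nu>' z \<le> ennreal (J + \<epsilon>))"
      using A p' pot by (intro exI[of _ A] exI[of _ \<nu>']) (auto simp: D_def)
  qed
qed

section \<open>Measures on subsets of nearly full capacity and their comparison with
  \<open>G\<close>\<close>

context green_function
begin

text \<open>A capacity is a supremum, so a set of nearly full capacity carries a measure whose
  energy is within \<delta> of that of every measure on \<open>K\<close>. One of the latter is the
  Leja limit, with energy at most \<open>L + robin\<close>; it also shows that \<open>K\<close> has
  positive capacity, so that the factor \<open>exp (- \<delta>)\<close> leaves room below
  it.\<close>

lemma near_optimal_subsets:
  assumes L: "0 \<le> L" "\<And>z w. z \<in> K \<Longrightarrow> w \<in> K \<Longrightarrow> dist z w \<le> exp L"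
    and E: "\<And>r. E r \<subseteq> K" "((\<lambda>r. log_cap (E r)) \<longlongrightarrow> log_cap K) F"
    and \<delta>: "0 < \<delta>"
  shows "\<forall>\<^sub>F r in F. \<exists>A \<nu> J. compact A \<and> A \<subseteq> E r \<and> prob_on A \<nu> \<and> shifted_energy L \<nu> = ennreal J \<and>
           0 \<le> J \<and> J \<le> L + robin + \<delta> \<and> (\<forall>\<sigma>. prob_on K \<sigma> \<longrightarrow> ennreal J \<le> shifted_energy L \<sigma> + ennreal \<delta>)"
proof -
  have ub: "exp_neg (log_energy \<sigma>) \<le> log_cap K" if "prob_on K \<sigma>" for \<sigma>
    unfolding log_cap_def by (rule SUP_upper) (rule prob_on_in_prob_measures[OF that compact_K subset_refl])
  have bound: "exp_neg (log_energy \<sigma>) \<le> ennreal (exp L)" if "prob_on K \<sigma>" for \<sigma>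
  proof (cases "shifted_energy L \<sigma>")
    case (real E)
    then show ?thesis using exp_neg_log_energy(1)[OF that L real(2,1)] by (simp add: ennreal_leI)
  qed (use exp_neg_log_energy(2)[OF that L] in simp)
  have "log_cap K \<le> ennreal (exp L)"
    unfolding log_cap_def
  proof (rule SUP_least)
    fix \<nu> assume "\<nu> \<in> {\<nu> \<in> prob_measures K. compact (measure_supp \<nu>)}"
    then have "prob_on K \<nu>" using prob_on_measure_supp prob_on_mono by blast
    then show "exp_neg (log_energy \<nu>) \<le> ennreal (exp L)" by (rule bound)
  qed
  then obtain c where c: "log_cap K = ennreal c" "0 \<le> c"
    by (cases "log_cap K") (auto simp: top_unique)
  obtain \<tau> where \<tau>: "prob_on K \<tau>" "shifted_energy L \<tau> \<le> ennreal (L + robin)"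
    using exists_energy_le_robin[OF L(2)] by blast
  then obtain T where T: "shifted_energy L \<tau> = ennreal T" "0 \<le> T"
    by (cases "shifted_energy L \<tau>") (auto simp: top_unique)
  have "ennreal (exp (L - T)) \<le> ennreal c"
    using ub[OF \<tau>(1)] exp_neg_log_energy(1)[OF \<tau>(1) L T] c(1) by simp
  then have cT: "exp (L - T) \<le> c" using c(2) by simp
  have c0: "0 < c" using cT exp_gt_zero order.strict_trans2 by blast
  \<comment> \<open>If \<open>L + robin\<close> were negative, \<open>ennreal\<close> would replace
    it by 0 and the bound on the energy of \<tau> would say too little; the first two Leja points
    exclude this.\<close>
  have TR: "T \<le> L + robin"
  proof (cases "0 \<le> L + robin")
    case True
    then show ?thesis using \<tau>(2) T by simp
  next
    case False
    obtain x where x: "\<And>n. x n \<in> K" "\<And>n. exp (- real n * robin) \<le> (\<Prod>j<n. dist (x n) (x j))"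
      using Leja_points by blast
    have "exp (- robin) \<le> dist (x 1) (x 0)" using x(2)[of 1] by simp
    also have "\<dots> \<le> exp L" by (rule L(2)[OF x(1) x(1)])
    finally show ?thesis using False by simp
  qed
  have "ennreal (c * exp (- \<delta>)) < log_cap K"
    unfolding c(1) using c0 \<delta> by (subst ennreal_less_iff) auto
  from order_tendstoD(1)[OF E(2) this] have "\<forall>\<^sub>F r in F. ennreal (c * exp (- \<delta>)) < log_cap (E r)" .
  then show ?thesis
  proof eventually_elim
    case (elim r)
    obtain \<nu> where \<nu>: "\<nu> \<in> prob_measures (E r)" "compact (measure_supp \<nu>)"
      "ennreal (c * exp (- \<delta>)) < exp_neg (log_energy \<nu>)"
      using elim unfolding log_cap_def less_SUP_iff by blast
    define A where "A = measure_supp \<nu>"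
    have A: "compact A" "A \<subseteq> E r" "prob_on A \<nu>"
      using \<nu> prob_on_measure_supp[OF \<nu>(1)] by (auto simp: A_def)
    have \<nu>K: "prob_on K \<nu>" using prob_on_mono[OF A(3)] A(2) E(1) by blast
    have "shifted_energy L \<nu> \<noteq> top"
      using \<nu>(3) exp_neg_log_energy(2)[OF \<nu>K L] by auto
    then obtain J where J: "shifted_energy L \<nu> = ennreal J" "0 \<le> J"
      by (cases "shifted_energy L \<nu>") auto
    have "ennreal (c * exp (- \<delta>)) < ennreal (exp (L - J))"
      using \<nu>(3) exp_neg_log_energy(1)[OF \<nu>K L J] by simp
    then have cJ: "c * exp (- \<delta>) < exp (L - J)" using c0 by (subst (asm) ennreal_less_iff) auto
    have key: "J \<le> S + \<delta>" if "exp (L - S) \<le> c" for S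
    proof -
      have "exp (L - S - \<delta>) = exp (L - S) * exp (- \<delta>)" by (simp add: exp_add[symmetric])
      also have "\<dots> \<le> c * exp (- \<delta>)" using that by (intro mult_right_mono) auto
      also have "\<dots> < exp (L - J)" by (rule cJ)
      finally show ?thesis by simp
    qed
    have opt: "ennreal J \<le> shifted_energy L \<sigma> + ennreal \<delta>" if \<sigma>: "prob_on K \<sigma>" for \<sigma>
    proof (cases "shifted_energy L \<sigma>")
      case (real S)
      have "ennreal (exp (L - S)) \<le> ennreal c"
        using ub[OF \<sigma>] exp_neg_log_energy(1)[OF \<sigma> L real(2,1)] c(1) by simp
      then have "J \<le> S + \<delta>" using c(2) by (intro key) simp
      then show ?thesis using real \<delta> by (simp add: ennreal_plus[symmetric] ennreal_leI del: ennreal_plus)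
    qed simp
    have "J \<le> L + robin + \<delta>" using key[OF cT] TR by simp
    then show ?case using A J opt by blast
  qed
qed

text \<open>Near-optimality against all measures on \<open>K\<close> includes those on the same
  carrier, so the variation argument applies there, and the maximum principle extends the resulting
  bound from the carrier to the plane. Half of \<epsilon> is spent on the energy and half on the
  potential.\<close>

lemma small_potential_measures:
  assumes E: "\<And>r. E r \<subseteq> K" "((\<lambda>r. log_cap (E r)) \<longlongrightarrow> log_cap K) F"
    and \<epsilon>: "0 < \<epsilon>"
  shows "\<forall>\<^sub>F r in F. \<exists>A \<nu>. compact A \<and> A \<subseteq> E r \<and> prob_on A \<nu> \<and> (\<forall>z. z \<notin> A \<longrightarrow> log_pot \<nu> z \<le> robin + \<epsilon>)"
proof -
  obtain b where b: "\<And>z. z \<in> K \<Longrightarrow> norm z \<le> b" using compact_imp_bounded[OF compact_K] unfolding bounded_iff by blast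
  \<comment> \<open>\<open>exp L\<close> exceeds every distance within \<open>K\<close> by at least
    1, the margin used near the carrier, and the maximum with 1 ensures
    \<open>0 \<le> L\<close>.\<close>
  define L where "L = ln (max 1 (2 * b + 1))"
  have L0: "0 \<le> L" by (simp add: L_def)
  have eL: "exp L = max 1 (2 * b + 1)" unfolding L_def by (rule exp_ln) auto
  have L1: "dist z w + 1 \<le> exp L" if "z \<in> K" "w \<in> K" for z w
  proof -
    have "dist z w \<le> norm z + norm w" by (simp add: dist_norm norm_triangle_ineq4)
    then show ?thesis using b[OF that(1)] b[OF that(2)] eL by linarith
  qed
  then have L: "dist z w \<le> exp L" if "z \<in> K" "w \<in> K" for z w using that by fastforce
  define C where "C = max 0 (L + robin + \<epsilon>)"
  have C: "0 \<le> C" "0 < \<epsilon> / 2" using \<epsilon> by (auto simp: C_def)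
  obtain \<delta>0 where \<delta>0: "0 < \<delta>0"
    "\<And>F \<nu> J L. \<lbrakk>compact F; prob_on F \<nu>; shifted_energy L \<nu> = ennreal J; 0 \<le> J; J \<le> C;
       \<And>\<sigma>. prob_on F \<sigma> \<Longrightarrow> ennreal J \<le> shifted_energy L \<sigma> + ennreal \<delta>0\<rbrakk> \<Longrightarrow>
       \<exists>A \<nu>'. compact A \<and> A \<subseteq> F \<and> prob_on A \<nu>' \<and> (\<forall>z\<in>A. shifted_pot L \<nu>' z \<le> ennreal (J + \<epsilon> / 2))"
    using near_minimal_energy_restrict[OF C] by blast
  define \<delta> where "\<delta> = min \<delta>0 (\<epsilon> / 2)"
  have \<delta>: "0 < \<delta>" "\<delta> \<le> \<delta>0" "\<delta> \<le> \<epsilon> / 2" using \<delta>0(1) \<epsilon> by (auto simp: \<delta>_def)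
  have "\<forall>\<^sub>F r in F. \<exists>A \<nu> J. compact A \<and> A \<subseteq> E r \<and> prob_on A \<nu> \<and> shifted_energy L \<nu> = ennreal J \<and>
           0 \<le> J \<and> J \<le> L + robin + \<delta> \<and> (\<forall>\<sigma>. prob_on K \<sigma> \<longrightarrow> ennreal J \<le> shifted_energy L \<sigma> + ennreal \<delta>)"
    by (rule near_optimal_subsets[OF L0 _ E \<delta>(1)]) (rule L)
  then show ?thesis
  proof eventually_elim
    case (elim r)
    then obtain D \<nu> J where D: "compact D" "D \<subseteq> E r" "prob_on D \<nu>" and J: "shifted_energy L \<nu> = ennreal J"
      "0 \<le> J" "J \<le> L + robin + \<delta>" and opt: "\<And>\<sigma>. prob_on K \<sigma> \<Longrightarrow> ennreal J \<le> shifted_energy L \<sigma> + ennreal \<delta>"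
      by blast
    have opt': "ennreal J \<le> shifted_energy L \<sigma> + ennreal \<delta>0" if \<sigma>: "prob_on D \<sigma>" for \<sigma>
    proof -
      have "prob_on K \<sigma>" using prob_on_mono[OF \<sigma>] D(2) E(1) by blast
      then have "ennreal J \<le> shifted_energy L \<sigma> + ennreal \<delta>" by (rule opt)
      also have "\<dots> \<le> shifted_energy L \<sigma> + ennreal \<delta>0" using \<delta>(2) by (intro add_left_mono ennreal_leI)
      finally show ?thesis .
    qed
    have "J \<le> C" using J(3) \<delta>(3) \<epsilon> by (simp add: C_def)
    from \<delta>0(2)[OF D(1,3) J(1,2) this opt'] obtain A \<nu>' where A: "compact A" "A \<subseteq> D" "prob_on A \<nu>'"
      "\<And>z. z \<in> A \<Longrightarrow> shifted_pot L \<nu>' z \<le> ennreal (J + \<epsilon> / 2)"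
      by blast
    have AK: "A \<subseteq> K" using A(2) D(2) E(1) by blast
    have "log_pot \<nu>' z \<le> J + \<epsilon> / 2 - L" if z: "z \<notin> A" for z
    proof (rule log_pot_maximum_principle[OF A(3,1) _ _ _ z])
      show "dist z w + 1 \<le> exp L" if "z \<in> A" "w \<in> A" for z w using L1 that AK by blast
      show "0 \<le> L + (J + \<epsilon> / 2 - L)" using J(2) \<epsilon> by simp
      show "shifted_pot L \<nu>' z \<le> ennreal (L + (J + \<epsilon> / 2 - L))" if "z \<in> A" for z using A(4)[OF that] by simp
    qed
    moreover have "J + \<epsilon> / 2 - L \<le> robin + \<epsilon>" using J(3) \<delta>(3) by simp
    ultimately have "\<forall>z. z \<notin> A \<longrightarrow> log_pot \<nu>' z \<le> robin + \<epsilon>" by (meson order_trans)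
    then show ?case using A D(2) by blast
  qed
qed

lemma log_pot_asymp:
  assumes "prob_on A \<nu>" "compact A" "0 < e"
  shows "\<forall>\<^sub>F z in at_infinity. \<bar>log_pot \<nu> z + ln (norm z)\<bar> < e"
proof -
  obtain R where R: "R > 0" "A \<subseteq> cball 0 R"
    using compact_imp_bounded[OF assms(2)] by (metis bounded_subset_ballD ball_subset_cball order_trans)
  show ?thesis
    unfolding eventually_at_infinity
  proof (intro exI[of _ "max (2 * R) (4 * R / e)"] allI impI)
    fix z :: complex assume z: "max (2 * R) (4 * R / e) \<le> norm z"
    have nz: "norm z > 0" using z R by linarith
    have "\<bar>log_pot \<nu> z + ln (norm z)\<bar> \<le> 2 * R / norm z"
      using log_pot_at_infinity[OF assms(1,2) R(2,1)] z by simp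
    also have "\<dots> < e"
    proof -
      have "4 * R \<le> norm z * e" using z assms(3) by (simp add: field_simps)
      then have "2 * R < norm z * e" using R(1) by linarith
      then show ?thesis using nz by (simp add: field_simps)
    qed
    finally show "\<bar>log_pot \<nu> z + ln (norm z)\<bar> < e" .
  qed
qed

text \<open>The term \<open>\<delta> * G z\<close> tends to infinity at infinity while the rest
  stays bounded, so a lower bound at the frontier of \<open>S\<close> suffices. The function is in
  fact harmonic, and its minimum principle is the maximum principle for \<open>exp\<close> of its
  negative.\<close>

lemma log_pot_minus_G_superharmonic:
  assumes A: "compact A" "A \<subseteq> K" "prob_on A \<nu>" and S: "open S" "S \<subseteq> - K"
    and fr: "\<And>\<xi> c. \<xi> \<in> frontier S \<Longrightarrow> m > c \<Longrightarrow> \<forall>\<^sub>F z in at \<xi> within S. c < a - log_pot \<nu> z - G z + \<delta> * G z"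
    and \<delta>: "0 < \<delta>" and z: "z \<in> S"
  shows "m \<le> a - log_pot \<nu> z - G z + \<delta> * G z"
proof -
  define h where "h z = a - log_pot \<nu> z - G z + \<delta> * G z" for z
  have re: "real_part_on_discs h S"
  proof -
    have "real_part_on_discs (log_pot \<nu>) S"
      using real_part_on_discs_subset[OF log_pot_real_part_on_discs[OF A(3,1)]] A(2) S(2) by blast
    moreover have "real_part_on_discs G S" using real_part_on_discs_subset[OF G_re S(2)] .
    ultimately show ?thesis
      unfolding h_def
      by (intro real_part_on_discs_add real_part_on_discs_diff real_part_on_discs_cmult real_part_on_discs_const)
  qed
  have "norm (1::complex) * exp (- h z) \<le> exp (- m)"
  proof (rule maximum_principle[OF S(1) _ real_part_on_discs_minus[OF re] _ _ z, where f = "\<lambda>_. 1"])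
    fix \<xi> c assume \<xi>: "\<xi> \<in> frontier S" and c: "exp (- m) < c"
    have c0: "0 < c" using c exp_gt_zero order.strict_trans by blast
    then have "- m < ln c" using c by (metis exp_less_cancel_iff exp_ln)
    then have "\<forall>\<^sub>F z in at \<xi> within S. - ln c < h z" using fr[OF \<xi>, of "- ln c"] by (simp add: h_def)
    then show "\<forall>\<^sub>F z in at \<xi> within S. norm (1::complex) * exp (- h z) < c"
    proof eventually_elim
      case (elim z)
      then have "exp (- h z) < exp (ln c)" by simp
      then show ?case using c0 by simp
    qed
  next
    fix c assume c: "exp (- m) < c"
    have c0: "0 < c" using c exp_gt_zero order.strict_trans by blast
    obtain C where C: "\<forall>\<^sub>F z in at_infinity. \<bar>G z - ln (norm z)\<bar> \<le> C" using G_at_infinity by blast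
    have "\<forall>\<^sub>F z in at_infinity. \<bar>log_pot \<nu> z + ln (norm z)\<bar> < 1" by (rule log_pot_asymp[OF A(3,1)]) simp
    moreover have "\<forall>\<^sub>F z in at_infinity. (- ln c - a + 1 + C) / \<delta> < G z" by (rule eventually_G_gt)
    ultimately show "\<forall>\<^sub>F z in at_infinity. z \<in> S \<longrightarrow> norm (1::complex) * exp (- h z) < c"
      using C
    proof eventually_elim
      case (elim z)
      have "- ln c - a + 1 + C < \<delta> * G z" using elim(2) \<delta> by (simp add: field_simps)
      then have "- h z < ln c" using elim(1,3) by (simp add: h_def abs_le_iff abs_less_iff)
      then have "exp (- h z) < exp (ln c)" by simp
      then show ?case using c0 by simp
    qed
  qed auto
  then show ?thesis by (simp add: h_def)
qed

lemma le_of_perturbation: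
  fixes m x y :: real
  assumes "\<And>\<delta>. 0 < \<delta> \<Longrightarrow> \<delta> \<le> 1 \<Longrightarrow> m \<le> x + \<delta> * y" 
  shows "m \<le> x"
proof (rule tendsto_lowerbound)
  show "((\<lambda>\<delta>. x + \<delta> * y) \<longlongrightarrow> x) (at_right 0)" by (auto intro!: tendsto_eq_intros)
  show "\<forall>\<^sub>F \<delta> in at_right 0. m \<le> x + \<delta> * y"
    unfolding eventually_at_right_field by (intro exI[of _ 1] conjI allI impI assms) simp_all
qed simp

text \<open>With the measure nearly optimal, \<open>h = robin + \<epsilon> - log_pot \<nu> - G\<close> is a non-negative
  harmonic function whose lower limit at infinity is at most \<open>\<epsilon>\<close>; Harnack makes it small on the level set.\<close>

lemma potential_vs_G:
  assumes e1: "0 < e1"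
  obtains \<epsilon> where "0 < \<epsilon>"
    "\<And>A \<nu>. \<lbrakk>compact A; A \<subseteq> K; prob_on A \<nu>; \<And>z. z \<notin> A \<Longrightarrow> log_pot \<nu> z \<le> robin + \<epsilon>\<rbrakk> \<Longrightarrow>
       (\<forall>z. z \<notin> K \<longrightarrow> G z \<le> robin + \<epsilon> - log_pot \<nu> z) \<and>
       (\<forall>z. G z = e1 \<longrightarrow> robin + \<epsilon> - log_pot \<nu> z \<le> 2 * e1)"
proof -
  obtain R where R: "R > 0" "K \<subseteq> cball 0 R"
    using compact_imp_bounded[OF compact_K] by (metis bounded_subset_ballD ball_subset_cball order_trans)
  define R' where "R' = R + 1"
  have R': "0 < R'" using R by (simp add: R'_def)
  have far: "z \<in> outside K" if "R' \<le> norm z" for z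
    using outside_subset_convex[OF convex_cball R(2)] that by (auto simp: R'_def subset_iff)
  \<comment> \<open>The circle is added to the level set because it links it to infinity: a lower
    bound for \<open>h\<close> on the circle persists outside, where \<open>h\<close> is known to
    take small values.\<close>
  define Q where "Q = {z. G z = e1} \<union> sphere 0 R'"
  have Q: "compact Q" unfolding Q_def using compact_G_eq by (intro compact_Un) auto
  have Qout: "Q \<subseteq> outside K"
  proof
    fix z assume "z \<in> Q"
    then show "z \<in> outside K" using far[of z] G_zero[of z] e1 by (cases "z \<in> outside K") (auto simp: Q_def)
  qed
  have bK: "bounded K" using compact_K compact_imp_bounded by blast
  have con: "connected (outside K)" by (rule connected_outside[OF bK]) simp
  have op: "open (outside K)" using compact_K by (simp add: compact_imp_closed open_outside)
  have oK: "outside K \<subseteq> - K" using outside_no_overlap[of K] by blast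
  obtain C where C: "C > 0"
    "\<And>h z w. \<lbrakk>real_part_on_discs h (outside K); \<And>x. x \<in> outside K \<Longrightarrow> 0 \<le> h x; z \<in> Q; w \<in> Q\<rbrakk> \<Longrightarrow> h z \<le> C * h w"
    using Harnack_compact[OF op con Q Qout] by blast
  \<comment> \<open>Near infinity \<open>h\<close> takes a value of at most
    \<open>2 * \<epsilon>\<close>, and Harnack multiplies this by \<open>C\<close>; the product is
    \<open>e1\<close>.\<close>
  define \<epsilon> where "\<epsilon> = e1 / (2 * C)"
  have \<epsilon>: "0 < \<epsilon>" using e1 C by (simp add: \<epsilon>_def)
  show ?thesis
  proof (rule that[OF \<epsilon>])
    fix A \<nu> assume A: "compact A" "A \<subseteq> K" "prob_on A \<nu>" and pot: "\<And>z. z \<notin> A \<Longrightarrow> log_pot \<nu> z \<le> robin + \<epsilon>"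
    define h where "h z = robin + \<epsilon> - log_pot \<nu> z - G z" for z
    \<comment> \<open>Towards \<open>K\<close> the bound on the potential keeps
      \<open>robin + \<epsilon> - log_pot \<nu>\<close> non-negative, and \<open>G\<close> tends to
      0; so the lower limits of \<open>h\<close> at the boundary are at least 0.\<close>
    have h0: "0 \<le> h z" if z: "z \<notin> K" for z
    proof (rule le_of_perturbation[where y = "G z"])
      fix \<delta> :: real assume \<delta>: "0 < \<delta>" "\<delta> \<le> 1"
      show "0 \<le> h z + \<delta> * G z"
        unfolding h_def
      proof (rule log_pot_minus_G_superharmonic[OF A open_compl_K subset_refl _ \<delta>(1)])
        fix \<xi> c assume \<xi>: "\<xi> \<in> frontier (- K)" and c: "c < (0::real)"
        have \<xi>K: "\<xi> \<in> K" using \<xi> frontier_compl_K by blast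
        have "(G \<longlongrightarrow> 0) (at \<xi> within - K)" using G_tendsto[of \<xi> "- K"] G_on_K[OF \<xi>K] by simp
        then have "\<forall>\<^sub>F z in at \<xi> within - K. G z < - c" using c by (intro order_tendstoD(2)) auto
        moreover have "\<forall>\<^sub>F z in at \<xi> within - K. z \<in> - K" by (simp add: eventually_at_filter)
        ultimately show "\<forall>\<^sub>F z in at \<xi> within - K. c < robin + \<epsilon> - log_pot \<nu> z - G z + \<delta> * G z"
        proof eventually_elim
          case (elim z)
          have "log_pot \<nu> z \<le> robin + \<epsilon>" using pot elim(2) A(2) by blast
          moreover have "0 \<le> \<delta> * G z" using \<delta> G_nonneg by simp
          ultimately show ?case using elim(1) by linarith
        qed
      qed (use z in simp)
    qed
    have reh: "real_part_on_discs h (- K)"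
    proof -
      have "real_part_on_discs (log_pot \<nu>) (- K)"
        using real_part_on_discs_subset[OF log_pot_real_part_on_discs[OF A(3,1)]] A(2) by blast
      then show ?thesis unfolding h_def
        by (intro real_part_on_discs_diff real_part_on_discs_const G_re)
    qed
    have hC: "h z \<le> C * h w" if "z \<in> Q" "w \<in> Q" for z w
      using C(2)[OF real_part_on_discs_subset[OF reh oK] _ that] h0 oK by blast
    have small: "h y \<le> e1" if y: "y \<in> Q" for y
    proof -
      \<comment> \<open>By Harnack \<open>m\<close> is a lower bound for \<open>h\<close> on the
        circle, and by the minimum principle on its whole exterior; a single point near infinity
        then bounds \<open>m\<close> from above.\<close>
      define m where "m = h y / C"
      have sph: "m \<le> h \<xi>" if "norm \<xi> = R'" for \<xi>
        using hC[OF y, of \<xi>] that C(1) by (simp add: m_def Q_def field_simps)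
      define S where "S = - cball (0::complex) R'"
      have S: "open S" "S \<subseteq> - K" using R(2) by (auto simp: S_def R'_def)
      have ext: "m \<le> h z" if z: "z \<in> S" for z
      proof (rule le_of_perturbation[where y = "G z"])
        fix \<delta> :: real assume \<delta>: "0 < \<delta>" "\<delta> \<le> 1"
        show "m \<le> h z + \<delta> * G z"
          unfolding h_def
        proof (rule log_pot_minus_G_superharmonic[OF A S _ \<delta>(1) z])
          fix \<xi> c assume \<xi>: "\<xi> \<in> frontier S" and c: "c < m"
          have "\<xi> \<in> sphere 0 R'" using \<xi> R' by (simp add: S_def frontier_complement)
          then have n\<xi>: "norm \<xi> = R'" by simp
          then have \<xi>K: "\<xi> \<in> - K" using far oK by auto
          have "continuous_on (- K) h" by (rule real_part_on_discs_continuous[OF reh open_compl_K])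
          then have "(h \<longlongrightarrow> h \<xi>) (at \<xi>)"
            using \<xi>K open_compl_K by (simp add: continuous_on_eq_continuous_at isContD)
          then have "(h \<longlongrightarrow> h \<xi>) (at \<xi> within S)" by (rule tendsto_within_subset) simp
          moreover have "c < h \<xi>" using sph[OF n\<xi>] c by simp
          ultimately have "\<forall>\<^sub>F z in at \<xi> within S. c < h z" by (rule order_tendstoD(1))
          then show "\<forall>\<^sub>F z in at \<xi> within S. c < robin + \<epsilon> - log_pot \<nu> z - G z + \<delta> * G z"
          proof eventually_elim
            case (elim z)
            have "0 \<le> \<delta> * G z" using \<delta> G_nonneg by simp
            then show ?case using elim by (simp add: h_def)
          qed
        qed
      qed
      have "\<forall>\<^sub>F z in at_infinity. \<bar>log_pot \<nu> z + ln (norm z)\<bar> < \<epsilon> / 2"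
        by (rule log_pot_asymp[OF A(3,1)]) (use \<epsilon> in simp)
      moreover have "\<forall>\<^sub>F z in at_infinity. robin - \<epsilon> / 2 < G z - ln (norm z)"
        by (rule robin_bounds(1)) (use \<epsilon> in simp)
      moreover have "\<forall>\<^sub>F z in at_infinity. z \<in> S"
        unfolding eventually_at_infinity by (intro exI[of _ "R' + 1"]) (auto simp: S_def)
      ultimately have "\<forall>\<^sub>F z in at_infinity. \<bar>log_pot \<nu> z + ln (norm z)\<bar> < \<epsilon> / 2 \<and>
          robin - \<epsilon> / 2 < G z - ln (norm z) \<and> z \<in> S"
        by eventually_elim blast
      then obtain z where z: "\<bar>log_pot \<nu> z + ln (norm z)\<bar> < \<epsilon> / 2" "robin - \<epsilon> / 2 < G z - ln (norm z)" "z \<in> S"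
        using eventually_happens'[OF trivial_limit_at_infinity] by blast
      have "m \<le> h z" by (rule ext[OF z(3)])
      also have "h z \<le> 2 * \<epsilon>" using z(1,2) unfolding h_def by linarith
      finally have "m \<le> 2 * \<epsilon>" .
      then show ?thesis using C(1) by (simp add: m_def \<epsilon>_def field_simps)
    qed
    show "(\<forall>z. z \<notin> K \<longrightarrow> G z \<le> robin + \<epsilon> - log_pot \<nu> z) \<and>
       (\<forall>z. G z = e1 \<longrightarrow> robin + \<epsilon> - log_pot \<nu> z \<le> 2 * e1)"
    proof (intro conjI allI impI)
      fix z assume "z \<notin> K"
      then show "G z \<le> robin + \<epsilon> - log_pot \<nu> z" using h0[of z] by (simp add: h_def)
    next
      fix z assume z: "G z = e1"
      then have "h z \<le> e1" by (intro small) (simp add: Q_def)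
      then show "robin + \<epsilon> - log_pot \<nu> z \<le> 2 * e1" using z by (simp add: h_def)
    qed
  qed
qed

end

section \<open>Rational functions\<close>

text \<open>Each linear factor grows at most by the factor \<open>T\<close> from \<open>z\<close> to
  \<open>y\<close>; one root is split off at a time.\<close>

lemma norm_poly_ratio_le:
  fixes q :: "complex poly"
  assumes "q \<noteq> 0" "1 \<le> T" "\<And>a. poly q a = 0 \<Longrightarrow> norm (y - a) \<le> T * norm (z - a)"
  shows "norm (poly q y) \<le> T ^ degree q * norm (poly q z)"
  using assms
proof (induction "degree q" arbitrary: q)
  case 0
  then obtain c where "q = [:c:]" by (metis degree_eq_zeroE)
  then show ?case by simp
next
  case (Suc n)
  have "\<not> constant (poly q)" using Suc.hyps(2) by (simp add: constant_degree)
  then obtain a where a: "poly q a = 0" using fundamental_theorem_of_algebra by blast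
  then obtain q' where q: "q = [:- a, 1:] * q'" by (auto simp: poly_eq_0_iff_dvd elim: dvdE)
  have nz: "q' \<noteq> 0" using q Suc.prems(1) by auto
  then have deg: "degree q = Suc (degree q')" unfolding q by (subst degree_mult_eq) auto
  have IH: "norm (poly q' y) \<le> T ^ degree q' * norm (poly q' z)"
  proof (rule Suc.hyps(1))
    show "n = degree q'" using Suc.hyps(2) deg by simp
    show "norm (y - b) \<le> T * norm (z - b)" if "poly q' b = 0" for b
      using Suc.prems(3) that q by simp
  qed (use nz Suc.prems in auto)
  have eq: "poly q x = (x - a) * poly q' x" for x by (simp add: q left_diff_distrib)
  have "norm (poly q y) = norm (y - a) * norm (poly q' y)" by (simp add: eq norm_mult)
  also have "\<dots> \<le> (T * norm (z - a)) * (T ^ degree q' * norm (poly q' z))"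
    using IH Suc.prems(3)[OF a] Suc.prems(2) by (intro mult_mono) auto
  also have "\<dots> = T ^ degree q * norm (poly q z)" by (simp add: eq norm_mult deg)
  finally show ?case .
qed

text \<open>Circles of radius \<open>R / 4\<close> about points of the disc of radius
  \<open>R / 2\<close> stay inside the ball, so the Cauchy inequality bounds the derivative there by
  \<open>4 * B / R\<close>.\<close>

lemma norm_diff_le_of_bounded_holomorphic:
  assumes f: "f holomorphic_on ball z R" and B: "\<And>x. x \<in> ball z R \<Longrightarrow> norm (f x) \<le> B"
    and R: "0 < R" and w: "dist z w \<le> R / 2"
  shows "norm (f z - f w) \<le> 4 * B / R * dist z w"
proof -
  have der: "norm (deriv f x) \<le> 4 * B / R" if x: "dist z x \<le> R / 2" for x
  proof -
    have sub: "cball x (R / 4) \<subseteq> ball z R"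
    proof
      fix y assume "y \<in> cball x (R / 4)"
      then show "y \<in> ball z R" using x R dist_triangle[of z y x] by simp
    qed
    have "norm ((deriv ^^ 1) f x) \<le> fact 1 * B / (R / 4) ^ 1"
    proof (rule Cauchy_inequality)
      show "f holomorphic_on ball x (R / 4)" using f sub ball_subset_cball holomorphic_on_subset by blast
      show "continuous_on (cball x (R / 4)) f"
        using holomorphic_on_imp_continuous_on[OF holomorphic_on_subset[OF f sub]] .
      show "0 < R / 4" using R by simp
      show "norm (f y) \<le> B" if "norm (x - y) = R / 4" for y
        using that sub by (intro B) (auto simp: subset_iff dist_norm)
    qed
    then show ?thesis by (simp add: mult.commute)
  qed
  have "norm (f z - f w) \<le> 4 * B / R * norm (z - w)"
  proof (rule field_differentiable_bound[where S = "cball z (R / 2)" and f' = "deriv f"])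
    fix x assume x: "x \<in> cball z (R / 2)"
    then have "x \<in> ball z R" using R by auto
    then show "(f has_field_derivative deriv f x) (at x within cball z (R / 2))"
      using holomorphic_derivI[OF f open_ball] by blast
    show "norm (deriv f x) \<le> 4 * B / R" using der x by simp
  qed (use w R in auto)
  then show ?thesis by (simp add: dist_norm)
qed

section \<open>Growth of rational functions with poles in \<open>P\<close>\<close>

context green_function
begin

definition admissible :: "complex set \<Rightarrow> nat \<Rightarrow> complex poly \<Rightarrow> complex poly \<Rightarrow> bool" where
  "admissible P k p q \<longleftrightarrow> degree p \<le> k \<and> degree q \<le> k \<and> {z. poly q z = 0} \<subseteq> P"

lemma admissible_nonzero:
  assumes "admissible P k p q" "compact P" shows "q \<noteq> 0"
proof
  assume "q = 0"
  then have "P = UNIV" using assms(1) by (auto simp: admissible_def)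
  then show False using assms(2) by simp
qed

text \<open>For fixed \<open>z\<close> the numerator is at most \<open>M * T ^ k * |q z|\<close> on
  \<open>K\<close>, because the denominator changes by at most \<open>T ^ k\<close> between points
  of \<open>{G \<le> e0}\<close>. Bernstein-Walsh carries this constant bound to \<open>z\<close>,
  where \<open>q z\<close> cancels.\<close>

lemma rational_crude_bound:
  assumes P: "compact P" and e0: "0 < e0" "\<And>a. a \<in> P \<Longrightarrow> e0 < G a"
  obtains C where "0 < C"
    "\<And>k p q M z. \<lbrakk>admissible P k p q; \<And>x. x \<in> K \<Longrightarrow> norm (poly p x / poly q x) \<le> M; G z \<le> e0\<rbrakk> \<Longrightarrow>
       norm (poly p z / poly q z) \<le> M * exp (real k * C)"
proof -
  define D where "D = {z. G z \<le> e0}"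
  have D: "compact D" using closed_G_le bounded_G_le by (simp add: D_def compact_eq_bounded_closed)
  have KD: "K \<subseteq> D" using G_on_K e0 by (auto simp: D_def)
  have dis: "D \<inter> P = {}" using e0(2) by (fastforce simp: D_def)
  obtain d where d: "d > 0" "\<And>z a. z \<in> D \<Longrightarrow> a \<in> P \<Longrightarrow> d \<le> dist z a"
    using separate_compact_closed[OF D compact_imp_closed[OF P] dis] by blast
  obtain b where b: "\<And>z. z \<in> D \<Longrightarrow> norm z \<le> b" using compact_imp_bounded[OF D] unfolding bounded_iff by blast
  \<comment> \<open>\<open>2 * |b|\<close> bounds the distances within \<open>D\<close>, and
    \<open>d\<close> bounds those from \<open>D\<close> to \<open>P\<close> from below; the triangle
    inequality then compares the distances of two points of \<open>D\<close> to a pole.\<close>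
  define T where "T = 1 + 2 * \<bar>b\<bar> / d"
  have T: "1 \<le> T" using d by (simp add: T_def)
  have ratio: "norm (y - a) \<le> T * norm (z - a)" if "y \<in> D" "z \<in> D" "a \<in> P" for y z a
  proof -
    have "norm (y - a) \<le> norm (y - z) + norm (z - a)" using norm_triangle_ineq[of "y - z" "z - a"] by simp
    moreover have "norm (y - z) \<le> 2 * \<bar>b\<bar>"
      using b[OF that(1)] b[OF that(2)] norm_triangle_ineq4[of y z] by linarith
    moreover have "2 * \<bar>b\<bar> \<le> 2 * \<bar>b\<bar> / d * norm (z - a)"
      using d(2)[OF that(2,3)] d(1) mult_left_mono[of d "norm (z - a)" "2 * \<bar>b\<bar> / d"] by (simp add: dist_norm)
    ultimately show ?thesis unfolding T_def distrib_right by linarith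
  qed
  define C where "C = ln T + e0"
  have C: "0 < C" using T e0 by (simp add: C_def add_nonneg_pos)
  show ?thesis
  proof (rule that[OF C])
    fix k p q M z
    assume adm: "admissible P k p q" and M: "\<And>x. x \<in> K \<Longrightarrow> norm (poly p x / poly q x) \<le> M" and z: "G z \<le> e0"
    have q0: "q \<noteq> 0" by (rule admissible_nonzero[OF adm P])
    have zD: "z \<in> D" using z by (simp add: D_def)
    have nz: "poly q x \<noteq> 0" if "x \<in> D" for x using adm dis that by (auto simp: admissible_def)
    obtain z0 where z0: "z0 \<in> K" using nonempty_K by blast
    have M0: "0 \<le> M" using M[OF z0] norm_ge_zero order_trans by blast
    have "norm (poly p x) \<le> M * (T ^ k * norm (poly q z))" if x: "x \<in> K" for x
    proof -
      have xD: "x \<in> D" using KD x by blast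
      have "norm (poly p x) = norm (poly p x / poly q x) * norm (poly q x)"
        using nz[OF xD] by (simp add: norm_divide)
      also have "\<dots> \<le> M * norm (poly q x)" by (intro mult_right_mono M x) simp
      also have "norm (poly q x) \<le> T ^ degree q * norm (poly q z)"
        by (rule norm_poly_ratio_le[OF q0 T]) (use adm in \<open>auto simp: admissible_def intro!: ratio[OF xD zD]\<close>)
      also have "T ^ degree q \<le> T ^ k" using T adm by (intro power_increasing) (auto simp: admissible_def)
      finally show ?thesis using M0 by (simp add: mult_left_mono mult_right_mono)
    qed
    then have "norm (poly p z) \<le> M * (T ^ k * norm (poly q z)) * exp (real k * G z)"
      using adm by (intro Bernstein_Walsh) (auto simp: admissible_def)
    also have "\<dots> \<le> M * (T ^ k * norm (poly q z)) * exp (real k * e0)"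
      using z M0 T by (intro mult_left_mono) (auto intro!: mult_left_mono)
    also have "\<dots> = M * exp (real k * C) * norm (poly q z)"
    proof -
      have "exp (ln T) = T" using T by (intro exp_ln) linarith
      then have "T ^ k = exp (real k * ln T)" by (simp add: exp_of_nat_mult)
      then show ?thesis by (simp add: C_def distrib_left exp_add)
    qed
    finally show "norm (poly p z / poly q z) \<le> M * exp (real k * C)"
      using nz[OF zD] by (simp add: norm_divide divide_le_eq)
  qed
qed

lemma rational_continuous:
  assumes adm: "admissible P k p q" and a: "\<And>a. a \<in> P \<Longrightarrow> e0 < G a" and z: "G z \<le> e0"
  shows "((\<lambda>z. norm (poly p z / poly q z)) \<longlongrightarrow> norm (poly p z / poly q z)) (at z within S)"
proof -
  have "poly q z \<noteq> 0" using adm a[of z] z by (force simp: admissible_def)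
  then show ?thesis by (intro tendsto_intros)
qed

lemma rational_holomorphic:
  assumes adm: "admissible P k p q" and a: "\<And>a. a \<in> P \<Longrightarrow> e0 < G a" and S: "\<And>z. z \<in> S \<Longrightarrow> G z \<le> e0"
  shows "(\<lambda>z. poly p z / poly q z) holomorphic_on S"
proof -
  have "poly q z \<noteq> 0" if "z \<in> S" for z using adm a[of z] S[OF that] by (force simp: admissible_def)
  then show ?thesis by (intro holomorphic_intros)
qed

lemma eventually_notin_G_less: "\<forall>\<^sub>F z in at_infinity. z \<notin> {z. G z < e}"
  using eventually_G_gt[of e] by eventually_elim simp

lemma frontier_G_less_diff:
  assumes "closed A" "\<xi> \<in> frontier ({z. G z < e} - A)"
  shows "\<xi> \<in> A \<or> (\<xi> \<notin> A \<and> G \<xi> = e)" "G \<xi> \<le> e"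
proof -
  have op: "open ({z. G z < e} - A)" by (intro open_Diff open_G_less assms(1))
  have cl: "\<xi> \<in> closure ({z. G z < e} - A)" and ni: "\<xi> \<notin> {z. G z < e} - A"
    using assms(2) op by (auto simp: frontier_def interior_open)
  have "closure ({z. G z < e} - A) \<subseteq> {z. G z \<le> e}"
    by (rule closure_minimal) (auto simp: closed_G_le)
  then show "G \<xi> \<le> e" using cl by blast
  then have "\<xi> \<notin> A \<Longrightarrow> G \<xi> = e" using ni by simp
  then show "\<xi> \<in> A \<or> (\<xi> \<notin> A \<and> G \<xi> = e)" by blast
qed

text \<open>The crude bound at level \<open>e0\<close> is interpolated: after multiplication by
  \<open>exp (- \<Lambda> * G)\<close> with \<open>\<Lambda> = k * C / e0\<close>, the maximum
  principle on \<open>{G < e0} - K\<close> gives the bound \<open>M\<close> throughout. Near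
  \<open>K\<close> the values of \<open>G\<close> are so small that the exponential rate drops to
  \<delta>.\<close>

lemma rational_bound_near_K:
  assumes P: "compact P" and e0: "0 < e0" "\<And>a. a \<in> P \<Longrightarrow> e0 < G a" and \<delta>: "0 < \<delta>"
  obtains \<rho> where "0 < \<rho>"
    "\<And>x z. x \<in> K \<Longrightarrow> dist x z < \<rho> \<Longrightarrow> G z < e0"
    "\<And>k p q M x z. \<lbrakk>admissible P k p q; \<And>x. x \<in> K \<Longrightarrow> norm (poly p x / poly q x) \<le> M; x \<in> K; dist x z < \<rho>\<rbrakk> \<Longrightarrow>
       norm (poly p z / poly q z) \<le> M * exp (real k * \<delta>)"
proof -
  obtain C where C: "0 < C"
    "\<And>k p q M z. \<lbrakk>admissible P k p q; \<And>x. x \<in> K \<Longrightarrow> norm (poly p x / poly q x) \<le> M; G z \<le> e0\<rbrakk> \<Longrightarrow>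
       norm (poly p z / poly q z) \<le> M * exp (real k * C)"
    using rational_crude_bound[OF P e0] by blast
  \<comment> \<open>Below the level \<open>t\<close> the exponent \<open>\<Lambda> * G\<close> is at
    most \<open>k * \<delta>\<close>, and by compactness a uniform neighbourhood of \<open>K\<close>
    lies below this level.\<close>
  define t where "t = min e0 (\<delta> * e0 / C)"
  have t: "0 < t" "t \<le> e0" "t \<le> \<delta> * e0 / C" using e0 \<delta> C(1) by (auto simp: t_def)
  have clt: "closed (- {z. G z < t})" using open_G_less by (simp add: closed_def)
  have dis: "K \<inter> - {z. G z < t} = {}" using G_on_K t(1) by auto
  obtain \<rho> where \<rho>: "\<rho> > 0" "\<And>x z. x \<in> K \<Longrightarrow> z \<in> - {z. G z < t} \<Longrightarrow> \<rho> \<le> dist x z"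
    using separate_compact_closed[OF compact_K clt dis] by blast
  have near: "G z < t" if "x \<in> K" "dist x z < \<rho>" for x z using \<rho>(2)[OF that(1), of z] that(2) by force
  show ?thesis
  proof (rule that[OF \<rho>(1)])
    show "G z < e0" if "x \<in> K" "dist x z < \<rho>" for x z using near[OF that] t by simp
    fix k p q M x z
    assume adm: "admissible P k p q" and M: "\<And>x. x \<in> K \<Longrightarrow> norm (poly p x / poly q x) \<le> M"
      and x: "x \<in> K" "dist x z < \<rho>"
    have Gz: "G z < t" by (rule near[OF x])
    have M0: "0 \<le> M" using M[OF x(1)] norm_ge_zero order_trans by blast
    define \<Lambda> where "\<Lambda> = real k * C / e0"
    have \<Lambda>: "0 \<le> \<Lambda>" using C(1) e0 by (simp add: \<Lambda>_def)
    have "norm (poly p z / poly q z) * exp (- \<Lambda> * G z) \<le> M"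
    proof (cases "z \<in> K")
      case True
      then show ?thesis using M G_on_K by simp
    next
      case False
      show ?thesis
      proof (rule maximum_principle[where S = "{z. G z < e0} - K" and f = "\<lambda>z. poly p z / poly q z"
            and h = "\<lambda>z. - \<Lambda> * G z" and z = z])
        show "open ({z. G z < e0} - K)" by (intro open_Diff open_G_less compact_imp_closed compact_K)
        show "(\<lambda>z. poly p z / poly q z) holomorphic_on {z. G z < e0} - K"
          by (rule rational_holomorphic[OF adm e0(2)]) auto
        show "real_part_on_discs (\<lambda>z. - \<Lambda> * G z) ({z. G z < e0} - K)"
          by (intro real_part_on_discs_cmult real_part_on_discs_subset[OF G_re]) auto
        show "z \<in> {z. G z < e0} - K" using False Gz t by auto
      next
        fix \<xi> c assume \<xi>: "\<xi> \<in> frontier ({z. G z < e0} - K)" and c: "M < c"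
        note f = frontier_G_less_diff[OF compact_imp_closed[OF compact_K] \<xi>]
        have le: "norm (poly p \<xi> / poly q \<xi>) * exp (- \<Lambda> * G \<xi>) \<le> M"
          using f(1)
        proof
          assume "\<xi> \<in> K"
          then show ?thesis using M G_on_K by simp
        next
          assume "\<xi> \<notin> K \<and> G \<xi> = e0"
          then have e: "\<Lambda> * G \<xi> = real k * C" using e0 by (simp add: \<Lambda>_def)
          have "norm (poly p \<xi> / poly q \<xi>) * exp (- \<Lambda> * G \<xi>) \<le> M * exp (real k * C) * exp (- \<Lambda> * G \<xi>)"
            using f(2) by (intro mult_right_mono C(2)[OF adm M]) auto
          also have "\<dots> = M" using e by (simp add: mult.assoc exp_add[symmetric])
          finally show ?thesis .
        qed
        have "((\<lambda>z. norm (poly p z / poly q z) * exp (- \<Lambda> * G z)) \<longlongrightarrow>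
          norm (poly p \<xi> / poly q \<xi>) * exp (- \<Lambda> * G \<xi>)) (at \<xi> within {z. G z < e0} - K)"
          by (intro tendsto_mult tendsto_exp tendsto_const G_tendsto rational_continuous[OF adm e0(2) f(2)])
        from order_tendstoD(2)[OF this order.strict_trans1[OF le c]]
        show "\<forall>\<^sub>F z in at \<xi> within {z. G z < e0} - K. norm (poly p z / poly q z) * exp (- \<Lambda> * G z) < c" .
      next
        fix c
        show "\<forall>\<^sub>F z in at_infinity. z \<in> {z. G z < e0} - K \<longrightarrow> norm (poly p z / poly q z) * exp (- \<Lambda> * G z) < c"
          using eventually_notin_G_less[of e0] by eventually_elim simp
      qed
    qed
    then have "norm (poly p z / poly q z) * exp (- \<Lambda> * G z) * exp (\<Lambda> * G z) \<le> M * exp (\<Lambda> * G z)"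
      by (intro mult_right_mono) auto
    then have "norm (poly p z / poly q z) \<le> M * exp (\<Lambda> * G z)" by (simp add: mult.assoc exp_add[symmetric])
    also have "\<dots> \<le> M * exp (real k * \<delta>)"
    proof -
      have "\<Lambda> * G z \<le> \<Lambda> * (\<delta> * e0 / C)" using Gz t(3) \<Lambda> by (intro mult_left_mono) auto
      also have "\<dots> = real k * \<delta>" using C(1) e0 by (simp add: \<Lambda>_def)
      finally show ?thesis using M0 by (intro mult_left_mono) auto
    qed
    finally show "norm (poly p z / poly q z) \<le> M * exp (real k * \<delta>)" .
  qed
qed

text \<open>A two-constants estimate in \<open>{G < e0} - A\<close> with the barrier \<open>w = robin + \<epsilon> - log_pot \<nu>\<close>, which
  is at least \<open>e0\<close> on \<open>{G = e0}\<close> and at most \<open>2 e1\<close> on \<open>{G = e1}\<close>.\<close>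

lemma rational_two_constants:
  assumes P: "compact P" and e0: "0 < e0" "\<And>a. a \<in> P \<Longrightarrow> e0 < G a" and \<beta>: "0 < \<beta>"
  obtains \<epsilon> where "0 < \<epsilon>"
    "\<And>A \<nu> k p q M a x. \<lbrakk>compact A; A \<subseteq> K; prob_on A \<nu>; \<And>z. z \<notin> A \<Longrightarrow> log_pot \<nu> z \<le> robin + \<epsilon>;
        admissible P k p q; \<And>x. x \<in> K \<Longrightarrow> norm (poly p x / poly q x) \<le> M;
        x \<in> K; norm (poly p x / poly q x) = M; 0 < a; \<And>x. x \<in> A \<Longrightarrow> norm (poly p x / poly q x) \<le> a\<rbrakk> \<Longrightarrow>
        M \<le> a * exp (real k * \<beta>)"
proof -
  obtain C where C: "0 < C"
    "\<And>k p q M z. \<lbrakk>admissible P k p q; \<And>x. x \<in> K \<Longrightarrow> norm (poly p x / poly q x) \<le> M; G z \<le> e0\<rbrakk> \<Longrightarrow>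
       norm (poly p z / poly q z) \<le> M * exp (real k * C)"
    using rational_crude_bound[OF P e0] by blast
  \<comment> \<open>With \<open>l = ln (M / a)\<close> the argument ends in
    \<open>l \<le> \<theta> * (l + k * C)\<close>. For \<theta> at most 1/2 this gives
    \<open>l \<le> 2 * \<theta> * k * C\<close>, at most \<open>k * \<beta>\<close> by the second
    condition. The level \<open>e1\<close> is half of \<open>\<theta> * e0\<close> because the
    barrier is only known to be at most \<open>2 * e1\<close> on it.\<close>
  define \<theta> where "\<theta> = min (1/2) (\<beta> / (2 * C))"
  have \<theta>: "0 < \<theta>" "\<theta> \<le> 1/2" "2 * \<theta> * C \<le> \<beta>"
  proof -
    show "0 < \<theta>" "\<theta> \<le> 1/2" using \<beta> C(1) by (auto simp: \<theta>_def)
    have "\<theta> \<le> \<beta> / (2 * C)" by (simp add: \<theta>_def)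
    then show "2 * \<theta> * C \<le> \<beta>" using C(1) by (simp add: field_simps)
  qed
  define e1 where "e1 = \<theta> * e0 / 2"
  have e1: "0 < e1" "e1 < e0"
  proof -
    show "0 < e1" using \<theta> e0 by (simp add: e1_def)
    have "\<theta> * e0 \<le> 1/2 * e0" using \<theta>(2) e0(1) by (intro mult_right_mono) auto
    then show "e1 < e0" using e0(1) by (simp add: e1_def)
  qed
  obtain \<epsilon> where \<epsilon>: "0 < \<epsilon>" "\<And>A \<nu>. \<lbrakk>compact A; A \<subseteq> K; prob_on A \<nu>; \<And>z. z \<notin> A \<Longrightarrow> log_pot \<nu> z \<le> robin + \<epsilon>\<rbrakk> \<Longrightarrow>
       (\<forall>z. z \<notin> K \<longrightarrow> G z \<le> robin + \<epsilon> - log_pot \<nu> z) \<and>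
       (\<forall>z. G z = e1 \<longrightarrow> robin + \<epsilon> - log_pot \<nu> z \<le> 2 * e1)"
    using potential_vs_G[OF e1(1)] by blast
  show ?thesis
  proof (rule that[OF \<epsilon>(1)])
    fix A \<nu> k p q M a x
    assume A: "compact A" "A \<subseteq> K" "prob_on A \<nu>" and pot: "\<And>z. z \<notin> A \<Longrightarrow> log_pot \<nu> z \<le> robin + \<epsilon>"
      and adm: "admissible P k p q" and M: "\<And>x. x \<in> K \<Longrightarrow> norm (poly p x / poly q x) \<le> M"
      and x: "x \<in> K" "norm (poly p x / poly q x) = M" and a: "0 < a" "\<And>x. x \<in> A \<Longrightarrow> norm (poly p x / poly q x) \<le> a"
    show "M \<le> a * exp (real k * \<beta>)"
    proof (cases "M \<le> a")
      case True
      also have "a * 1 \<le> a * exp (real k * \<beta>)" using a(1) \<beta> by (intro mult_left_mono) auto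
      finally show ?thesis by simp
    next
      case False
      then have aM: "a < M" by simp
      then have M0: "0 < M" using a(1) by linarith
      define w where "w z = robin + \<epsilon> - log_pot \<nu> z" for z
      have w: "0 \<le> w z" if "z \<notin> A" for z using pot[OF that] by (simp add: w_def)
      have wG: "G z \<le> w z" if "z \<notin> K" for z using \<epsilon>(2)[OF A pot] that by (simp add: w_def)
      have w1: "w z \<le> 2 * e1" if "G z = e1" for z using \<epsilon>(2)[OF A pot] that by (simp add: w_def)
      define l where "l = ln (M / a)"
      have l: "0 < l" "M = a * exp l" using aM a(1) by (auto simp: l_def)
      \<comment> \<open>Chosen so that on \<open>{G = e0}\<close> off \<open>A\<close>, where the
        barrier is at least \<open>e0\<close>, the crude bound \<open>M * exp (k * C)\<close> is
        damped to at most \<open>a\<close>.\<close>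
      define \<Lambda> where "\<Lambda> = (l + real k * C) / e0"
      have \<Lambda>: "0 \<le> \<Lambda>" using l C(1) e0 by (simp add: \<Lambda>_def)
      have oA: "open (- A)" using A(1) by (simp add: compact_imp_closed open_Compl)
      have reA: "real_part_on_discs w (- A)"
        unfolding w_def by (intro real_part_on_discs_diff real_part_on_discs_const log_pot_real_part_on_discs[OF A(3,1)])
      let ?S = "{z. G z < e0} - A"
      have main: "norm (poly p z / poly q z) * exp (- \<Lambda> * w z) \<le> a" if z: "z \<in> ?S" for z
      proof (rule maximum_principle[OF _ _ _ _ _ z, where f = "\<lambda>z. poly p z / poly q z" and h = "\<lambda>z. - \<Lambda> * w z"])
        show "open ?S" by (intro open_Diff open_G_less compact_imp_closed A)
        show "(\<lambda>z. poly p z / poly q z) holomorphic_on ?S"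
          by (rule rational_holomorphic[OF adm e0(2)]) auto
        show "real_part_on_discs (\<lambda>z. - \<Lambda> * w z) ?S"
          by (intro real_part_on_discs_cmult real_part_on_discs_subset[OF reA]) auto
      next
        fix \<xi> c assume \<xi>: "\<xi> \<in> frontier ?S" and c: "a < c"
        note f = frontier_G_less_diff[OF compact_imp_closed[OF A(1)] \<xi>]
        have rc: "((\<lambda>z. norm (poly p z / poly q z)) \<longlongrightarrow> norm (poly p \<xi> / poly q \<xi>)) (at \<xi> within ?S)"
          by (rule rational_continuous[OF adm e0(2) f(2)])
        from f(1) show "\<forall>\<^sub>F z in at \<xi> within ?S. norm (poly p z / poly q z) * exp (- \<Lambda> * w z) < c"
        proof
          \<comment> \<open>At points of \<open>A\<close> only the sign of the barrier enters, since
            \<open>log_pot \<nu>\<close> may have no limit there.\<close>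
          assume "\<xi> \<in> A"
          then have "norm (poly p \<xi> / poly q \<xi>) < c" using a(2) c by fastforce
          with rc have "\<forall>\<^sub>F z in at \<xi> within ?S. norm (poly p z / poly q z) < c" by (rule order_tendstoD(2))
          moreover have "\<forall>\<^sub>F z in at \<xi> within ?S. z \<in> ?S" by (simp add: eventually_at_filter)
          ultimately show ?thesis
          proof eventually_elim
            case (elim z)
            then have "0 \<le> \<Lambda> * w z" using w \<Lambda> by auto
            then have "norm (poly p z / poly q z) * exp (- \<Lambda> * w z) \<le> norm (poly p z / poly q z) * 1"
              by (intro mult_left_mono) auto
            then show ?case using elim by simp
          qed
        next
          assume \<xi>A: "\<xi> \<notin> A \<and> G \<xi> = e0"
          then have \<xi>K: "\<xi> \<notin> K" using G_on_K e0 by auto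
          have "(w \<longlongrightarrow> w \<xi>) (at \<xi>)"
            using real_part_on_discs_continuous[OF reA oA] oA \<xi>A
            by (simp add: continuous_on_eq_continuous_at isContD)
          then have "(w \<longlongrightarrow> w \<xi>) (at \<xi> within ?S)" by (rule tendsto_within_subset) simp
          then have lim: "((\<lambda>z. norm (poly p z / poly q z) * exp (- \<Lambda> * w z)) \<longlongrightarrow>
            norm (poly p \<xi> / poly q \<xi>) * exp (- \<Lambda> * w \<xi>)) (at \<xi> within ?S)"
            by (intro tendsto_mult tendsto_exp tendsto_const rc)
          have "e0 \<le> w \<xi>" using wG[OF \<xi>K] \<xi>A by simp
          then have "\<Lambda> * e0 \<le> \<Lambda> * w \<xi>" using \<Lambda> by (rule mult_left_mono)
          then have "l + real k * C \<le> \<Lambda> * w \<xi>" using e0 by (simp add: \<Lambda>_def)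
          then have "exp (- \<Lambda> * w \<xi>) \<le> exp (- (l + real k * C))" by simp
          moreover have "norm (poly p \<xi> / poly q \<xi>) \<le> M * exp (real k * C)"
            by (rule C(2)[OF adm M f(2)])
          ultimately have "norm (poly p \<xi> / poly q \<xi>) * exp (- \<Lambda> * w \<xi>)
              \<le> M * exp (real k * C) * exp (- (l + real k * C))"
            using M0 by (intro mult_mono) auto
          also have "\<dots> = a" unfolding l(2) by (simp add: mult.assoc exp_add[symmetric])
          finally have le: "norm (poly p \<xi> / poly q \<xi>) * exp (- \<Lambda> * w \<xi>) \<le> a" .
          show ?thesis by (rule order_tendstoD(2)[OF lim order.strict_trans1[OF le c]])
        qed
      next
        fix c
        show "\<forall>\<^sub>F z in at_infinity. z \<in> ?S \<longrightarrow> norm (poly p z / poly q z) * exp (- \<Lambda> * w z) < c"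
          using eventually_notin_G_less[of e0] by eventually_elim simp
      qed
      have level: "norm (poly p z / poly q z) \<le> a * exp (\<theta> * (l + real k * C))" if z: "G z = e1" for z
      proof -
        have "z \<in> ?S" using z e1 G_on_K A(2) by fastforce
        then have "norm (poly p z / poly q z) * exp (- \<Lambda> * w z) * exp (\<Lambda> * w z) \<le> a * exp (\<Lambda> * w z)"
          by (intro mult_right_mono main) auto
        then have "norm (poly p z / poly q z) \<le> a * exp (\<Lambda> * w z)" by (simp add: mult.assoc exp_add[symmetric])
        also have "\<dots> \<le> a * exp (\<theta> * (l + real k * C))"
        proof -
          have "\<Lambda> * w z \<le> \<Lambda> * (2 * e1)" using w1[OF z] \<Lambda> by (rule mult_left_mono)
          also have "\<dots> = \<theta> * (l + real k * C)" using e0 by (simp add: \<Lambda>_def e1_def)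
          finally show ?thesis using a(1) by simp
        qed
        finally show ?thesis .
      qed
      \<comment> \<open>The barrier is known to be small only on the level set
        \<open>{G = e1}\<close>, not on \<open>K\<close>. The bound reaches \<open>x\<close> by the
        maximum principle on the whole set \<open>{G < e1}\<close>, which contains \<open>K\<close>
        and no poles.\<close>
      have "norm (poly p x / poly q x) * exp (0::real) \<le> a * exp (\<theta> * (l + real k * C))"
      proof (rule maximum_principle[where S = "{z. G z < e1}" and h = "\<lambda>_. 0" and f = "\<lambda>z. poly p z / poly q z" and z = x])
        show "open {z. G z < e1}" by (rule open_G_less)
        show "(\<lambda>z. poly p z / poly q z) holomorphic_on {z. G z < e1}"
          by (rule rational_holomorphic[OF adm e0(2)]) (use e1 in auto)
        show "x \<in> {z. G z < e1}" using x G_on_K e1 by simp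
      next
        fix \<xi> c assume \<xi>: "\<xi> \<in> frontier {z. G z < e1}" and c: "a * exp (\<theta> * (l + real k * C)) < c"
        have G\<xi>: "G \<xi> = e1" using \<xi> frontier_G_less by blast
        have "((\<lambda>z. norm (poly p z / poly q z)) \<longlongrightarrow> norm (poly p \<xi> / poly q \<xi>)) (at \<xi> within {z. G z < e1})"
          by (rule rational_continuous[OF adm e0(2)]) (use e1 G\<xi> in auto)
        from order_tendstoD(2)[OF this, of c] show "\<forall>\<^sub>F z in at \<xi> within {z. G z < e1}. norm (poly p z / poly q z) * exp (0::real) < c"
          using level[OF G\<xi>] c by simp
      next
        fix c
        show "\<forall>\<^sub>F z in at_infinity. z \<in> {z. G z < e1} \<longrightarrow> norm (poly p z / poly q z) * exp (0::real) < c"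
          using eventually_notin_G_less[of e1] by eventually_elim simp
      qed (rule real_part_on_discs_const)
      then have "a * exp l \<le> a * exp (\<theta> * (l + real k * C))" using x(2) l(2) by simp
      then have "l \<le> \<theta> * (l + real k * C)" using a(1) by simp
      moreover have "\<theta> * l \<le> 1/2 * l" using \<theta>(2) l(1) by (intro mult_right_mono) auto
      ultimately have "l \<le> real k * (2 * \<theta> * C)" by (simp add: distrib_left mult_ac)
      also have "\<dots> \<le> real k * \<beta>" using \<theta>(3) by (intro mult_left_mono) auto
      finally show ?thesis unfolding l(2) using a(1) by simp
    qed
  qed
qed

end

text \<open>If \<open>|f|\<close> squared were at least \<open>X\<^sup>2\<close> divided by the mass
  of the ball at all points of \<open>K\<close> in the ball, its integral over the ball alone would
  reach \<open>X\<^sup>2\<close>. Taking \<open>X\<close> strictly above the L2 norm lets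
  \<open>X\<close> be positive even when the norm is 0.\<close>

lemma exists_small_value_in_ball:
  fixes f :: "complex \<Rightarrow> complex"
  assumes \<mu>: "finite_measure \<mu>" "sets \<mu> = sets borel" "AE z in \<mu>. z \<in> K"
    and f: "f \<in> borel_measurable borel" "\<And>z. z \<in> K \<Longrightarrow> norm (f z) \<le> M"
    and b: "0 < b" "b \<le> measure \<mu> (ball z r)" and X: "L2_norm \<mu> f < X"
  obtains w where "w \<in> ball z r" "w \<in> K" "(norm (f w))\<^sup>2 \<le> X\<^sup>2 / b"
proof -
  interpret finite_measure \<mu> by fact
  define B where "B = measure \<mu> (ball z r)"
  have B: "0 < B" "b \<le> B" using b by (auto simp: B_def)
  have nn: "0 \<le> (LINT z|\<mu>. (norm (f z))\<^sup>2)" by (intro Bochner_Integration.integral_nonneg) auto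
  have N0: "0 \<le> L2_norm \<mu> f" using nn by (simp add: L2_norm_def)
  have int: "integrable \<mu> (\<lambda>z. (norm (f z))\<^sup>2)"
  proof (rule integrable_const_bound[where B = "M\<^sup>2"])
    show "AE z in \<mu>. norm ((norm (f z))\<^sup>2) \<le> M\<^sup>2"
      using \<mu>(3) by eventually_elim (use f(2) in \<open>auto intro!: power_mono\<close>)
    show "(\<lambda>z. (norm (f z))\<^sup>2) \<in> borel_measurable \<mu>"
      using f(1) by (simp add: \<mu>(2) cong: measurable_cong_sets)
  qed
  have "\<exists>w\<in>ball z r \<inter> K. (norm (f w))\<^sup>2 < X\<^sup>2 / B"
  proof (rule ccontr)
    assume "\<not> ?thesis"
    then have ge: "X\<^sup>2 / B \<le> (norm (f w))\<^sup>2" if "w \<in> ball z r" "w \<in> K" for w using that by force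
    have "X\<^sup>2 = (LINT w|\<mu>. X\<^sup>2 / B * indicat_real (ball z r) w)"
      using B \<mu>(2) sets_eq_imp_space_eq[OF \<mu>(2)] by (simp add: B_def)
    also have "\<dots> \<le> (LINT z|\<mu>. (norm (f z))\<^sup>2)"
    proof (rule integral_mono_AE[OF _ int])
      show "integrable \<mu> (\<lambda>w. X\<^sup>2 / B * indicat_real (ball z r) w)"
        using \<mu>(2) by (intro integrable_mult_right) (auto simp: emeasure_eq_measure)
      show "AE w in \<mu>. X\<^sup>2 / B * indicat_real (ball z r) w \<le> (norm (f w))\<^sup>2"
        using \<mu>(3) by eventually_elim (use ge in \<open>auto simp: indicator_def\<close>)
    qed
    also have "\<dots> = (L2_norm \<mu> f)\<^sup>2" using nn by (simp add: L2_norm_def)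
    finally have "X \<le> L2_norm \<mu> f" using N0 by (rule power2_le_imp_le)
    then show False using X by simp
  qed
  then obtain w where w: "w \<in> ball z r" "w \<in> K" "(norm (f w))\<^sup>2 < X\<^sup>2 / B" by blast
  moreover have "X\<^sup>2 / B \<le> X\<^sup>2 / b" using b B by (intro divide_left_mono) auto
  ultimately show ?thesis using that by fastforce
qed

section \<open>From the L2 norm to the sup norm on \<open>K\<close>\<close>

context green_function
begin

lemma rational_Bernstein_Markov_estimate:
  assumes P: "compact P" "P \<subseteq> outside K"
    and \<mu>: "finite_measure \<mu>" "sets \<mu> = sets borel" "measure_supp \<mu> = K"
    and cap: "((\<lambda>r::real. log_cap {z \<in> K. r powr t \<le> measure \<mu> (ball z r)}) \<longlongrightarrow> log_cap K) (at_right 0)"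
    and \<eta>: "0 < \<eta>"
  shows "\<forall>\<^sub>F k in sequentially. \<forall>p q. admissible P k p q \<longrightarrow>
    sup_norm_on K (\<lambda>z. poly p z / poly q z) \<le>
      2 * exp (real k * (\<eta> * t / 2 + \<eta> / 4)) * L2_norm \<mu> (\<lambda>z. poly p z / poly q z)"
proof -
  have AE: "AE z in \<mu>. z \<in> K" using AE_in_measure_supp[OF \<mu>(2)] \<mu>(3) by simp
  obtain e0 where e0: "0 < e0" "\<And>a. a \<in> P \<Longrightarrow> e0 < G a"
  proof (cases "P = {}")
    case True
    then show ?thesis using that[of 1] by simp
  next
    case False
    obtain a0 where a0: "a0 \<in> P" "\<And>a. a \<in> P \<Longrightarrow> G a0 \<le> G a"
      using continuous_attains_inf[OF P(1) False continuous_on_subset[OF continuous_G subset_UNIV]] by blast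
    have "0 < G a0" using G_pos a0(1) P(2) by blast
    then show ?thesis using that[of "G a0 / 2"] a0(2) by force
  qed
  \<comment> \<open>Of the factor \<open>exp (- \<eta> * k)\<close> supplied by the radius, half
    pays for the bound on the function near \<open>K\<close> and a quarter for the two-constants
    step; the last quarter is left for the absorption.\<close>
  have \<beta>: "0 < \<eta> / 4" and \<delta>: "0 < \<eta> / 2" using \<eta> by auto
  obtain \<epsilon> where \<epsilon>: "0 < \<epsilon>" and two:
    "\<And>A \<nu> k p q M a x. \<lbrakk>compact A; A \<subseteq> K; prob_on A \<nu>; \<And>z. z \<notin> A \<Longrightarrow> log_pot \<nu> z \<le> robin + \<epsilon>;
        admissible P k p q; \<And>x. x \<in> K \<Longrightarrow> norm (poly p x / poly q x) \<le> M;
        x \<in> K; norm (poly p x / poly q x) = M; 0 < a; \<And>x. x \<in> A \<Longrightarrow> norm (poly p x / poly q x) \<le> a\<rbrakk> \<Longrightarrow>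
        M \<le> a * exp (real k * (\<eta> / 4))"
    using rational_two_constants[OF P(1) e0 \<beta>] by blast
  obtain \<rho> where \<rho>: "0 < \<rho>" "\<And>x z. x \<in> K \<Longrightarrow> dist x z < \<rho> \<Longrightarrow> G z < e0" and near:
    "\<And>k p q M x z. \<lbrakk>admissible P k p q; \<And>x. x \<in> K \<Longrightarrow> norm (poly p x / poly q x) \<le> M; x \<in> K; dist x z < \<rho>\<rbrakk> \<Longrightarrow>
       norm (poly p z / poly q z) \<le> M * exp (real k * (\<eta> / 2))"
    using rational_bound_near_K[OF P(1) e0 \<delta>] by blast
  define E where "E r = {z \<in> K. r powr t \<le> measure \<mu> (ball z r)}" for r :: real
  have EK: "E r \<subseteq> K" for r by (auto simp: E_def)
  have ev: "\<forall>\<^sub>F r in at_right 0. \<exists>A \<nu>. compact A \<and> A \<subseteq> E r \<and> prob_on A \<nu> \<and> (\<forall>z. z \<notin> A \<longrightarrow> log_pot \<nu> z \<le> robin + \<epsilon>)"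
    by (rule small_potential_measures[OF EK _ \<epsilon>]) (use cap in \<open>simp add: E_def\<close>)
  have lim0: "((\<lambda>k. exp (- c * real k)) \<longlongrightarrow> 0) sequentially" if c: "0 < c" for c :: real
  proof -
    have "(\<lambda>k. (exp (- c)) ^ k) \<longlonglongrightarrow> 0" using c by (intro LIMSEQ_power_zero) simp
    then show ?thesis by (simp add: exp_of_nat_mult[symmetric] mult.commute)
  qed
  have fl: "filterlim (\<lambda>k. exp (- \<eta> * real k)) (at_right 0) sequentially"
    using lim0[OF \<eta>] by (simp add: filterlim_at)
  have ev1: "\<forall>\<^sub>F k in sequentially. \<exists>A \<nu>. compact A \<and> A \<subseteq> E (exp (- \<eta> * real k)) \<and> prob_on A \<nu> \<and>
      (\<forall>z. z \<notin> A \<longrightarrow> log_pot \<nu> z \<le> robin + \<epsilon>)"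
    using eventually_compose_filterlim[OF ev fl] .
  have ev2: "\<forall>\<^sub>F k in sequentially. exp (- \<eta> * real k) < \<rho> / 2"
    by (rule order_tendstoD(2)[OF lim0[OF \<eta>]]) (use \<rho> in simp)
  \<comment> \<open>The 8 offsets the \<open>4 / \<rho>\<close> of the derivative estimate and
    leaves the factor 1/2, with which the displacement term is absorbed into the left side.\<close>
  have ev3: "\<forall>\<^sub>F k in sequentially. exp (- (\<eta> / 4) * real k) < \<rho> / 8"
    by (rule order_tendstoD(2)[OF lim0[OF \<beta>]]) (use \<rho> in simp)
  show ?thesis
    using ev1 ev2 ev3
  proof eventually_elim
    case (elim k)
    define \<rho>k where "\<rho>k = exp (- \<eta> * real k)"
    obtain A \<nu> where A: "compact A" "A \<subseteq> E \<rho>k" "prob_on A \<nu>" "\<And>z. z \<notin> A \<Longrightarrow> log_pot \<nu> z \<le> robin + \<epsilon>"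
      using elim(1) unfolding \<rho>k_def by blast
    have AK: "A \<subseteq> K" using A(2) EK by blast
    have \<rho>k: "0 < \<rho>k" "\<rho>k < \<rho> / 2" using elim(2) by (auto simp: \<rho>k_def)
    show ?case
    proof (intro allI impI)
      fix p q assume adm: "admissible P k p q"
      define f where "f z = poly p z / poly q z" for z
      have fm: "f \<in> borel_measurable borel"
        unfolding f_def by (intro borel_measurable_divide borel_measurable_continuous_onI continuous_intros)
      have contf: "continuous_on K f"
        unfolding f_def
        by (intro holomorphic_on_imp_continuous_on rational_holomorphic[OF adm e0(2)]) (use G_on_K e0 in auto)
      then have "continuous_on K (\<lambda>z. norm (f z))" by (intro continuous_intros)
      from continuous_attains_sup[OF compact_K nonempty_K this]
      obtain x where x: "x \<in> K" "\<And>z. z \<in> K \<Longrightarrow> norm (f z) \<le> norm (f x)" by blast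
      define M where "M = norm (f x)"
      have M: "norm (f z) \<le> M" if "z \<in> K" for z using x(2)[OF that] by (simp add: M_def)
      have M0: "0 \<le> M" by (simp add: M_def)
      have sup: "sup_norm_on K f = M"
        unfolding sup_norm_on_def using x M by (intro cSup_eq_maximum) (auto simp: M_def)
      \<comment> \<open>\<open>X\<close> replaces the L2 norm, which might be 0, because the
        two-constants step works with a positive bound \<open>a\<close>; it decreases to the norm
        afterwards.\<close>
      have main: "M \<le> 2 * exp (real k * (\<eta> * t / 2 + \<eta> / 4)) * X" if X: "L2_norm \<mu> f < X" for X
      proof -
        have "0 \<le> L2_norm \<mu> f" by (simp add: L2_norm_def Bochner_Integration.integral_nonneg)
        then have X0: "0 < X" using X by linarith
        define a where "a = X * exp (real k * (\<eta> * t / 2)) + 4 / \<rho> * M * exp (- (\<eta> / 2) * real k)"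
        have a0: "0 < a" unfolding a_def using X0 \<rho>(1) M0 by (intro add_pos_nonneg mult_pos_pos mult_nonneg_nonneg) auto
        have fa: "norm (f z) \<le> a" if z: "z \<in> A" for z
        proof -
          have zK: "z \<in> K" using z AK by blast
          have mb: "exp (- \<eta> * t * real k) \<le> measure \<mu> (ball z \<rho>k)"
          proof -
            have "\<rho>k powr t = exp (- \<eta> * t * real k)" by (simp add: powr_def \<rho>k_def)
            then show ?thesis using A(2) z by (auto simp: E_def)
          qed
          obtain w where w: "w \<in> ball z \<rho>k" "w \<in> K" "(norm (f w))\<^sup>2 \<le> X\<^sup>2 / exp (- \<eta> * t * real k)"
            using exists_small_value_in_ball[OF \<mu>(1,2) AE fm M exp_gt_zero mb X] by blast
          have "X\<^sup>2 / exp (- \<eta> * t * real k) = (X * exp (real k * (\<eta> * t / 2)))\<^sup>2"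
          proof -
            have e1: "(exp (real k * (\<eta> * t / 2)))\<^sup>2 = exp (\<eta> * t * real k)"
              unfolding exp_double[symmetric] by simp
            have e2: "exp (- \<eta> * t * real k) = inverse (exp (\<eta> * t * real k))"
              by (simp add: exp_minus)
            show ?thesis unfolding power_mult_distrib e1 e2 by (simp add: divide_inverse)
          qed
          then have "(norm (f w))\<^sup>2 \<le> (X * exp (real k * (\<eta> * t / 2)))\<^sup>2" using w(3) by simp
          then have fw: "norm (f w) \<le> X * exp (real k * (\<eta> * t / 2))"
            by (rule power2_le_imp_le) (use X0 in simp)
          have "norm (f z - f w) \<le> 4 * (M * exp (real k * (\<eta> / 2))) / \<rho> * dist z w"
          proof (rule norm_diff_le_of_bounded_holomorphic)
            show "f holomorphic_on ball z \<rho>"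
              unfolding f_def by (rule rational_holomorphic[OF adm e0(2)]) (use \<rho>(2)[OF zK] in \<open>auto intro: less_imp_le\<close>)
            show "norm (f y) \<le> M * exp (real k * (\<eta> / 2))" if "y \<in> ball z \<rho>" for y
              unfolding f_def by (rule near[OF adm _ zK]) (use M that in \<open>auto simp: f_def\<close>)
            show "0 < \<rho>" by (rule \<rho>(1))
            show "dist z w \<le> \<rho> / 2" using w(1) \<rho>k by simp
          qed
          also have "\<dots> \<le> 4 * (M * exp (real k * (\<eta> / 2))) / \<rho> * \<rho>k"
            using w(1) M0 \<rho>(1) by (intro mult_left_mono) auto
          also have "\<dots> = 4 / \<rho> * M * exp (- (\<eta> / 2) * real k)"
          proof -
            have "exp (real k * (\<eta> / 2)) * \<rho>k = exp (- (\<eta> / 2) * real k)"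
              unfolding \<rho>k_def exp_add[symmetric] by (simp add: algebra_simps)
            then show ?thesis by (simp add: mult_ac)
          qed
          finally have "norm (f z - f w) \<le> 4 / \<rho> * M * exp (- (\<eta> / 2) * real k)" .
          then show ?thesis
            using fw norm_triangle_ineq[of "f z - f w" "f w"] unfolding a_def by simp
        qed
        have "M \<le> a * exp (real k * (\<eta> / 4))"
          by (rule two[OF A(1) AK A(3,4) adm _ x(1) _ a0]) (use M fa in \<open>auto simp: f_def M_def\<close>)
        also have "\<dots> = X * exp (real k * (\<eta> * t / 2 + \<eta> / 4)) + 4 / \<rho> * M * exp (- (\<eta> / 4) * real k)"
        proof -
          have "exp (- (\<eta> / 2) * real k) * exp (real k * (\<eta> / 4)) = exp (- (\<eta> / 4) * real k)"
            unfolding exp_add[symmetric] by (simp add: algebra_simps)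
          moreover have "exp (real k * (\<eta> * t / 2)) * exp (real k * (\<eta> / 4)) = exp (real k * (\<eta> * t / 2 + \<eta> / 4))"
            unfolding exp_add[symmetric] by (simp add: algebra_simps)
          ultimately show ?thesis unfolding a_def distrib_right mult.assoc by simp
        qed
        also have "4 / \<rho> * M * exp (- (\<eta> / 4) * real k) \<le> M / 2"
        proof -
          have "4 / \<rho> * M * exp (- (\<eta> / 4) * real k) \<le> 4 / \<rho> * M * (\<rho> / 8)"
            using elim(3) M0 \<rho>(1) by (intro mult_left_mono) auto
          then show ?thesis using \<rho>(1) by simp
        qed
        finally have "M \<le> X * exp (real k * (\<eta> * t / 2 + \<eta> / 4)) + M / 2" by simp
        then have "M \<le> 2 * (X * exp (real k * (\<eta> * t / 2 + \<eta> / 4)))" by linarith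
        then show ?thesis by (simp only: mult_ac)
      qed
      have "M / (2 * exp (real k * (\<eta> * t / 2 + \<eta> / 4))) \<le> L2_norm \<mu> f"
      proof (rule dense_ge)
        fix X assume "L2_norm \<mu> f < X"
        from main[OF this] show "M / (2 * exp (real k * (\<eta> * t / 2 + \<eta> / 4))) \<le> X"
          by (simp add: divide_le_eq mult_ac)
      qed
      then have "M \<le> 2 * exp (real k * (\<eta> * t / 2 + \<eta> / 4)) * L2_norm \<mu> f"
        by (simp add: divide_le_eq mult_ac)
      then show "sup_norm_on K (\<lambda>z. poly p z / poly q z) \<le>
        2 * exp (real k * (\<eta> * t / 2 + \<eta> / 4)) * L2_norm \<mu> (\<lambda>z. poly p z / poly q z)"
        using sup by (simp add: f_def[abs_def])
    qed
  qed
qed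

end

section \<open>Passage to the limit superior\<close>

theorem theorem3p1:
  fixes K P :: "complex set" and \<mu> :: "complex measure"
  assumes "regular_compact K"
    and "compact P" and "P \<subseteq> outside K"
    and "\<mu> \<in> pos_measures K" and "measure_supp \<mu> = K"
    and "\<exists>t::real>0.
           ((\<lambda>r::real. log_cap {z \<in> K. r powr t \<le> measure \<mu> (ball z r)}) \<longlongrightarrow> log_cap K) (at_right 0)"
  shows "rational_Bernstein_Markov K \<mu> P"
proof (cases "K = {}")
  \<comment> \<open>The Green function setting assumes a nonempty \<open>K\<close>; for empty
    \<open>K\<close> every function vanishes on \<open>K\<close>, so all ratios take the default
    value 0.\<close>
  case True
  then show ?thesis
    by (simp add: rational_Bernstein_Markov_def norm_ratio_root_def Limsup_const)
next
  case False
  obtain g where "compact K" "classical_green_function K g"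
    using assms(1) by (auto simp: regular_compact_def)
  then interpret green_function K "\<lambda>z. if z \<in> outside K then g z else 0"
    using False by (intro classical_green_function_imp_green_function)
  obtain t where t: "t > 0" and cap:
    "((\<lambda>r::real. log_cap {z \<in> K. r powr t \<le> measure \<mu> (ball z r)}) \<longlongrightarrow> log_cap K) (at_right 0)"
    using assms(6) by blast
  have fin: "finite_measure \<mu>" and s: "sets \<mu> = sets borel"
    using assms(4) by (auto simp: pos_measures_def)
  show ?thesis
    unfolding rational_Bernstein_Markov_def
  proof (intro allI impI)
    fix p q :: "nat \<Rightarrow> complex poly"
    assume pq: "\<forall>k. degree (p k) \<le> k \<and> degree (q k) \<le> k \<and> {z. poly (q k) z = 0} \<subseteq> P"
    have adm: "admissible P k (p k) (q k)" for k using pq by (simp add: admissible_def)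
    show "limsup (\<lambda>k. norm_ratio_root K \<mu> (\<lambda>z. poly (p k) z / poly (q k) z) k) \<le> 1"
    proof (rule dense_ge)
      fix c :: ereal assume c: "1 < c"
      \<comment> \<open>Half of \<open>ln c\<close>: one \<gamma> is the exponential rate of the
        estimate, the other absorbs its constant factor 2 as soon as \<open>k * \<gamma>\<close> is
        at least 1.\<close>
      define \<gamma> where "\<gamma> = (if c = \<infinity> then 1 else ln (real_of_ereal c) / 2)"
      have \<gamma>: "0 < \<gamma>" "ereal (exp (2 * \<gamma>)) \<le> c"
        using c by (cases c; simp add: \<gamma>_def)+
      \<comment> \<open>The estimate has the rate \<open>\<eta> * t / 2 + \<eta> / 4\<close>, which
        this choice makes equal to \<gamma>.\<close>
      define \<eta> where "\<eta> = \<gamma> / (t / 2 + 1 / 4)"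
      have \<eta>: "0 < \<eta>" "\<eta> * t / 2 + \<eta> / 4 = \<gamma>"
      proof -
        have "0 < t / 2 + 1 / 4" using t by linarith
        then show "0 < \<eta>" using \<gamma>(1) by (simp add: \<eta>_def)
        have "\<eta> * (t / 2 + 1 / 4) = \<gamma>" using \<open>0 < t / 2 + 1 / 4\<close> by (simp add: \<eta>_def)
        then show "\<eta> * t / 2 + \<eta> / 4 = \<gamma>" by (simp add: distrib_left)
      qed
      have "\<forall>\<^sub>F k in sequentially. norm_ratio_root K \<mu> (\<lambda>z. poly (p k) z / poly (q k) z) k \<le> ereal (exp (2 * \<gamma>))"
        using rational_Bernstein_Markov_estimate[OF assms(2,3) fin s assms(5) cap \<eta>(1)]
          eventually_gt_at_top[of 0] eventually_ge_at_top[of "nat \<lceil>1 / \<gamma>\<rceil>"]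
      proof eventually_elim
        case (elim k)
        define f where "f z = poly (p k) z / poly (q k) z" for z
        have est: "sup_norm_on K f \<le> 2 * exp (real k * \<gamma>) * L2_norm \<mu> f"
          using elim(1) adm[of k] \<eta>(2) by (simp add: f_def[abs_def])
        have k: "0 < k" "1 \<le> real k * \<gamma>"
        proof -
          show "0 < k" by (rule elim(2))
          have "1 / \<gamma> \<le> real k" using elim(3) by linarith
          then show "1 \<le> real k * \<gamma>" using \<gamma>(1) by (simp add: field_simps)
        qed
        have contf: "continuous_on K (\<lambda>z. norm (f z))"
        proof -
          have "poly (q k) z \<noteq> 0" if "z \<in> K" for z
            using that pq assms(3) outside_no_overlap[of K] by blast
          then show ?thesis unfolding f_def by (intro continuous_intros) auto
        qed
        have bdd: "bdd_above ((\<lambda>z. norm (f z)) ` K)"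
          by (rule bounded_imp_bdd_above[OF compact_imp_bounded[OF compact_continuous_image[OF contf compact_K]]])
        have L20: "0 \<le> L2_norm \<mu> f" by (simp add: L2_norm_def Bochner_Integration.integral_nonneg)
        have "norm_ratio_root K \<mu> f k \<le> ereal (exp (2 * \<gamma>))"
        proof (cases "\<forall>z\<in>K. f z = 0")
          case True
          then show ?thesis by (simp add: norm_ratio_root_def)
        next
          case False
          then obtain x where x: "x \<in> K" "f x \<noteq> 0" by blast
          have "0 < norm (f x)" using x by simp
          also have "norm (f x) \<le> sup_norm_on K f"
            unfolding sup_norm_on_def using x(1) bdd by (rule cSUP_upper)
          finally have pos: "0 < sup_norm_on K f" .
          \<comment> \<open>The estimate excludes the infinite ratio: a vanishing L2 norm would
            force the sup norm on \<open>K\<close> to be 0.\<close>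
          then have L2: "0 < L2_norm \<mu> f" using est L20 by (cases "L2_norm \<mu> f = 0") auto
          have "sup_norm_on K f / L2_norm \<mu> f \<le> 2 * exp (real k * \<gamma>)"
            using est L2 by (simp add: divide_le_eq)
          also have "\<dots> \<le> exp (real k * \<gamma>) * exp (real k * \<gamma>)"
          proof (rule mult_right_mono)
            show "2 \<le> exp (real k * \<gamma>)" using k(2) exp_ge_add_one_self[of "real k * \<gamma>"] by linarith
          qed simp
          also have "\<dots> = exp (real k * (2 * \<gamma>))" by (simp add: exp_add[symmetric])
          finally have "(sup_norm_on K f / L2_norm \<mu> f) powr (1 / real k) \<le> exp (real k * (2 * \<gamma>)) powr (1 / real k)"
            using pos L2 by (intro powr_mono2) auto
          also have "\<dots> = exp (2 * \<gamma>)" using k(1) by (simp add: powr_def)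
          finally show ?thesis using False L2 by (simp add: norm_ratio_root_def)
        qed
        then show ?case by (simp add: f_def[abs_def])
      qed
      then have "limsup (\<lambda>k. norm_ratio_root K \<mu> (\<lambda>z. poly (p k) z / poly (q k) z) k) \<le> ereal (exp (2 * \<gamma>))"
        by (rule Limsup_bounded)
      then show "limsup (\<lambda>k. norm_ratio_root K \<mu> (\<lambda>z. poly (p k) z / poly (q k) z) k) \<le> c"
        using \<gamma>(2) by (rule order_trans)
    qed
  qed
qed

end
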